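(* Let $d\ge 2$ be a fixed integer and consider the random complex process $\{Y^d_t(n)\}_{t\ge 0}$. Let $I_t$ denote the number of isolated $(d-1)$-dimensional faces in the complex $Y^d_t(n)$. Fix any $\delta>0$ and define $t_0 = t_0(n)$ by $p(t_0) = (d-1+\delta)\log n/n$, where $p(t) = 1-e^{-t}$. Then with high probability, for all times $t\ge t_0$ simultaneously, $$H_{d-1}(Y^d_t(n),\mathbb{Q}) \cong \mathbb{Q}^{I_t}.$$
   Context: The process $\{Y^d_t(n)\}_{t\ge0}$ is defined as follows. For each $(d+1)$-subset $\sigma$ of $[n]=\{1,\dots,n\}$ (each possible $d$-face) let $T_\sigma$ be an independent exponential random variable of mean $1$. $Y^d_t(n)$ is the simplicial complex on vertex set $[n]$ consisting of the complete $(d-1)$-skeleton of the simplex on $[n]$ together with all $d$-faces $\sigma$ with $T_\sigma \le t$. For fixed $t$ each $d$-face is thus present independently with probability $p(t)=1-e^{-t}$. A $(d-1)$-face is isolated if it is not contained in any $d$-face of the complex. "With high probability" means with probability tending to $1$ as $n\to\infty$. *)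

theory Defs
  imports
    "HOL-Probability.Probability" "HOL-Library.Poly_Mapping" "HOL-Algebra.AbelCoset"
    "Jordan_Normal_Form.VS_Connect"
begin

section \<open>Vector spaces: quotients and isomorphism\<close>

text \<open>As for \<^const>\<open>module_vec\<close>, the multiplicative fields of a module record carry no information.\<close>

definition quotient_module ::
    "('r, 'a, 'm) module_scheme \<Rightarrow> 'a set \<Rightarrow> ('r, 'a set) module" where
  "quotient_module V W =
    \<lparr>carrier = a_rcosets\<^bsub>V\<^esub> W, mult = undefined, one = undefined,
     zero = W, add = set_add V,
     smult = (\<lambda>r C. \<Union>x\<in>C. W +>\<^bsub>V\<^esub> (r \<odot>\<^bsub>V\<^esub> x))\<rparr>"

definition vs_isomorphic ::
    "('r, 'k) ring_scheme \<Rightarrow> ('r, 'a, 'm) module_scheme \<Rightarrow> ('r, 'b, 'n) module_scheme \<Rightarrow> bool" where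
  "vs_isomorphic K V W \<longleftrightarrow>
    (\<exists>f. linear_map K V W f \<and> bij_betw f (carrier V) (carrier W))"


section \<open>Rational simplicial homology of an abstract simplicial complex\<close>

text \<open>A complex is given by its set of nonempty finite faces; the empty set is not a face, so this
  is unreduced homology.  Each face is oriented by the order of its vertices.\<close>

definition simplices :: "'v set set \<Rightarrow> nat \<Rightarrow> 'v set set" where
  "simplices X k = {\<sigma> \<in> X. card \<sigma> = k + 1}"

definition chain_space :: "'v set set \<Rightarrow> nat \<Rightarrow> (rat, 'v set \<Rightarrow>\<^sub>0 rat) module" where
  "chain_space X k =
    \<lparr>carrier = {c. Poly_Mapping.keys c \<subseteq> simplices X k}, mult = undefined, one = undefined,
     zero = 0, add = (+), smult = (\<lambda>q. Poly_Mapping.map ((*) q))\<rparr>"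

text \<open>The exponent is the position of \<open>v\<close> in the increasing list of vertices of \<open>\<sigma>\<close>, so that
  \<open>[v\<^sub>0, \<dots>, v\<^sub>k]\<close> is sent to the alternating sum of its facets.\<close>

definition boundary :: "nat \<Rightarrow> ('v::linorder set \<Rightarrow>\<^sub>0 rat) \<Rightarrow> ('v set \<Rightarrow>\<^sub>0 rat)" where
  "boundary k c =
    (if k = 0 then 0
     else \<Sum>\<sigma>\<in>Poly_Mapping.keys c. \<Sum>v\<in>\<sigma>.
       Poly_Mapping.single (\<sigma> - {v}) ((-1) ^ card {u \<in> \<sigma>. u < v} * Poly_Mapping.lookup c \<sigma>))"

definition cycles :: "'v::linorder set set \<Rightarrow> nat \<Rightarrow> ('v set \<Rightarrow>\<^sub>0 rat) set" where
  "cycles X k = {c \<in> carrier (chain_space X k). boundary k c = 0}"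

definition boundaries :: "'v::linorder set set \<Rightarrow> nat \<Rightarrow> ('v set \<Rightarrow>\<^sub>0 rat) set" where
  "boundaries X k = boundary (k + 1) ` carrier (chain_space X (k + 1))"

definition homology :: "'v::linorder set set \<Rightarrow> nat \<Rightarrow> (rat, ('v set \<Rightarrow>\<^sub>0 rat) set) module" where
  "homology X k = quotient_module (chain_space X k\<lparr>carrier := cycles X k\<rparr>) (boundaries X k)"

definition isolated_simplices :: "'v set set \<Rightarrow> nat \<Rightarrow> 'v set set" where
  "isolated_simplices X k =
    {\<sigma> \<in> simplices X k. \<not> (\<exists>\<tau> \<in> simplices X (k + 1). \<sigma> \<subseteq> \<tau>)}"


section \<open>The random complex process\<close>

definition possible_faces :: "nat \<Rightarrow> nat \<Rightarrow> nat set set" where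
  "possible_faces d n = {\<sigma>. \<sigma> \<subseteq> {1..n} \<and> card \<sigma> = d + 1}"

locale face_clocks = prob_space M for M :: "'a measure" +
  fixes d n :: nat and T :: "nat set \<Rightarrow> 'a \<Rightarrow> real"
  assumes clocks_indep: "indep_vars (\<lambda>_. borel) T (possible_faces d n)"
    and clocks_exponential:
      "\<And>\<sigma>. \<sigma> \<in> possible_faces d n \<Longrightarrow> distributed M lborel (T \<sigma>) (exponential_density 1)"

definition process_complex :: "nat \<Rightarrow> nat \<Rightarrow> (nat set \<Rightarrow> real) \<Rightarrow> real \<Rightarrow> nat set set" where
  "process_complex d n clock t =
    {\<sigma>. \<sigma> \<subseteq> {1..n} \<and> \<sigma> \<noteq> {} \<and> card \<sigma> \<le> d} \<union> {\<sigma> \<in> possible_faces d n. clock \<sigma> \<le> t}"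

end

theory Submission imports Defs "HOL-Real_Asymp.Real_Asymp" begin

text \<open>Restricting cycles to the isolated \<open>(d - 1)\<close>-faces gives a map from the homology to \<open>\<rat>\<close> to the
  power \<open>I\<^sub>t\<close>.  It is onto once every isolated face has a coface without further isolated facets.  It is
  injective once every cocycle modulo two is a coboundary plus a set of isolated faces: dividing by two
  repeatedly, an integral cocycle then takes values divisible by all powers of two on a cycle that vanishes
  on the isolated faces.

  At time \<open>t\<^sub>0\<close> the condition on cocycles follows from a union bound.  A smallest exceptional cocycle \<open>A\<close>
  is connected through faces of the complex, so it is carried by a connected set of fewer than \<open>|A|\<close> present
  \<open>d\<close>-faces, and no face of its coboundary, which has at least \<open>n |A| / (d + 1)\<close> elements
  and nearly \<open>n |A|\<close> for small \<open>A\<close>, is present.  There are only about \<open>n\<^sup>d (C n)\<^sup>k\<close> connected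
  sets of \<open>k\<close> faces, so each present face costs a factor \<open>C log n\<close> only.

  The condition persists unless two faces isolated at time \<open>t\<^sub>0\<close> are covered for the first time by
  the same \<open>d\<close>-face, and this is unlikely.\<close>

section \<open>Set systems as cochains modulo two\<close>

text \<open>Rational cocycles form an infinite space, which no union bound can run through; modulo
  two a cocycle is a finite set of faces, it has a size, and a smallest one can be chosen. The price
  is the lift back to the rationals. The exponents shape the rest. Put c = d - 1 + \<delta>. Up to
  powers of log n there are n^d candidates \<open>A\<close> with m elements, and for bounded m each
  survives with probability about n^(-c m). For m = 1 this leaves n^(1 - \<delta>): these are the
  isolated faces, which are to be expected at the starting time if \<delta> < 1 and have to be
  divided out. For m \<ge> 2 the exponent is at most d - 2 c = 2 - d - 2 \<delta>, which is negative
  for d \<ge> 2. For large m the factor (C log n)^m is no longer negligible, but there the weaker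
  expansion n m / (d + 1) still gives n^(-m/3), which beats it. No estimate is made for single later
  times: outside an event about first covers, everything after the starting time follows
  deterministically.\<close>

definition ksets :: "nat \<Rightarrow> nat \<Rightarrow> nat set set" where
  "ksets n k = {\<sigma>. \<sigma> \<subseteq> {1..n} \<and> card \<sigma> = k}"

definition odd_facets :: "'v set set \<Rightarrow> 'v set \<Rightarrow> bool" where
  "odd_facets A \<tau> \<longleftrightarrow> odd (card {v \<in> \<tau>. \<tau> - {v} \<in> A})"

text \<open>\<open>k\<close> counts the vertices of the resulting sets: for \<open>k = d\<close>
  they are (d-1)-faces, for \<open>k = Suc d\<close> they are d-faces. Only members of
  \<open>\<phi>\<close> with one vertex fewer contribute, so any set system may stand for
  \<open>\<phi>\<close>.\<close>

definition cobdry :: "nat \<Rightarrow> nat \<Rightarrow> nat set set \<Rightarrow> nat set set" where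
  "cobdry n k \<phi> = {\<sigma> \<in> ksets n k. odd_facets \<phi> \<sigma>}"

definition cocycle :: "nat \<Rightarrow> nat \<Rightarrow> nat set set \<Rightarrow> nat set set \<Rightarrow> bool" where
  "cocycle n d Y A \<longleftrightarrow> A \<subseteq> ksets n d \<and> (\<forall>\<tau>\<in>Y. \<not> odd_facets A \<tau>)"

definition isolated :: "nat \<Rightarrow> nat \<Rightarrow> nat set set \<Rightarrow> nat set set" where
  "isolated n d Y = {\<sigma> \<in> ksets n d. \<not> (\<exists>\<tau>\<in>Y. \<sigma> \<subseteq> \<tau>)}"

text \<open>An isolated face is a cocycle on its own, since no face in \<open>Y\<close> contains it,
  and need not be a coboundary. Triviality is therefore taken modulo sets of isolated faces.\<close>

definition trivial_cocycle :: "nat \<Rightarrow> nat \<Rightarrow> nat set set \<Rightarrow> nat set set \<Rightarrow> bool" where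
  "trivial_cocycle n d Y A \<longleftrightarrow>
    (\<exists>\<phi> J. J \<subseteq> isolated n d Y \<and> A = sym_diff (cobdry n d \<phi>) J)"

text \<open>The sign occurring in \<open>boundary\<close>. The ring is left open because integers
  serve for parities and integral cochains, rationals for homology.\<close>

definition fsign :: "'v::linorder set \<Rightarrow> 'v \<Rightarrow> 'a::comm_ring_1" where
  "fsign \<sigma> v = (-1) ^ card {u \<in> \<sigma>. u < v}"

lemma finite_ksets [simp]: "finite (ksets n k)"
  by (rule finite_subset[of _ "Pow {1..n}"]) (auto simp: ksets_def)

lemma ksetsD: "\<sigma> \<in> ksets n k \<Longrightarrow> finite \<sigma>" "\<sigma> \<in> ksets n k \<Longrightarrow> card \<sigma> = k"
  "\<sigma> \<in> ksets n k \<Longrightarrow> \<sigma> \<subseteq> {1..n}"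
  by (auto simp: ksets_def intro: finite_subset)

lemma ksets_remove: "\<tau> \<in> ksets n (Suc k) \<Longrightarrow> v \<in> \<tau> \<Longrightarrow> \<tau> - {v} \<in> ksets n k"
  by (auto simp: ksets_def)

lemma ksets_insert: "\<sigma> \<in> ksets n k \<Longrightarrow> v \<in> {1..n} \<Longrightarrow> v \<notin> \<sigma> \<Longrightarrow> insert v \<sigma> \<in> ksets n (Suc k)"
  using ksetsD(1)[of \<sigma> n k] by (auto simp: ksets_def)

lemma facet_cases:
  assumes "\<sigma> \<in> ksets n k" "\<tau> \<in> ksets n (Suc k)" "\<sigma> \<subseteq> \<tau>"
  obtains v where "v \<in> \<tau>" "v \<notin> \<sigma>" "\<sigma> = \<tau> - {v}" "\<tau> = insert v \<sigma>"
proof -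
  have "card (\<tau> - \<sigma>) = 1"
    using assms ksetsD[OF assms(1)] ksetsD[OF assms(2)] by (simp add: card_Diff_subset)
  then obtain v where "\<tau> - \<sigma> = {v}" by (auto simp: card_1_singleton_iff)
  then have "v \<in> \<tau>" "v \<notin> \<sigma>" "\<sigma> = \<tau> - {v}" "\<tau> = insert v \<sigma>" using assms(3) by auto
  then show thesis by (rule that)
qed

lemma odd_card_sym_diff:
  assumes "finite A" "finite B"
  shows "odd (card (sym_diff A B)) \<longleftrightarrow> odd (card A) \<noteq> odd (card B)"
proof -
  have "card (sym_diff A B) = card (A - B) + card (B - A)"
    using assms by (subst card_Un_disjoint) auto
  moreover have "card A = card (A \<inter> B) + card (A - B)" "card B = card (A \<inter> B) + card (B - A)"
    using card_Int_Diff[OF assms(1), of B] card_Int_Diff[OF assms(2), of A] by (simp_all add: Int_commute)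
  ultimately show ?thesis by simp presburger
qed

lemma odd_facets_sym_diff:
  assumes "finite \<tau>"
  shows "odd_facets (sym_diff A B) \<tau> \<longleftrightarrow> odd_facets A \<tau> \<noteq> odd_facets B \<tau>"
proof -
  have "{v \<in> \<tau>. \<tau> - {v} \<in> sym_diff A B} = sym_diff {v \<in> \<tau>. \<tau> - {v} \<in> A} {v \<in> \<tau>. \<tau> - {v} \<in> B}"
    by auto
  then show ?thesis
    using odd_card_sym_diff[of "{v \<in> \<tau>. \<tau> - {v} \<in> A}" "{v \<in> \<tau>. \<tau> - {v} \<in> B}"] assms
    by (simp add: odd_facets_def)
qed

lemma cobdry_sym_diff: "cobdry n k (sym_diff \<phi> \<psi>) = sym_diff (cobdry n k \<phi>) (cobdry n k \<psi>)"
  using odd_facets_sym_diff ksetsD(1) unfolding cobdry_def by blast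

lemma cobdry_empty [simp]: "cobdry n k {} = {}"
  by (simp add: cobdry_def odd_facets_def)

section \<open>Signs, parities and the square of the coboundary\<close>

lemma fsign_cancel:
  assumes "finite \<tau>" "u \<in> \<tau>" "v \<in> \<tau>" "u < v"
  shows "(fsign \<tau> v * fsign (\<tau> - {v}) u :: 'a::comm_ring_1) = - (fsign \<tau> u * fsign (\<tau> - {u}) v)"
proof -
  \<comment> \<open>Removing the larger vertex \<open>v\<close> leaves the position of
    \<open>u\<close> unchanged, while removing \<open>u\<close> lowers the position of
    \<open>v\<close> by one.\<close>
  have 1: "{w \<in> \<tau> - {v}. w < u} = {w \<in> \<tau>. w < u}" using assms by auto
  have "{w \<in> \<tau>. w < v} = insert u {w \<in> \<tau> - {u}. w < v}" using assms by auto
  then have 2: "card {w \<in> \<tau>. w < v} = Suc (card {w \<in> \<tau> - {u}. w < v})" using assms(1) by simp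
  show ?thesis unfolding fsign_def 1 2 by (simp add: mult.commute)
qed

text \<open>The ordered pairs of removed vertices cancel in twos, \<open>(v, u)\<close> against
  \<open>(u, v)\<close>.\<close>

lemma signed_coboundary_twice:
  fixes f :: "'v::linorder set \<Rightarrow> 'a::comm_ring_1"
  assumes "finite \<tau>"
  shows "(\<Sum>v\<in>\<tau>. fsign \<tau> v * (\<Sum>u\<in>\<tau> - {v}. fsign (\<tau> - {v}) u * f (\<tau> - {v} - {u}))) = 0"
proof -
  define g where "g = (\<lambda>(v, u). fsign \<tau> v * fsign (\<tau> - {v}) u * f (\<tau> - {v} - {u}))"
  define P where "P = {(v, u) \<in> \<tau> \<times> \<tau>. u < v}"
  define Q where "Q = {(v, u) \<in> \<tau> \<times> \<tau>. v < u}"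
  have fin: "finite P" "finite Q"
    using assms by (auto simp: P_def Q_def intro: finite_subset[of _ "\<tau> \<times> \<tau>"])
  have "(\<Sum>v\<in>\<tau>. fsign \<tau> v * (\<Sum>u\<in>\<tau> - {v}. fsign (\<tau> - {v}) u * f (\<tau> - {v} - {u})))
      = (\<Sum>v\<in>\<tau>. \<Sum>u\<in>\<tau> - {v}. g (v, u))"
    by (simp add: g_def sum_distrib_left mult.assoc)
  also have "\<dots> = sum g (Sigma \<tau> (\<lambda>v. \<tau> - {v}))"
    using assms by (subst sum.Sigma) auto
  also have "Sigma \<tau> (\<lambda>v. \<tau> - {v}) = P \<union> Q" by (auto simp: P_def Q_def)
  also have "sum g (P \<union> Q) = sum g P + sum g Q"
    using fin by (rule sum.union_disjoint) (auto simp: P_def Q_def)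
  also have "sum g Q = (\<Sum>(v, u)\<in>P. g (u, v))"
    by (rule sum.reindex_bij_witness[of _ "\<lambda>(v, u). (u, v)" "\<lambda>(v, u). (u, v)"])
      (auto simp: P_def Q_def)
  also have "\<dots> = (\<Sum>x\<in>P. - g x)"
  proof (rule sum.cong)
    fix x assume "x \<in> P"
    then obtain v u where x: "x = (v, u)" "v \<in> \<tau>" "u \<in> \<tau>" "u < v" by (auto simp: P_def)
    have "\<tau> - {v} - {u} = \<tau> - {u} - {v}" by auto
    then show "(case x of (v, u) \<Rightarrow> g (u, v)) = - g x"
      using fsign_cancel[OF assms x(3,2,4), where 'a='a] by (simp add: x(1) g_def)
  qed simp
  finally show ?thesis by (simp add: sum_negf)
qed

lemma odd_fsign [simp]: "odd (fsign \<sigma> v :: int)"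
  by (simp add: fsign_def)

text \<open>Signs are odd, so the parity of a signed integral coboundary ignores them. Any integral
  lift \<open>w\<close> of \<open>A\<close> modulo two will do, as long as it is correct on the
  facets of \<open>\<sigma>\<close>.\<close>

lemma odd_facets_iff_sum:
  fixes w :: "'v::linorder set \<Rightarrow> int"
  assumes "finite \<sigma>" "\<And>v. v \<in> \<sigma> \<Longrightarrow> odd (w (\<sigma> - {v})) \<longleftrightarrow> \<sigma> - {v} \<in> A"
  shows "odd_facets A \<sigma> \<longleftrightarrow> odd (\<Sum>v\<in>\<sigma>. fsign \<sigma> v * w (\<sigma> - {v}))"
proof -
  have "{v \<in> \<sigma>. odd (fsign \<sigma> v * w (\<sigma> - {v}))} = {v \<in> \<sigma>. \<sigma> - {v} \<in> A}"
    using assms(2) by auto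
  then show ?thesis
    using assms(1) by (simp add: even_sum_iff odd_facets_def)
qed

text \<open>Two lifts are chained: \<open>f\<close> lifts \<open>\<phi>\<close>, and its signed
  coboundary \<open>w\<close> lifts \<open>cobdry n k \<phi>\<close>. The signed coboundary of
  \<open>w\<close> is zero, hence even.\<close>

lemma cobdry_cobdry:
  assumes "\<tau> \<in> ksets n (Suc k)"
  shows "\<not> odd_facets (cobdry n k \<phi>) \<tau>"
proof -
  define f where "f = (\<lambda>\<rho>. if \<rho> \<in> \<phi> then 1 else 0 :: int)"
  define w where "w = (\<lambda>\<sigma>. \<Sum>u\<in>\<sigma>. fsign \<sigma> u * f (\<sigma> - {u}))"
  have fin: "finite \<tau>" using ksetsD[OF assms] by simp
  have "odd (w (\<tau> - {v})) \<longleftrightarrow> \<tau> - {v} \<in> cobdry n k \<phi>" if "v \<in> \<tau>" for v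
    unfolding w_def using ksets_remove[OF assms that] fin
    by (subst odd_facets_iff_sum[of "\<tau> - {v}" f \<phi>, symmetric]) (auto simp: f_def cobdry_def)
  then have "odd_facets (cobdry n k \<phi>) \<tau> \<longleftrightarrow> odd (\<Sum>v\<in>\<tau>. fsign \<tau> v * w (\<tau> - {v}))"
    by (rule odd_facets_iff_sum[OF fin])
  then show ?thesis by (simp add: w_def signed_coboundary_twice[OF fin])
qed

section \<open>Expansion of coboundaries in the full simplex\<close>

text \<open>Cone homotopy: \<open>\<phi>\<close> is the link of \<open>v\<close> in
  \<open>A\<close>. On faces containing \<open>v\<close> its coboundary agrees with
  \<open>A\<close>; at a face \<open>\<sigma>\<close> avoiding \<open>v\<close> the disagreement is
  the value of the coboundary of \<open>A\<close> at the cone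
  \<open>insert v \<sigma>\<close>.\<close>

lemma cone_sym_diff:
  assumes A: "A \<subseteq> ksets n d" and v: "v \<in> {1..n}"
  defines "\<phi> \<equiv> {\<rho>. v \<notin> \<rho> \<and> insert v \<rho> \<in> A}"
  shows "sym_diff A (cobdry n d \<phi>) \<subseteq> {\<sigma> \<in> ksets n d. v \<notin> \<sigma> \<and> insert v \<sigma> \<in> cobdry n (Suc d) A}"
proof
  fix \<sigma> assume \<sigma>: "\<sigma> \<in> sym_diff A (cobdry n d \<phi>)"
  then have \<sigma>k: "\<sigma> \<in> ksets n d" using A by (auto simp: cobdry_def)
  have fin: "finite \<sigma>" using ksetsD[OF \<sigma>k] by simp
  have iff: "\<sigma> \<in> A \<longleftrightarrow> \<not> odd_facets \<phi> \<sigma>" using \<sigma> \<sigma>k by (auto simp: cobdry_def)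
  have nv: "v \<notin> \<sigma>"
  proof
    assume "v \<in> \<sigma>"
    then have "{u \<in> \<sigma>. \<sigma> - {u} \<in> \<phi>} = (if \<sigma> \<in> A then {v} else {})"
      by (auto simp: \<phi>_def insert_absorb)
    then show False using iff by (auto simp: odd_facets_def split: if_splits)
  qed
  have "{u \<in> insert v \<sigma>. insert v \<sigma> - {u} \<in> A} =
      (if \<sigma> \<in> A then insert v {u \<in> \<sigma>. \<sigma> - {u} \<in> \<phi>} else {u \<in> \<sigma>. \<sigma> - {u} \<in> \<phi>})"
  proof -
    have "insert v \<sigma> - {u} \<in> A \<longleftrightarrow> \<sigma> - {u} \<in> \<phi>" if "u \<in> \<sigma>" for u
    proof -
      have "u \<noteq> v" using that nv by auto
      then have "insert v \<sigma> - {u} = insert v (\<sigma> - {u})" by auto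
      then show ?thesis using nv by (simp add: \<phi>_def)
    qed
    moreover have "insert v \<sigma> - {v} = \<sigma>" using nv by auto
    ultimately show ?thesis by auto
  qed
  then have "odd_facets A (insert v \<sigma>)"
    using iff nv fin by (auto simp: odd_facets_def split: if_splits)
  then show "\<sigma> \<in> {\<sigma> \<in> ksets n d. v \<notin> \<sigma> \<and> insert v \<sigma> \<in> cobdry n (Suc d) A}"
    using \<sigma>k nv ksets_insert[OF \<sigma>k v nv] by (simp add: cobdry_def)
qed

text \<open>For each apex \<open>v\<close>, minimality against the cone over \<open>v\<close> yields
  at least \<open>card A\<close> faces of the coboundary that contain \<open>v\<close>. Summing over
  the n apices counts every such face once per vertex, that is \<open>Suc d\<close> times.\<close>

lemma coboundary_expansion:
  assumes A: "A \<subseteq> ksets n d"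
    and min: "\<And>\<phi>. card A \<le> card (sym_diff A (cobdry n d \<phi>))"
  shows "n * card A \<le> Suc d * card (cobdry n (Suc d) A)"
proof -
  define C where "C = cobdry n (Suc d) A"
  have fC: "finite C" by (auto simp: C_def cobdry_def)
  have "card A \<le> card {\<tau> \<in> C. v \<in> \<tau>}" if v: "v \<in> {1..n}" for v
  proof -
    have "card A \<le> card (sym_diff A (cobdry n d {\<rho>. v \<notin> \<rho> \<and> insert v \<rho> \<in> A}))"
      by (rule min)
    also have "\<dots> \<le> card {\<sigma> \<in> ksets n d. v \<notin> \<sigma> \<and> insert v \<sigma> \<in> C}"
      unfolding C_def by (rule card_mono[OF _ cone_sym_diff[OF A v]]) simp
    also have "\<dots> \<le> card {\<tau> \<in> C. v \<in> \<tau>}"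
      by (rule card_inj_on_le[where f="insert v"]) (auto simp: inj_on_def fC insert_ident)
    finally show ?thesis .
  qed
  then have "(\<Sum>v\<in>{1..n}. card A) \<le> (\<Sum>v\<in>{1..n}. card {\<tau> \<in> C. v \<in> \<tau>})"
    by (rule sum_mono)
  also have "\<dots> = Suc d * card C"
  proof (rule sum_multicount)
    show "\<forall>\<tau>\<in>C. card {v \<in> {1..n}. v \<in> \<tau>} = Suc d"
    proof
      fix \<tau> assume "\<tau> \<in> C"
      then have "\<tau> \<in> ksets n (Suc d)" by (simp add: C_def cobdry_def)
      then have "{v \<in> {1..n}. v \<in> \<tau>} = \<tau>" "card \<tau> = Suc d" using ksetsD by fast+
      then show "card {v \<in> {1..n}. v \<in> \<tau>} = Suc d" by simp
    qed
  qed (auto simp: fC)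
  finally show ?thesis by (simp add: C_def)
qed

text \<open>A member \<open>\<sigma>\<close> of \<open>A\<close> and a vertex in
  \<open>good \<sigma>\<close> span a face with exactly one facet in \<open>A\<close>, and every
  other member of \<open>A\<close> spoils at most one vertex. The factor close to n, instead of n /
  (d + 1), is what bounded \<open>card A\<close> requires.\<close>

lemma coboundary_expansion_small:
  assumes A: "A \<subseteq> ksets n d"
  shows "card A * (n - d - card A) \<le> card (cobdry n (Suc d) A)"
proof -
  have fA: "finite A" by (rule finite_subset[OF A]) simp
  define good where "good \<sigma> = {v \<in> {1..n} - \<sigma>. \<forall>\<sigma>'\<in>A. \<sigma>' \<subseteq> insert v \<sigma> \<longrightarrow> \<sigma>' = \<sigma>}" for \<sigma>
  have cg: "n - d - card A \<le> card (good \<sigma>)" if \<sigma>: "\<sigma> \<in> A" for \<sigma>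
  proof -
    have \<sigma>k: "\<sigma> \<in> ksets n d" using A \<sigma> by auto
    have "({1..n} - \<sigma>) - good \<sigma> \<subseteq> (\<lambda>\<sigma>'. the_elem (\<sigma>' - \<sigma>)) ` A"
    proof
      fix v assume "v \<in> ({1..n} - \<sigma>) - good \<sigma>"
      then obtain \<sigma>' where s: "v \<in> {1..n}" "v \<notin> \<sigma>" "\<sigma>' \<in> A" "\<sigma>' \<subseteq> insert v \<sigma>" "\<sigma>' \<noteq> \<sigma>"
        by (auto simp: good_def)
      have "\<sigma>' \<in> ksets n d" using A s by auto
      then have "\<not> \<sigma>' \<subseteq> \<sigma>" using s(5) \<sigma>k ksetsD[of _ n d] card_subset_eq[of \<sigma> \<sigma>'] by metis
      then have "\<sigma>' - \<sigma> = {v}" using s by auto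
      then have "v = the_elem (\<sigma>' - \<sigma>)" by simp
      then show "v \<in> (\<lambda>\<sigma>'. the_elem (\<sigma>' - \<sigma>)) ` A" using s(3) by auto
    qed
    then have "card (({1..n} - \<sigma>) - good \<sigma>) \<le> card A"
      by (rule surj_card_le[OF fA])
    moreover have "card (({1..n} - \<sigma>) - good \<sigma>) = card ({1..n} - \<sigma>) - card (good \<sigma>)"
      by (rule card_Diff_subset) (auto simp: good_def)
    moreover have "card ({1..n} - \<sigma>) = n - d"
      using ksetsD[OF \<sigma>k] by (simp add: card_Diff_subset)
    ultimately show ?thesis by linarith
  qed
  have "card A * (n - d - card A) \<le> (\<Sum>\<sigma>\<in>A. card (good \<sigma>))"
    using sum_mono[of A "\<lambda>_. n - d - card A" "\<lambda>\<sigma>. card (good \<sigma>)"] cg by simp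
  also have "\<dots> = card (Sigma A good)"
    using fA by (intro card_SigmaI[symmetric]) (auto simp: good_def)
  also have "\<dots> \<le> card (cobdry n (Suc d) A)"
  proof (rule card_inj_on_le[where f="\<lambda>(\<sigma>, v). insert v \<sigma>"])
    show "inj_on (\<lambda>(\<sigma>, v). insert v \<sigma>) (Sigma A good)"
    proof (rule inj_onI, clarify)
      fix \<sigma> v \<sigma>' v' assume h: "\<sigma> \<in> A" "v \<in> good \<sigma>" "\<sigma>' \<in> A" "v' \<in> good \<sigma>'" "insert v \<sigma> = insert v' \<sigma>'"
      then have "\<sigma>' = \<sigma>" by (auto simp: good_def)
      then show "\<sigma> = \<sigma>' \<and> v = v'" using h by (auto simp: good_def)
    qed
    show "(\<lambda>(\<sigma>, v). insert v \<sigma>) ` Sigma A good \<subseteq> cobdry n (Suc d) A"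
    proof clarify
      fix \<sigma> v assume h: "\<sigma> \<in> A" "v \<in> good \<sigma>"
      have "\<sigma> \<in> ksets n d" using A h by auto
      moreover have nv: "v \<in> {1..n}" "v \<notin> \<sigma>" using h by (auto simp: good_def)
      moreover have "{u \<in> insert v \<sigma>. insert v \<sigma> - {u} \<in> A} = {v}"
      proof -
        have "u = v" if "u \<in> insert v \<sigma>" "insert v \<sigma> - {u} \<in> A" for u
        proof -
          have "insert v \<sigma> - {u} = \<sigma>" using h(2) that(2) by (auto simp: good_def)
          then show ?thesis using nv that by auto
        qed
        moreover have "insert v \<sigma> - {v} = \<sigma>" using nv by auto
        ultimately show ?thesis using h(1) by auto
      qed
      ultimately show "insert v \<sigma> \<in> cobdry n (Suc d) A"
        using ksets_insert by (simp add: cobdry_def odd_facets_def)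
    qed
  qed (auto simp: cobdry_def)
  finally show ?thesis .
qed

section \<open>Connected sets\<close>

text \<open>Connectedness through cuts instead of paths: an edge leaves every proper nonempty part.
  Splitting a cocycle, growing a set and comparing two clusters all use it in this form.\<close>

definition rel_connected :: "('a \<Rightarrow> 'a \<Rightarrow> bool) \<Rightarrow> 'a set \<Rightarrow> bool" where
  "rel_connected R K \<longleftrightarrow> (\<forall>L. L \<subset> K \<and> L \<noteq> {} \<longrightarrow> (\<exists>u\<in>L. \<exists>w\<in>K - L. R u w))"

lemma rel_connected_mono:
  "rel_connected R K \<Longrightarrow> (\<And>u w. u \<in> K \<Longrightarrow> w \<in> K \<Longrightarrow> R u w \<Longrightarrow> S u w) \<Longrightarrow> rel_connected S K"
  unfolding rel_connected_def by (meson DiffD1 psubsetD)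

lemma rel_connected_insert:
  assumes K: "rel_connected R K" and "u \<in> K" "R u w" "R w u"
  shows "rel_connected R (insert w K)"
proof (cases "w \<in> K")
  case False
  show ?thesis unfolding rel_connected_def
  proof (intro allI impI)
    fix L assume "L \<subset> insert w K \<and> L \<noteq> {}"
    then have L: "L \<subset> insert w K" "L \<noteq> {}" by auto
    consider "L \<inter> K = {}" | "L \<inter> K = K" | "L \<inter> K \<noteq> {}" "L \<inter> K \<subset> K" by auto
    then show "\<exists>u\<in>L. \<exists>v\<in>insert w K - L. R u v"
    proof cases
      case 1
      then have "w \<in> L" using L by auto
      then show ?thesis using assms(2,4) 1 by blast
    next
      case 2
      then have "w \<notin> L" using L by auto
      then show ?thesis using assms(2,3) 2 by blast
    next
      case 3
      then show ?thesis using K[unfolded rel_connected_def, rule_format, of "L \<inter> K"] by blast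
    qed
  qed
qed (simp add: K insert_absorb)

lemma sum_Pow_weights:
  fixes x :: real
  assumes "finite W"
  shows "(\<Sum>S\<in>Pow W. x ^ card S * (1 - x) ^ card (W - S)) = 1"
  using prod_add[OF assms, of "\<lambda>_. x" "\<lambda>_. 1 - x"] by simp

text \<open>Site percolation: let every vertex be open with probability \<open>x = 1 / (2 * \<Delta>)\<close>.  The events
  that a given connected set is the open cluster of the root are disjoint, so their probabilities
  sum to at most one, and each of them is at least \<open>x ^ (k - 1) / 2 ^ k\<close>.\<close>

lemma card_connected_le:
  fixes R :: "'a \<Rightarrow> 'a \<Rightarrow> bool"
  assumes V: "finite V" and r: "r \<in> V" and \<Delta>: "\<Delta> > 0"
    and deg: "\<And>u. u \<in> V \<Longrightarrow> card {w \<in> V. R u w} \<le> \<Delta>"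
  shows "card {K. K \<subseteq> V \<and> r \<in> K \<and> card K = k \<and> rel_connected R K} \<le> (2 * \<Delta>) ^ (k - 1) * 2 ^ k"
proof -
  define F where "F = {K. K \<subseteq> V \<and> r \<in> K \<and> card K = k \<and> rel_connected R K}"
  define x where "x = 1 / (2 * real \<Delta>)"
  have x: "0 < x" "x < 1" using \<Delta> by (auto simp: x_def)
  define U where "U = V - {r}"
  define N where "N K = (\<Union>u\<in>K. {w \<in> V. R u w}) - K" for K
  define E where "E K = {S. S \<subseteq> U \<and> K - {r} \<subseteq> S \<and> S \<inter> N K = {}}" for K
  define wt where "wt S = x ^ card S * (1 - x) ^ card (U - S)" for S
  have fU: "finite U" using V by (simp add: U_def)
  have fF: "finite F" by (rule finite_subset[of _ "Pow V"]) (auto simp: F_def V)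
  have fE: "finite (E K)" for K by (rule finite_subset[of _ "Pow U"]) (auto simp: E_def fU)
  \<comment> \<open>Were \<open>K'\<close> not inside \<open>K\<close>, an edge would lead from
    \<open>K \<inter> K'\<close> to a site \<open>w\<close> of \<open>K' - K\<close>, which is
    closed if \<open>K\<close> is the cluster and open if \<open>K'\<close> is.\<close>
  have sub: "K' \<subseteq> K" if h: "K \<in> F" "K' \<in> F" "S \<in> E K" "S \<in> E K'" for K K' S
  proof (rule ccontr)
    assume "\<not> K' \<subseteq> K"
    then have "K \<inter> K' \<subset> K'" "K \<inter> K' \<noteq> {}" using h by (auto simp: F_def)
    then obtain u w where uw: "u \<in> K" "w \<in> K' - K" "R u w"
      using h(2) unfolding F_def rel_connected_def by blast
    then have "w \<in> N K" using h by (auto simp: F_def N_def)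
    moreover have "w \<in> S" using uw h by (auto simp: F_def E_def)
    ultimately show False using h(3) by (auto simp: E_def)
  qed
  have disj: "\<forall>K\<in>F. \<forall>K'\<in>F. K \<noteq> K' \<longrightarrow> E K \<inter> E K' = {}" using sub by blast
  have lower: "x ^ (k - 1) * (1 / 2) ^ k \<le> sum wt (E K)" if K: "K \<in> F" for K
  proof -
    have KV: "K \<subseteq> V" "r \<in> K" "card K = k" using K by (auto simp: F_def)
    have fK: "finite K" using KV V finite_subset by auto
    define W where "W = U - K - N K"
    have fN: "finite (N K)" by (rule finite_subset[of _ V]) (auto simp: N_def V)
    have NV: "N K \<subseteq> U" "N K \<inter> K = {}" using KV by (auto simp: N_def U_def)
    have "card (N K) \<le> card (\<Union>u\<in>K. {w \<in> V. R u w})"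
      unfolding N_def using V fK by (intro card_mono) auto
    also have "\<dots> \<le> (\<Sum>u\<in>K. card {w \<in> V. R u w})" using fK by (rule card_UN_le)
    also have "\<dots> \<le> (\<Sum>u\<in>K. \<Delta>)" using deg KV by (intro sum_mono) auto
    finally have cN: "card (N K) \<le> \<Delta> * k" using KV by (simp add: mult.commute)
    \<comment> \<open>Bernoulli's inequality is the reason for the choice of \<open>x\<close>:
      closing all neighbours of one site costs at most a factor 2, hence closing the boundary of
      \<open>K\<close> at most \<open>2 ^ k\<close>.\<close>
    have "1 / 2 = 1 + real \<Delta> * (- x)" using \<Delta> by (simp add: x_def)
    also have "\<dots> \<le> (1 + (- x)) ^ \<Delta>" by (rule Bernoulli_inequality) (use x in auto)
    finally have "(1 / 2) ^ k \<le> ((1 - x) ^ \<Delta>) ^ k" by (intro power_mono) auto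
    also have "\<dots> = (1 - x) ^ (\<Delta> * k)" by (simp add: power_mult)
    also have "\<dots> \<le> (1 - x) ^ card (N K)" using cN x by (intro power_decreasing) auto
    finally have "x ^ (k - 1) * (1 / 2) ^ k \<le> x ^ (k - 1) * (1 - x) ^ card (N K)"
      using x by (intro mult_left_mono) auto
    \<comment> \<open>The sites of \<open>W\<close> are neither in \<open>K\<close> nor next to it,
      so their state is free and their weights sum to one.\<close>
    also have "\<dots> = x ^ (k - 1) * (1 - x) ^ card (N K) * (\<Sum>S\<in>Pow W. x ^ card S * (1 - x) ^ card (W - S))"
      using sum_Pow_weights[of W x] fU by (simp add: W_def)
    also have "\<dots> = (\<Sum>S\<in>Pow W. wt ((K - {r}) \<union> S))"
      unfolding sum_distrib_left
    proof (rule sum.cong)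
      fix S assume S: "S \<in> Pow W"
      have fS: "finite S" using S fU finite_subset[of S U] by (auto simp: W_def)
      have "card ((K - {r}) \<union> S) = (k - 1) + card S"
        using S fS fK KV by (subst card_Un_disjoint) (auto simp: W_def)
      moreover have "U - ((K - {r}) \<union> S) = N K \<union> (W - S)"
        using S NV KV by (auto simp: W_def U_def)
      moreover have "card (N K \<union> (W - S)) = card (N K) + card (W - S)"
        using fN fU by (intro card_Un_disjoint) (auto simp: W_def)
      ultimately show "x ^ (k - 1) * (1 - x) ^ card (N K) * (x ^ card S * (1 - x) ^ card (W - S)) =
          wt ((K - {r}) \<union> S)"
        by (simp add: wt_def power_add)
    qed simp
    also have "\<dots> = sum wt ((\<lambda>S. (K - {r}) \<union> S) ` Pow W)"
      by (subst sum.reindex) (auto simp: inj_on_def W_def)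
    also have "\<dots> \<le> sum wt (E K)"
    proof (rule sum_mono2[OF fE])
      show "(\<lambda>S. (K - {r}) \<union> S) ` Pow W \<subseteq> E K"
        using KV NV by (auto simp: E_def W_def U_def)
    qed (use x in \<open>auto simp: wt_def\<close>)
    finally show ?thesis .
  qed
  have "real (card F) * (x ^ (k - 1) * (1 / 2) ^ k) \<le> (\<Sum>K\<in>F. sum wt (E K))"
    using sum_mono[of F "\<lambda>_. x ^ (k - 1) * (1 / 2) ^ k" "\<lambda>K. sum wt (E K)"] lower by simp
  also have "\<dots> = sum wt (\<Union>K\<in>F. E K)"
    using fF fE disj by (intro sum.UNION_disjoint[symmetric]) auto
  also have "\<dots> \<le> sum wt (Pow U)"
    by (rule sum_mono2) (use x fU in \<open>auto simp: wt_def E_def\<close>)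
  also have "\<dots> = 1" unfolding wt_def by (rule sum_Pow_weights[OF fU])
  finally have "real (card F) \<le> real ((2 * \<Delta>) ^ (k - 1) * 2 ^ k)"
    using \<Delta> by (simp add: x_def power_one_over divide_simps split: if_splits)
  then show ?thesis unfolding F_def by (simp only: of_nat_le_iff)
qed

text \<open>\<open>K\<close> grows together with the covered part \<open>B\<close> of
  \<open>A\<close>. One coface covers the first two members, and each further member costs at most
  one more coface, so \<open>K\<close> stays smaller than \<open>B\<close>. A new coface shares with
  \<open>K\<close> the member of \<open>B\<close> from which it was reached, which keeps
  \<open>K\<close> connected.\<close>

lemma connecting_sets:
  assumes "finite A" "2 \<le> card A"
    and conn: "rel_connected (\<lambda>\<sigma> \<sigma>'. \<exists>\<tau>\<in>Y. \<sigma> \<subseteq> \<tau> \<and> \<sigma>' \<subseteq> \<tau>) A"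
  obtains K where "K \<subseteq> Y" "finite K" "K \<noteq> {}" "card K < card A" "\<forall>\<sigma>\<in>A. \<exists>\<tau>\<in>K. \<sigma> \<subseteq> \<tau>"
    "rel_connected (\<lambda>\<tau> \<tau>'. \<exists>\<sigma>\<in>A. \<sigma> \<subseteq> \<tau> \<and> \<sigma> \<subseteq> \<tau>') K"
proof -
  let ?R = "\<lambda>\<tau> \<tau>'. \<exists>\<sigma>\<in>A. \<sigma> \<subseteq> \<tau> \<and> \<sigma> \<subseteq> \<tau>'"
  have step: "\<exists>\<sigma>\<in>B. \<exists>\<sigma>'\<in>A - B. \<exists>\<tau>\<in>Y. \<sigma> \<subseteq> \<tau> \<and> \<sigma>' \<subseteq> \<tau>" if "B \<subseteq> A" "B \<noteq> {}" "card B < card A" for B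
  proof -
    have "B \<subset> A" using that by auto
    then show ?thesis using conn[unfolded rel_connected_def, THEN spec, of B] that(2) by simp
  qed
  have "j \<le> card A \<Longrightarrow> \<exists>B K. B \<subseteq> A \<and> card B = j \<and> K \<subseteq> Y \<and> finite K \<and> K \<noteq> {} \<and> card K < j \<and>
      (\<forall>\<sigma>\<in>B. \<exists>\<tau>\<in>K. \<sigma> \<subseteq> \<tau>) \<and> rel_connected ?R K" if "2 \<le> j" for j
    using that
  proof (induction j rule: nat_induct_at_least)
    case base
    obtain \<sigma> where "\<sigma> \<in> A" using assms(2) by fastforce
    then obtain \<sigma>' \<tau> where h: "\<sigma>' \<in> A" "\<sigma>' \<noteq> \<sigma>" "\<tau> \<in> Y" "\<sigma> \<subseteq> \<tau>" "\<sigma>' \<subseteq> \<tau>"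
      using step[of "{\<sigma>}"] assms(2) by auto
    have "rel_connected ?R {\<tau>}" by (auto simp: rel_connected_def)
    then show ?case using h \<open>\<sigma> \<in> A\<close>
      by (intro exI[of _ "{\<sigma>, \<sigma>'}"] exI[of _ "{\<tau>}"]) auto
  next
    case (Suc j)
    then obtain B K where h: "B \<subseteq> A" "card B = j" "K \<subseteq> Y" "finite K" "K \<noteq> {}" "card K < j"
      "\<forall>\<sigma>\<in>B. \<exists>\<tau>\<in>K. \<sigma> \<subseteq> \<tau>" "rel_connected ?R K" by auto
    have "B \<noteq> {}" using h Suc by auto
    then obtain \<sigma> \<sigma>' \<tau> where g: "\<sigma> \<in> B" "\<sigma>' \<in> A - B" "\<tau> \<in> Y" "\<sigma> \<subseteq> \<tau>" "\<sigma>' \<subseteq> \<tau>"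
      using step[of B] h Suc by auto
    obtain \<tau>' where t: "\<tau>' \<in> K" "\<sigma> \<subseteq> \<tau>'" using h(7) g(1) by blast
    have fB: "finite B" using h(1) assms(1) finite_subset by auto
    have "rel_connected ?R (insert \<tau> K)"
      by (rule rel_connected_insert[OF h(8) t(1)]) (use t g h in auto)
    moreover have "card (insert \<tau> K) < Suc j" using h by (simp add: card_insert_if)
    moreover have "card (insert \<sigma>' B) = Suc j" using g h fB by simp
    ultimately show ?case using h g
      by (intro exI[of _ "insert \<sigma>' B"] exI[of _ "insert \<tau> K"]) auto
  qed
  from this[OF assms(2) order_refl] obtain B K where h: "B \<subseteq> A" "card B = card A" "K \<subseteq> Y"
    "finite K" "K \<noteq> {}" "card K < card A" "\<forall>\<sigma>\<in>B. \<exists>\<tau>\<in>K. \<sigma> \<subseteq> \<tau>" "rel_connected ?R K" by auto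
  then have "B = A" using card_subset_eq assms(1) by blast
  then show thesis using that[of K] h by auto
qed

section \<open>Smallest nontrivial cocycles\<close>

lemma cocycle_sym_diff_cobdry:
  assumes "cocycle n d Y A" "Y \<subseteq> ksets n (Suc d)"
  shows "cocycle n d Y (sym_diff A (cobdry n d \<phi>))"
  using assms cobdry_cobdry odd_facets_sym_diff[OF ksetsD(1)] unfolding cocycle_def
  by (fastforce simp: cobdry_def)

lemma trivial_cocycle_sym_diff:
  assumes "trivial_cocycle n d Y A" "trivial_cocycle n d Y B"
  shows "trivial_cocycle n d Y (sym_diff A B)"
proof -
  obtain \<phi> J \<psi> L where h: "J \<subseteq> isolated n d Y" "A = sym_diff (cobdry n d \<phi>) J"
    "L \<subseteq> isolated n d Y" "B = sym_diff (cobdry n d \<psi>) L"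
    using assms unfolding trivial_cocycle_def by blast
  have "sym_diff A B = sym_diff (cobdry n d (sym_diff \<phi> \<psi>)) (sym_diff J L)"
    unfolding h cobdry_sym_diff by blast
  moreover have "sym_diff J L \<subseteq> isolated n d Y" using h by auto
  ultimately show ?thesis unfolding trivial_cocycle_def by blast
qed

lemma trivial_cocycle_cobdry: "trivial_cocycle n d Y (cobdry n d \<phi>)"
  unfolding trivial_cocycle_def by (intro exI[of _ \<phi>] exI[of _ "{}"]) auto

lemma trivial_cocycle_isolated: "J \<subseteq> isolated n d Y \<Longrightarrow> trivial_cocycle n d Y J"
  unfolding trivial_cocycle_def by (intro exI[of _ "{}"] exI[of _ J]) auto

text \<open>Along a cut that no face of \<open>Y\<close> crosses, \<open>A\<close> would split into
  two smaller cocycles; these are trivial by minimality, and then so is \<open>A\<close>. A single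
  face that is not isolated is no cocycle, hence \<open>2 \<le> card A\<close>. Adding a coboundary
  keeps \<open>A\<close> nontrivial, so \<open>A\<close> is smallest in its class, as
  \<open>coboundary_expansion\<close> demands.\<close>

lemma minimal_nontrivial_cocycle:
  assumes Y: "Y \<subseteq> ksets n (Suc d)" and ex: "\<exists>A. cocycle n d Y A \<and> \<not> trivial_cocycle n d Y A"
  obtains A K where "A \<subseteq> ksets n d" "2 \<le> card A" "K \<subseteq> Y" "K \<noteq> {}" "card K < card A"
    "\<forall>\<sigma>\<in>A. \<exists>\<tau>\<in>K. \<sigma> \<subseteq> \<tau>"
    "rel_connected (\<lambda>\<tau> \<tau>'. \<exists>\<sigma>\<in>ksets n d. \<sigma> \<subseteq> \<tau> \<and> \<sigma> \<subseteq> \<tau>') K"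
    "cobdry n (Suc d) A \<inter> Y = {}" "n * card A \<le> Suc d * card (cobdry n (Suc d) A)"
proof -
  let ?P = "\<lambda>A. cocycle n d Y A \<and> \<not> trivial_cocycle n d Y A"
  obtain A where A: "cocycle n d Y A" "\<not> trivial_cocycle n d Y A"
    and min: "\<And>B. ?P B \<Longrightarrow> card A \<le> card B"
    using ex_has_least_nat[of ?P _ card] ex by metis
  have Ak: "A \<subseteq> ksets n d" using A(1) by (simp add: cocycle_def)
  have fA: "finite A" by (rule finite_subset[OF Ak]) simp
  have conn: "rel_connected (\<lambda>\<sigma> \<sigma>'. \<exists>\<tau>\<in>Y. \<sigma> \<subseteq> \<tau> \<and> \<sigma>' \<subseteq> \<tau>) A"
    unfolding rel_connected_def
  proof (intro allI impI)
    fix L assume L: "L \<subset> A \<and> L \<noteq> {}"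
    show "\<exists>\<sigma>\<in>L. \<exists>\<sigma>'\<in>A - L. \<exists>\<tau>\<in>Y. \<sigma> \<subseteq> \<tau> \<and> \<sigma>' \<subseteq> \<tau>"
    proof (rule ccontr)
      assume no: "\<not> ?thesis"
      \<comment> \<open>A face of \<open>Y\<close> has facets in at most one of \<open>L\<close> and
        \<open>A - L\<close>. The count for one part is then zero, and for the other it is the even
        count of \<open>A\<close>.\<close>
      have *: "\<not> odd_facets L \<tau> \<and> \<not> odd_facets (A - L) \<tau>" if \<tau>: "\<tau> \<in> Y" for \<tau>
      proof -
        have ev: "\<not> odd_facets A \<tau>" using A(1) \<tau> by (simp add: cocycle_def)
        have "{v \<in> \<tau>. \<tau> - {v} \<in> L} = {} \<or> {v \<in> \<tau>. \<tau> - {v} \<in> A - L} = {}"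
        proof (rule ccontr)
          assume "\<not> ?thesis"
          then obtain v w where "\<tau> - {v} \<in> L" "\<tau> - {w} \<in> A - L" by blast
          then show False using no \<tau> by (metis Diff_subset)
        qed
        then consider "{v \<in> \<tau>. \<tau> - {v} \<in> L} = {}" "{v \<in> \<tau>. \<tau> - {v} \<in> A - L} = {v \<in> \<tau>. \<tau> - {v} \<in> A}"
          | "{v \<in> \<tau>. \<tau> - {v} \<in> A - L} = {}" "{v \<in> \<tau>. \<tau> - {v} \<in> L} = {v \<in> \<tau>. \<tau> - {v} \<in> A}"
          using L by blast
        then show ?thesis
          using ev by cases (simp_all only: odd_facets_def card.empty even_zero not_not simp_thms)
      qed
      have "cocycle n d Y L" "cocycle n d Y (A - L)"
        using * Ak L by (auto simp: cocycle_def)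
      moreover have "card L < card A" using L fA by (simp add: psubset_card_mono)
      moreover have "card (A - L) < card A"
        using L fA by (intro psubset_card_mono) auto
      ultimately have "trivial_cocycle n d Y L" "trivial_cocycle n d Y (A - L)"
        using min by (meson not_le)+
      then have "trivial_cocycle n d Y (sym_diff L (A - L))" by (rule trivial_cocycle_sym_diff)
      moreover have "sym_diff L (A - L) = A" using L by auto
      ultimately show False using A(2) by simp
    qed
  qed
  have "A \<noteq> {}" using A(2) trivial_cocycle_isolated[of "{}"] by auto
  then have c0: "card A \<noteq> 0" using fA by simp
  have c1: "card A \<noteq> 1"
  proof
    assume "card A = 1"
    then obtain \<sigma> where \<sigma>: "A = {\<sigma>}" by (auto simp: card_1_singleton_iff)
    have "\<not> A \<subseteq> isolated n d Y" using A(2) trivial_cocycle_isolated by blast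
    then obtain \<tau> where \<tau>: "\<tau> \<in> Y" "\<sigma> \<subseteq> \<tau>" using Ak \<sigma> by (auto simp: isolated_def)
    have "\<sigma> \<in> ksets n d" "\<tau> \<in> ksets n (Suc d)" using Ak \<sigma> \<tau>(1) Y by auto
    then obtain v where v: "v \<in> \<tau>" "v \<notin> \<sigma>" "\<sigma> = \<tau> - {v}" "\<tau> = insert v \<sigma>"
      using facet_cases \<tau>(2) by metis
    have "{u \<in> \<tau>. \<tau> - {u} \<in> A} = {v}"
    proof -
      have "u = v" if "u \<in> \<tau>" "\<tau> - {u} = \<tau> - {v}" for u using that v(1) by blast
      then show ?thesis using v(1) unfolding \<sigma> v(3) by blast
    qed
    then have "odd_facets A \<tau>" by (simp only: odd_facets_def) simp
    then show False using A(1) \<tau> by (simp add: cocycle_def)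
  qed
  have c2: "2 \<le> card A" using c0 c1 by linarith
  obtain K where K: "K \<subseteq> Y" "finite K" "K \<noteq> {}" "card K < card A" "\<forall>\<sigma>\<in>A. \<exists>\<tau>\<in>K. \<sigma> \<subseteq> \<tau>"
    "rel_connected (\<lambda>\<tau> \<tau>'. \<exists>\<sigma>\<in>A. \<sigma> \<subseteq> \<tau> \<and> \<sigma> \<subseteq> \<tau>') K"
    by (rule connecting_sets[OF fA c2 conn])
  have "rel_connected (\<lambda>\<tau> \<tau>'. \<exists>\<sigma>\<in>ksets n d. \<sigma> \<subseteq> \<tau> \<and> \<sigma> \<subseteq> \<tau>') K"
    by (rule rel_connected_mono[OF K(6)]) (use Ak in auto)
  moreover have "cobdry n (Suc d) A \<inter> Y = {}"
    using A(1) by (auto simp: cobdry_def cocycle_def)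
  moreover have "n * card A \<le> Suc d * card (cobdry n (Suc d) A)"
  proof (rule coboundary_expansion[OF Ak])
    fix \<phi>
    have "\<not> trivial_cocycle n d Y (sym_diff A (cobdry n d \<phi>))"
    proof
      assume "trivial_cocycle n d Y (sym_diff A (cobdry n d \<phi>))"
      then have "trivial_cocycle n d Y (sym_diff (sym_diff A (cobdry n d \<phi>)) (cobdry n d \<phi>))"
        by (rule trivial_cocycle_sym_diff) (rule trivial_cocycle_cobdry)
      moreover have "sym_diff (sym_diff A (cobdry n d \<phi>)) (cobdry n d \<phi>) = A" by blast
      ultimately show False using A(2) by simp
    qed
    then show "card A \<le> card (sym_diff A (cobdry n d \<phi>))"
      using min cocycle_sym_diff_cobdry[OF A(1) Y] by blast
  qed
  ultimately show thesis by (intro that[of A K] Ak c2 K)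
qed

section \<open>Counting the candidates of the union bound\<close>

lemma card_ksets: "card (ksets n k) = n choose k"
  unfolding ksets_def using n_subsets[of "{1..n}" k] by simp

lemma card_ksets_le: "card (ksets n k) \<le> n ^ k"
  unfolding card_ksets by (cases "k \<le> n") (auto intro: binomial_le_pow simp: binomial_eq_0)

lemma card_adjacent_le:
  assumes "\<tau> \<in> ksets n (Suc d)"
  shows "card {\<tau>' \<in> ksets n (Suc d). \<exists>\<sigma>\<in>ksets n d. \<sigma> \<subseteq> \<tau> \<and> \<sigma> \<subseteq> \<tau>'} \<le> Suc d * n"
proof -
  have "{\<tau>' \<in> ksets n (Suc d). \<exists>\<sigma>\<in>ksets n d. \<sigma> \<subseteq> \<tau> \<and> \<sigma> \<subseteq> \<tau>'}
      \<subseteq> (\<lambda>(u, v). insert v (\<tau> - {u})) ` (\<tau> \<times> {1..n})"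
  proof clarify
    fix \<tau>' \<sigma> assume h: "\<tau>' \<in> ksets n (Suc d)" "\<sigma> \<in> ksets n d" "\<sigma> \<subseteq> \<tau>" "\<sigma> \<subseteq> \<tau>'"
    obtain u where u: "u \<in> \<tau>" "\<sigma> = \<tau> - {u}" using facet_cases[OF h(2) assms h(3)] by metis
    obtain v where v: "v \<in> \<tau>'" "\<tau>' = insert v \<sigma>" using facet_cases[OF h(2) h(1) h(4)] by metis
    have "v \<in> {1..n}" using v ksetsD(3)[OF h(1)] by blast
    then show "\<tau>' \<in> (\<lambda>(u, v). insert v (\<tau> - {u})) ` (\<tau> \<times> {1..n})"
      using u v by (intro image_eqI[of _ _ "(u, v)"]) auto
  qed
  then have "card {\<tau>' \<in> ksets n (Suc d). \<exists>\<sigma>\<in>ksets n d. \<sigma> \<subseteq> \<tau> \<and> \<sigma> \<subseteq> \<tau>'} \<le> card (\<tau> \<times> {1..n})"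
    using ksetsD(1)[OF assms] by (intro surj_card_le) auto
  then show ?thesis using ksetsD(2)[OF assms] by (simp add: card_cartesian_product)
qed

text \<open>Index set of the union bound, with no reference to the random complex. \<open>K\<close>
  is recorded along with \<open>A\<close> because its k faces have to be present, which contributes
  the factor p^k.\<close>

definition covered_pairs :: "nat \<Rightarrow> nat \<Rightarrow> nat \<Rightarrow> nat \<Rightarrow> (nat set set \<times> nat set set) set" where
  "covered_pairs n d m k = {(A, K). A \<subseteq> ksets n d \<and> card A = m \<and> K \<subseteq> ksets n (Suc d) \<and> K \<noteq> {} \<and>
    card K = k \<and> (\<forall>\<sigma>\<in>A. \<exists>\<tau>\<in>K. \<sigma> \<subseteq> \<tau>) \<and>
    rel_connected (\<lambda>\<tau> \<tau>'. \<exists>\<sigma>\<in>ksets n d. \<sigma> \<subseteq> \<tau> \<and> \<sigma> \<subseteq> \<tau>') K}"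

lemma finite_covered_pairs [simp]: "finite (covered_pairs n d m k)"
  by (rule finite_subset[of _ "Pow (ksets n d) \<times> Pow (ksets n (Suc d))"]) (auto simp: covered_pairs_def)

text \<open>There are at most \<open>n ^ Suc d\<close> roots, and \<open>card_connected_le\<close>
  bounds the connected sets \<open>K\<close> through each of them. Once \<open>K\<close> is known,
  \<open>A\<close> is a subset of its at most \<open>Suc d * k\<close> facets.\<close>

lemma card_covered_pairs_le:
  assumes "n > 0"
  shows "card (covered_pairs n d m k) \<le> n ^ Suc d * ((2 * (Suc d * n)) ^ (k - 1) * 2 ^ k * 2 ^ (Suc d * k))"
proof -
  let ?R = "\<lambda>\<tau> \<tau>'. \<exists>\<sigma>\<in>ksets n d. \<sigma> \<subseteq> \<tau> \<and> \<sigma> \<subseteq> \<tau>'"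
  define F where "F r = {K. K \<subseteq> ksets n (Suc d) \<and> r \<in> K \<and> card K = k \<and> rel_connected ?R K}" for r
  define G where "G = (\<Union>r\<in>ksets n (Suc d). F r)"
  define facets where "facets K = (\<Union>\<tau>\<in>K. (\<lambda>v. \<tau> - {v}) ` \<tau>)" for K :: "nat set set"
  have fF: "finite (F r)" for r by (rule finite_subset[of _ "Pow (ksets n (Suc d))"]) (auto simp: F_def)
  have fG: "finite G" using fF by (simp add: G_def)
  have finK: "finite K" "card K = k" "K \<subseteq> ksets n (Suc d)" if "K \<in> G" for K
    using that finite_subset[of K "ksets n (Suc d)"] by (auto simp: G_def F_def)
  have "card G \<le> (\<Sum>r\<in>ksets n (Suc d). card (F r))"
    unfolding G_def by (rule card_UN_le) simp
  also have "\<dots> \<le> (\<Sum>r\<in>ksets n (Suc d). (2 * (Suc d * n)) ^ (k - 1) * 2 ^ k)"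
    unfolding F_def by (intro sum_mono card_connected_le card_adjacent_le) (use assms in auto)
  also have "\<dots> = card (ksets n (Suc d)) * ((2 * (Suc d * n)) ^ (k - 1) * 2 ^ k)" by simp
  also have "\<dots> \<le> n ^ Suc d * ((2 * (Suc d * n)) ^ (k - 1) * 2 ^ k)"
    by (intro mult_right_mono card_ksets_le) simp
  finally have cG: "card G \<le> n ^ Suc d * ((2 * (Suc d * n)) ^ (k - 1) * 2 ^ k)" .
  have facets: "finite (facets K)" "card (facets K) \<le> Suc d * k" if K: "K \<in> G" for K
  proof -
    have \<tau>: "finite \<tau>" "card \<tau> = Suc d" if "\<tau> \<in> K" for \<tau> using ksetsD finK[OF K] that by blast+
    show "finite (facets K)" using finK[OF K] \<tau> by (auto simp: facets_def)
    have "card (facets K) \<le> (\<Sum>\<tau>\<in>K. card ((\<lambda>v. \<tau> - {v}) ` \<tau>))"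
      unfolding facets_def by (rule card_UN_le[OF finK(1)[OF K]])
    also have "\<dots> \<le> (\<Sum>\<tau>\<in>K. Suc d)" by (intro sum_mono order_trans[OF card_image_le]) (simp_all add: \<tau>)
    finally show "card (facets K) \<le> Suc d * k" using finK[OF K] by (simp add: mult.commute)
  qed
  have "covered_pairs n d m k \<subseteq> (\<lambda>(K, A). (A, K)) ` Sigma G (\<lambda>K. Pow (facets K))"
  proof clarify
    fix A K assume h: "(A, K) \<in> covered_pairs n d m k"
    then obtain r where "r \<in> K" by (auto simp: covered_pairs_def)
    then have "K \<in> G" using h by (auto simp: covered_pairs_def G_def F_def)
    moreover have "A \<subseteq> facets K"
    proof
      fix \<sigma> assume \<sigma>: "\<sigma> \<in> A"
      have "\<forall>\<sigma>\<in>A. \<exists>\<tau>\<in>K. \<sigma> \<subseteq> \<tau>" using h by (simp add: covered_pairs_def)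
      then obtain \<tau> where \<tau>: "\<tau> \<in> K" "\<sigma> \<subseteq> \<tau>" using \<sigma> by blast
      have "\<sigma> \<in> ksets n d" "\<tau> \<in> ksets n (Suc d)" using h \<sigma> \<tau> by (auto simp: covered_pairs_def)
      then obtain v where "v \<in> \<tau>" "\<sigma> = \<tau> - {v}" using facet_cases \<tau>(2) by metis
      then show "\<sigma> \<in> facets K" using \<tau>(1) unfolding facets_def by blast
    qed
    ultimately show "(A, K) \<in> (\<lambda>(K, A). (A, K)) ` Sigma G (\<lambda>K. Pow (facets K))" by force
  qed
  then have "card (covered_pairs n d m k) \<le> card (Sigma G (\<lambda>K. Pow (facets K)))"
    using fG facets by (intro surj_card_le) auto
  also have "\<dots> = (\<Sum>K\<in>G. card (Pow (facets K)))"
    using fG facets by (intro card_SigmaI) auto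
  also have "\<dots> \<le> (\<Sum>K\<in>G. 2 ^ (Suc d * k))"
    using facets by (intro sum_mono) (simp add: card_Pow power_increasing del: mult_Suc)
  also have "\<dots> = card G * 2 ^ (Suc d * k)" by simp
  also have "\<dots> \<le> n ^ Suc d * ((2 * (Suc d * n)) ^ (k - 1) * 2 ^ k) * 2 ^ (Suc d * k)"
    by (intro mult_right_mono cG) simp
  finally show ?thesis by (simp only: mult.assoc)
qed

section \<open>Cocycles at later times\<close>

definition faces_until :: "nat \<Rightarrow> nat \<Rightarrow> (nat set \<Rightarrow> real) \<Rightarrow> real \<Rightarrow> nat set set" where
  "faces_until n d clock t = {\<tau> \<in> ksets n (Suc d). clock \<tau> \<le> t}"

text \<open>For \<open>d = 2\<close> and small \<open>\<delta>\<close> there are adjacent isolated faces at the starting time; only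
  their being covered first by one and the same face is unlikely.\<close>

definition simultaneous_cover :: "nat \<Rightarrow> nat \<Rightarrow> (nat set \<Rightarrow> real) \<Rightarrow> real \<Rightarrow> nat set \<Rightarrow> nat \<Rightarrow> nat \<Rightarrow> bool" where
  "simultaneous_cover n d clock s \<tau> u v \<longleftrightarrow> s < clock \<tau> \<and>
    (\<forall>\<tau>'\<in>ksets n (Suc d). \<tau> - {u} \<subseteq> \<tau>' \<or> \<tau> - {v} \<subseteq> \<tau>' \<longrightarrow> clock \<tau> \<le> clock \<tau>')"

lemma faces_until_subset: "faces_until n d clock t \<subseteq> ksets n (Suc d)"
  by (auto simp: faces_until_def)

text \<open>\<open>J\<close> differs from \<open>A\<close> by a coboundary, so it is a cocycle at
  time \<open>t\<close> too. If some member of \<open>J\<close> has been covered by then, the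
  earliest face \<open>\<tau>\<close> containing a member contains an even number of them, hence at
  least two, and neither was covered before.\<close>

lemma cocycles_trivial_later:
  assumes start: "\<And>A. cocycle n d (faces_until n d clock s) A \<Longrightarrow> trivial_cocycle n d (faces_until n d clock s) A"
    and single: "\<And>\<tau> u v. \<tau> \<in> ksets n (Suc d) \<Longrightarrow> u \<in> \<tau> \<Longrightarrow> v \<in> \<tau> \<Longrightarrow> u \<noteq> v \<Longrightarrow>
      \<not> simultaneous_cover n d clock s \<tau> u v"
    and t: "s \<le> t" and A: "cocycle n d (faces_until n d clock t) A"
  shows "trivial_cocycle n d (faces_until n d clock t) A"
proof -
  let ?Y = "faces_until n d clock"
  have sub: "?Y s \<subseteq> ?Y t" using t by (auto simp: faces_until_def)
  have "cocycle n d (?Y s) A" using A sub by (auto simp: cocycle_def)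
  then obtain \<phi> J where J: "J \<subseteq> isolated n d (?Y s)" and eq: "A = sym_diff (cobdry n d \<phi>) J"
    using start unfolding trivial_cocycle_def by blast
  have "J = sym_diff A (cobdry n d \<phi>)" unfolding eq by blast
  then have cJ: "cocycle n d (?Y t) J"
    using cocycle_sym_diff_cobdry[OF A faces_until_subset] by simp
  have "J \<subseteq> isolated n d (?Y t)"
  proof (rule ccontr)
    assume not: "\<not> ?thesis"
    define C where "C = {\<tau> \<in> ?Y t. \<exists>\<sigma>\<in>J. \<sigma> \<subseteq> \<tau>}"
    have "finite C" by (rule finite_subset[of _ "ksets n (Suc d)"]) (auto simp: C_def faces_until_def)
    moreover have "C \<noteq> {}"
      using not J by (auto simp: isolated_def C_def)
    ultimately obtain \<tau> where \<tau>: "\<tau> \<in> C" and min: "\<And>\<tau>'. \<tau>' \<in> C \<Longrightarrow> clock \<tau> \<le> clock \<tau>'"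
      using arg_min_if_finite(1)[of C clock] arg_min_least[of C _ clock] by metis
    have \<tau>k: "\<tau> \<in> ksets n (Suc d)" "clock \<tau> \<le> t" using \<tau> by (auto simp: C_def faces_until_def)
    have fin: "finite \<tau>" using ksetsD[OF \<tau>k(1)] by simp
    define P where "P = {v \<in> \<tau>. \<tau> - {v} \<in> J}"
    obtain \<sigma> where \<sigma>: "\<sigma> \<in> J" "\<sigma> \<subseteq> \<tau>" using \<tau> by (auto simp: C_def)
    have "\<sigma> \<in> ksets n d" using \<sigma> J by (auto simp: isolated_def)
    then obtain u where "u \<in> \<tau>" "\<sigma> = \<tau> - {u}" using facet_cases[OF _ \<tau>k(1) \<sigma>(2)] by metis
    then have u: "u \<in> P" using \<sigma> by (simp add: P_def)
    have "even (card P)" using cJ \<tau> by (auto simp: cocycle_def odd_facets_def P_def C_def)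
    moreover have "finite P" using fin by (simp add: P_def)
    ultimately have "P \<noteq> {u}" by auto
    then obtain v where v: "v \<in> P" "u \<noteq> v" using u by auto
    have "s < clock \<tau>"
      using u J \<tau>k unfolding P_def isolated_def faces_until_def by (auto simp: not_le[symmetric])
    moreover have "clock \<tau> \<le> clock \<tau>'"
      if "\<tau>' \<in> ksets n (Suc d)" "\<tau> - {u} \<subseteq> \<tau>' \<or> \<tau> - {v} \<subseteq> \<tau>'" for \<tau>'
    proof (cases "clock \<tau>' \<le> t")
      case True
      then have "\<tau>' \<in> C" using that u v by (auto simp: C_def P_def faces_until_def)
      then show ?thesis by (rule min)
    qed (use \<tau>k in simp)
    ultimately have "simultaneous_cover n d clock s \<tau> u v" by (simp add: simultaneous_cover_def)
    then show False using single[OF \<tau>k(1)] u v by (auto simp: P_def)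
  qed
  then show ?thesis using eq unfolding trivial_cocycle_def by blast
qed

section \<open>The random faces\<close>

lemma possible_faces_eq: "possible_faces d n = ksets n (Suc d)"
  by (simp add: possible_faces_def ksets_def)

context face_clocks
begin

lemma clock_measurable: "\<tau> \<in> ksets n (Suc d) \<Longrightarrow> T \<tau> \<in> borel_measurable M"
  using distributed_measurable[OF clocks_exponential] by (simp add: possible_faces_eq)

lemma prob_clocks:
  assumes J: "J \<subseteq> ksets n (Suc d)" and B: "\<And>\<tau>. \<tau> \<in> J \<Longrightarrow> B \<tau> \<in> sets borel"
  shows "prob {\<omega> \<in> space M. \<forall>\<tau>\<in>J. T \<tau> \<omega> \<in> B \<tau>} = (\<Prod>\<tau>\<in>J. prob {\<omega> \<in> space M. T \<tau> \<omega> \<in> B \<tau>})"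
proof (cases "J = {}")
  case False
  have "{\<omega> \<in> space M. \<forall>\<tau>\<in>J. T \<tau> \<omega> \<in> B \<tau>} = (\<Inter>\<tau>\<in>J. T \<tau> -` B \<tau> \<inter> space M)"
    using False by auto
  moreover have "{\<omega> \<in> space M. T \<tau> \<omega> \<in> B \<tau>} = T \<tau> -` B \<tau> \<inter> space M" for \<tau> by auto
  ultimately show ?thesis
    using indep_varsD[OF clocks_indep False finite_subset[OF J finite_ksets], of B] J B
    by (simp add: possible_faces_eq)
qed (simp add: prob_space)

lemma clocks_event:
  assumes J: "J \<subseteq> ksets n (Suc d)" and B: "\<And>\<tau>. \<tau> \<in> J \<Longrightarrow> B \<tau> \<in> sets borel"
  shows "{\<omega> \<in> space M. \<forall>\<tau>\<in>J. T \<tau> \<omega> \<in> B \<tau>} \<in> events"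
proof (rule sets.sets_Collect_finite_All[OF _ finite_subset[OF J finite_ksets]])
  fix \<tau> assume "\<tau> \<in> J"
  then have "T \<tau> -` B \<tau> \<inter> space M \<in> events" using J B by (intro measurable_sets[OF clock_measurable]) auto
  moreover have "T \<tau> -` B \<tau> \<inter> space M = {\<omega> \<in> space M. T \<tau> \<omega> \<in> B \<tau>}" by auto
  ultimately show "{\<omega> \<in> space M. T \<tau> \<omega> \<in> B \<tau>} \<in> events" by simp
qed

lemma prob_clock_le:
  "\<tau> \<in> ksets n (Suc d) \<Longrightarrow> s \<ge> 0 \<Longrightarrow> prob {\<omega> \<in> space M. T \<tau> \<omega> \<in> {..s}} = 1 - exp (- s)"
  using exponential_distributedD_le[OF clocks_exponential, of \<tau> s] by (simp add: possible_faces_eq)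

lemma prob_clock_gt:
  "\<tau> \<in> ksets n (Suc d) \<Longrightarrow> s \<ge> 0 \<Longrightarrow> prob {\<omega> \<in> space M. T \<tau> \<omega> \<in> {s<..}} = exp (- s)"
  using exponential_distributedD_gt[OF clocks_exponential, of \<tau> s] by (simp add: possible_faces_eq)

lemma prob_clock_between:
  assumes \<tau>: "\<tau> \<in> ksets n (Suc d)" and ab: "0 \<le> a" "a \<le> b"
  shows "prob {\<omega> \<in> space M. T \<tau> \<omega> \<in> {a<..b}} = exp (- a) - exp (- b)"
proof -
  have ev: "{\<omega> \<in> space M. T \<tau> \<omega> \<in> {..x}} \<in> events" for x
    using clocks_event[of "{\<tau>}" "\<lambda>_. {..x}"] \<tau> by simp
  have "{\<omega> \<in> space M. T \<tau> \<omega> \<in> {a<..b}} = {\<omega> \<in> space M. T \<tau> \<omega> \<in> {..b}} - {\<omega> \<in> space M. T \<tau> \<omega> \<in> {..a}}"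
    by auto
  also have "prob \<dots> = prob {\<omega> \<in> space M. T \<tau> \<omega> \<in> {..b}} - prob {\<omega> \<in> space M. T \<tau> \<omega> \<in> {..a}}"
    using ab by (intro finite_measure_Diff ev) auto
  also have "\<dots> = exp (- a) - exp (- b)" using prob_clock_le[OF \<tau>] ab by simp
  finally show ?thesis .
qed

lemma prob_present_absent:
  assumes K: "K \<subseteq> ksets n (Suc d)" and D: "D \<subseteq> ksets n (Suc d)" and disj: "K \<inter> D = {}" and s: "s \<ge> 0"
  defines "E \<equiv> {\<omega> \<in> space M. (\<forall>\<tau>\<in>K. T \<tau> \<omega> \<le> s) \<and> (\<forall>\<tau>\<in>D. s < T \<tau> \<omega>)}"
  shows "E \<in> events" "prob E = (1 - exp (- s)) ^ card K * exp (- s) ^ card D"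
proof -
  define B where "B \<tau> = (if \<tau> \<in> K then {..s} else {s<..})" for \<tau>
  have E: "E = {\<omega> \<in> space M. \<forall>\<tau>\<in>K \<union> D. T \<tau> \<omega> \<in> B \<tau>}"
    using disj by (auto simp: E_def B_def)
  have fin: "finite K" "finite D" using K D finite_subset[OF _ finite_ksets] by auto
  show "E \<in> events" unfolding E using K D by (intro clocks_event) (auto simp: B_def)
  have "prob E = (\<Prod>\<tau>\<in>K \<union> D. prob {\<omega> \<in> space M. T \<tau> \<omega> \<in> B \<tau>})"
    unfolding E using K D by (intro prob_clocks) (auto simp: B_def)
  also have "\<dots> = (\<Prod>\<tau>\<in>K. prob {\<omega> \<in> space M. T \<tau> \<omega> \<in> B \<tau>}) * (\<Prod>\<tau>\<in>D. prob {\<omega> \<in> space M. T \<tau> \<omega> \<in> B \<tau>})"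
    by (rule prod.union_disjoint[OF fin disj])
  also have "(\<Prod>\<tau>\<in>K. prob {\<omega> \<in> space M. T \<tau> \<omega> \<in> B \<tau>}) = (\<Prod>\<tau>\<in>K. 1 - exp (- s))"
  proof (rule prod.cong)
    fix \<tau> assume "\<tau> \<in> K"
    then show "prob {\<omega> \<in> space M. T \<tau> \<omega> \<in> B \<tau>} = 1 - exp (- s)"
      using prob_clock_le[of \<tau> s] K s by (auto simp: B_def)
  qed simp
  also have "(\<Prod>\<tau>\<in>D. prob {\<omega> \<in> space M. T \<tau> \<omega> \<in> B \<tau>}) = (\<Prod>\<tau>\<in>D. exp (- s))"
  proof (rule prod.cong)
    fix \<tau> assume "\<tau> \<in> D"
    then show "prob {\<omega> \<in> space M. T \<tau> \<omega> \<in> B \<tau>} = exp (- s)"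
      using prob_clock_gt[of \<tau> s] D s disj by (auto simp: B_def)
  qed simp
  finally show "prob E = (1 - exp (- s)) ^ card K * exp (- s) ^ card D" by simp
qed

lemma prob_UN_le:
  assumes "finite I" "\<And>i. i \<in> I \<Longrightarrow> E i \<in> events" "\<And>i. i \<in> I \<Longrightarrow> prob (E i) \<le> b i"
  shows "(\<Union>i\<in>I. E i) \<in> events" "prob (\<Union>i\<in>I. E i) \<le> (\<Sum>i\<in>I. b i)"
proof -
  show "(\<Union>i\<in>I. E i) \<in> events" using assms by auto
  have "prob (\<Union>i\<in>I. E i) \<le> (\<Sum>i\<in>I. prob (E i))"
    using assms by (intro finite_measure_subadditive_finite) auto
  also have "\<dots> \<le> (\<Sum>i\<in>I. b i)" using assms by (intro sum_mono) auto
  finally show "prob (\<Union>i\<in>I. E i) \<le> (\<Sum>i\<in>I. b i)" .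
qed

text \<open>Cutting the time axis into intervals of length \<open>1 / (card S + 1)\<close> makes the event a union of
  events that involve each clock separately, at the cost of a constant factor.\<close>

lemma prob_first_clock:
  assumes \<tau>: "\<tau> \<in> ksets n (Suc d)" and S: "S \<subseteq> ksets n (Suc d) - {\<tau>}" and s: "s \<ge> 0"
  obtains E where "E \<in> events" "{\<omega> \<in> space M. s < T \<tau> \<omega> \<and> (\<forall>\<tau>'\<in>S. T \<tau> \<omega> \<le> T \<tau>' \<omega>)} \<subseteq> E"
    "prob E \<le> 2 * exp (- s) ^ Suc (card S) / Suc (card S)"
proof -
  define N where "N = real (card S)"
  define h where "h = 1 / (N + 1)"
  have N: "N \<ge> 0" by (simp add: N_def)
  then have h: "h > 0" "h * (N + 1) = 1" by (auto simp: h_def)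
  have fS: "finite S" using S by (rule finite_subset) simp
  define a where "a k = s + real k * h" for k
  have a: "a k \<ge> 0" "a k \<le> a (Suc k)" for k using s h by (auto simp: a_def)
  define B where "B k \<tau>' = (if \<tau>' = \<tau> then {a k<..a (Suc k)} else {a k<..})" for k \<tau>'
  define E where "E k = {\<omega> \<in> space M. \<forall>\<tau>'\<in>insert \<tau> S. T \<tau>' \<omega> \<in> B k \<tau>'}" for k
  have ev: "E k \<in> events" for k
    unfolding E_def using \<tau> S by (intro clocks_event) (auto simp: B_def)
  have prE: "prob (E k) = exp (- s) ^ Suc (card S) * (1 - exp (- h)) * exp (- 1) ^ k" for k
  proof -
    have "prob (E k) = (\<Prod>\<tau>'\<in>insert \<tau> S. prob {\<omega> \<in> space M. T \<tau>' \<omega> \<in> B k \<tau>'})"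
      unfolding E_def using \<tau> S by (intro prob_clocks) (auto simp: B_def)
    also have "\<dots> = prob {\<omega> \<in> space M. T \<tau> \<omega> \<in> B k \<tau>} * (\<Prod>\<tau>'\<in>S. prob {\<omega> \<in> space M. T \<tau>' \<omega> \<in> B k \<tau>'})"
      using fS S by (subst prod.insert) auto
    also have "prob {\<omega> \<in> space M. T \<tau> \<omega> \<in> B k \<tau>} = exp (- a k) - exp (- a (Suc k))"
      using prob_clock_between[OF \<tau> a] by (simp add: B_def)
    also have "(\<Prod>\<tau>'\<in>S. prob {\<omega> \<in> space M. T \<tau>' \<omega> \<in> B k \<tau>'}) = (\<Prod>\<tau>'\<in>S. exp (- a k))"
    proof (rule prod.cong)
      fix \<tau>' assume "\<tau>' \<in> S"
      then show "prob {\<omega> \<in> space M. T \<tau>' \<omega> \<in> B k \<tau>'} = exp (- a k)"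
        using prob_clock_gt[of \<tau>' "a k"] a S by (auto simp: B_def)
    qed simp
    also have "(\<Prod>\<tau>'\<in>S. exp (- a k)) = exp (- a k) ^ card S" by simp
    also have "exp (- a (Suc k)) = exp (- a k) * exp (- h)"
      by (simp add: a_def algebra_simps flip: exp_add)
    finally have "prob (E k) = exp (- a k) ^ Suc (card S) * (1 - exp (- h))"
      by (simp add: algebra_simps)
    also have "exp (- a k) ^ Suc (card S) = exp (- (a k * (N + 1)))"
      by (simp add: N_def algebra_simps flip: exp_of_nat_mult exp_add)
    \<comment> \<open>Since \<open>h * (N + 1) = 1\<close>, moving on by one interval multiplies the
      probability by \<open>exp (- 1)\<close>, so the sum over \<open>k\<close> is
      geometric.\<close>
    also have "a k * (N + 1) = s * (N + 1) + real k * (h * (N + 1))"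
      by (simp add: a_def algebra_simps)
    also have "exp (- (s * (N + 1) + real k * (h * (N + 1)))) = exp (- s) ^ Suc (card S) * exp (- 1) ^ k"
      unfolding h(2) by (simp add: N_def algebra_simps flip: exp_of_nat_mult exp_add)
    finally show ?thesis by simp
  qed
  have geo: "(\<lambda>k. prob (E k)) sums (exp (- s) ^ Suc (card S) * (1 - exp (- h)) * (1 / (1 - exp (- 1))))"
    unfolding prE by (intro sums_mult geometric_sums) simp
  have "{\<omega> \<in> space M. s < T \<tau> \<omega> \<and> (\<forall>\<tau>'\<in>S. T \<tau> \<omega> \<le> T \<tau>' \<omega>)} \<subseteq> (\<Union>k. E k)"
  proof clarify
    fix \<omega> assume w: "\<omega> \<in> space M" "s < T \<tau> \<omega>" "\<forall>\<tau>'\<in>S. T \<tau> \<omega> \<le> T \<tau>' \<omega>"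
    define x where "x = (T \<tau> \<omega> - s) / h"
    have x: "x > 0" "T \<tau> \<omega> = s + x * h" using w h by (auto simp: x_def)
    \<comment> \<open>The ceiling is lowered by one because the intervals exclude their left end and
      include the right one.\<close>
    define k where "k = nat (\<lceil>x\<rceil> - 1)"
    have "real k < x" "x \<le> real (Suc k)" using x by (auto simp: k_def) linarith+
    then have "a k < T \<tau> \<omega>" "T \<tau> \<omega> \<le> a (Suc k)"
      unfolding a_def x(2) using h by auto
    then have "\<omega> \<in> E k" using w S by (force simp: E_def B_def)
    then show "\<omega> \<in> (\<Union>k. E k)" by auto
  qed
  moreover have "prob (\<Union>k. E k) \<le> 2 * exp (- s) ^ Suc (card S) / Suc (card S)"
  proof -
    have "prob (\<Union>k. E k) \<le> suminf (\<lambda>k. prob (E k))"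
      using ev geo by (intro finite_measure_subadditive_countably) (auto simp: sums_iff)
    also have "\<dots> = exp (- s) ^ Suc (card S) * (1 - exp (- h)) * (1 / (1 - exp (- 1)))"
      using geo by (simp add: sums_iff)
    also have "\<dots> \<le> exp (- s) ^ Suc (card S) * h * 2"
    proof (intro mult_mono)
      show "1 - exp (- h) \<le> h" using exp_ge_add_one_self[of "- h"] by linarith
      have "exp (- 1) \<le> (1 / 2 :: real)"
        using exp_ge_add_one_self[of 1] by (simp add: exp_minus field_simps)
      then show "1 / (1 - exp (- 1)) \<le> (2::real)" by (simp add: field_simps)
    qed (use h in auto)
    also have "\<dots> = 2 * exp (- s) ^ Suc (card S) / Suc (card S)"
      by (simp add: h_def N_def field_simps)
    finally show ?thesis .
  qed
  moreover have "(\<Union>k. E k) \<in> events" using ev by auto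
  ultimately show thesis using that by blast
qed

end

section \<open>Probabilities of the exceptional events\<close>

text \<open>Replace \<open>u\<close> or \<open>v\<close> by a vertex outside \<open>\<tau>\<close>.
  The two families are disjoint: members of the first miss \<open>u\<close>, members of the second
  contain it.\<close>

lemma other_cofaces:
  assumes \<tau>: "\<tau> \<in> ksets n (Suc d)" and uv: "u \<in> \<tau>" "v \<in> \<tau>" "u \<noteq> v"
  obtains S where "S \<subseteq> ksets n (Suc d) - {\<tau>}" "card S = 2 * (n - Suc d)"
    "\<forall>\<tau>'\<in>S. \<tau> - {u} \<subseteq> \<tau>' \<or> \<tau> - {v} \<subseteq> \<tau>'"
proof -
  define W where "W = {1..n} - \<tau>"
  define S where "S u = (\<lambda>w. insert w (\<tau> - {u})) ` W" for u
  have cW: "card W = n - Suc d" "finite W"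
    using ksetsD[OF \<tau>] by (auto simp: W_def card_Diff_subset)
  have inj: "inj_on (\<lambda>w. insert w (\<tau> - {u})) W" for u
    by (rule inj_onI) (auto simp: W_def)
  have cS: "card (S u) = n - Suc d" "finite (S u)" for u
    using card_image[OF inj] cW by (auto simp: S_def)
  have sub: "S u \<subseteq> ksets n (Suc d) - {\<tau>}" if "u \<in> \<tau>" for u
    using ksets_insert[OF ksets_remove[OF \<tau> that]] by (auto simp: S_def W_def)
  have "u \<notin> X" if "X \<in> S u" for X using that uv by (auto simp: S_def W_def)
  moreover have "u \<in> X" if "X \<in> S v" for X using that uv by (auto simp: S_def W_def)
  ultimately have "S u \<inter> S v = {}" by blast
  then have "card (S u \<union> S v) = 2 * (n - Suc d)" using cS by (simp add: card_Un_disjoint)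
  then show thesis using sub uv by (intro that[of "S u \<union> S v"]) (auto simp: S_def)
qed

context face_clocks
begin

abbreviation faces_at :: "real \<Rightarrow> 'a \<Rightarrow> nat set set" where
  "faces_at t \<omega> \<equiv> faces_until n d (\<lambda>\<tau>. T \<tau> \<omega>) t"

text \<open>A measurable superset of the bad event is enough for the union bound; the good event of
  the theorem gets its measurability from \<open>later_times_event\<close>. The divisor in the bound
  is the number of competing cofaces, \<open>\<tau>\<close> included, and makes up for one of the
  \<open>Suc d\<close> powers of n.\<close>

lemma simultaneous_cover_event:
  assumes s: "s \<ge> 0"
  obtains E where "E \<in> events"
    "{\<omega> \<in> space M. \<exists>\<tau>\<in>ksets n (Suc d). \<exists>u\<in>\<tau>. \<exists>v\<in>\<tau>. u \<noteq> v \<and> simultaneous_cover n d (\<lambda>\<tau>. T \<tau> \<omega>) s \<tau> u v} \<subseteq> E"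
    "prob E \<le> real n ^ Suc d * real (Suc d) ^ 2 *
      (2 * exp (- s) ^ Suc (2 * (n - Suc d)) / Suc (2 * (n - Suc d)))"
proof -
  define b where "b = 2 * exp (- s) ^ Suc (2 * (n - Suc d)) / real (Suc (2 * (n - Suc d)))"
  have b0: "b \<ge> 0" by (simp add: b_def)
  define I where "I = {(\<tau>, u, v). \<tau> \<in> ksets n (Suc d) \<and> u \<in> \<tau> \<and> v \<in> \<tau> \<and> u \<noteq> v}"
  define Q where "Q i \<omega> \<longleftrightarrow> (case i of (\<tau>, u, v) \<Rightarrow> simultaneous_cover n d (\<lambda>\<tau>. T \<tau> \<omega>) s \<tau> u v)" for i \<omega>
  have "\<forall>i\<in>I. \<exists>E. E \<in> events \<and> {\<omega> \<in> space M. Q i \<omega>} \<subseteq> E \<and> prob E \<le> b"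
  proof
    fix i assume "i \<in> I"
    then obtain \<tau> u v where i: "i = (\<tau>, u, v)"
      and h: "\<tau> \<in> ksets n (Suc d)" "u \<in> \<tau>" "v \<in> \<tau>" "u \<noteq> v" unfolding I_def by blast
    obtain S where S: "S \<subseteq> ksets n (Suc d) - {\<tau>}" "card S = 2 * (n - Suc d)"
      "\<forall>\<tau>'\<in>S. \<tau> - {u} \<subseteq> \<tau>' \<or> \<tau> - {v} \<subseteq> \<tau>'"
      by (rule other_cofaces[OF h])
    obtain E where E: "E \<in> events" "{\<omega> \<in> space M. s < T \<tau> \<omega> \<and> (\<forall>\<tau>'\<in>S. T \<tau> \<omega> \<le> T \<tau>' \<omega>)} \<subseteq> E"
      "prob E \<le> 2 * exp (- s) ^ Suc (card S) / Suc (card S)"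
      by (rule prob_first_clock[OF h(1) S(1) s])
    have "{\<omega> \<in> space M. Q i \<omega>} \<subseteq>
        {\<omega> \<in> space M. s < T \<tau> \<omega> \<and> (\<forall>\<tau>'\<in>S. T \<tau> \<omega> \<le> T \<tau>' \<omega>)}"
      using S unfolding i Q_def prod.case simultaneous_cover_def by blast
    also note E(2)
    finally show "\<exists>E. E \<in> events \<and> {\<omega> \<in> space M. Q i \<omega>} \<subseteq> E \<and> prob E \<le> b"
      using E(1,3) unfolding b_def S(2) by blast
  qed
  then obtain E' where E: "\<forall>i\<in>I. E' i \<in> events \<and> {\<omega> \<in> space M. Q i \<omega>} \<subseteq> E' i \<and> prob (E' i) \<le> b"
    by (rule bchoice[THEN exE])
  have IS: "I \<subseteq> Sigma (ksets n (Suc d)) (\<lambda>\<tau>. \<tau> \<times> \<tau>)" by (auto simp: I_def)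
  have fS: "finite (Sigma (ksets n (Suc d)) (\<lambda>\<tau>. \<tau> \<times> \<tau>))"
    by (intro finite_SigmaI) (auto dest: ksetsD)
  have fI: "finite I" by (rule finite_subset[OF IS fS])
  have "card I \<le> card (Sigma (ksets n (Suc d)) (\<lambda>\<tau>. \<tau> \<times> \<tau>))" by (rule card_mono[OF fS IS])
  also have "\<dots> = (\<Sum>\<tau>\<in>ksets n (Suc d). card (\<tau> \<times> \<tau>))"
    by (intro card_SigmaI) (auto dest: ksetsD)
  also have "\<dots> = (\<Sum>\<tau>\<in>ksets n (Suc d). Suc d ^ 2)"
    using ksetsD by (intro sum.cong) (auto simp: card_cartesian_product power2_eq_square)
  also have "\<dots> \<le> n ^ Suc d * Suc d ^ 2" using card_ksets_le[of n "Suc d"] by simp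
  finally have cI: "real (card I) \<le> real n ^ Suc d * real (Suc d) ^ 2"
    by (metis of_nat_le_iff of_nat_mult of_nat_power)
  have E': "E' i \<in> events" "prob (E' i) \<le> b" if "i \<in> I" for i
    using E that by blast+
  show thesis
  proof (rule that)
    show "(\<Union>i\<in>I. E' i) \<in> events" by (rule prob_UN_le(1)[OF fI E'])
    show "{\<omega> \<in> space M. \<exists>\<tau>\<in>ksets n (Suc d). \<exists>u\<in>\<tau>. \<exists>v\<in>\<tau>. u \<noteq> v \<and> simultaneous_cover n d (\<lambda>\<tau>. T \<tau> \<omega>) s \<tau> u v} \<subseteq> (\<Union>i\<in>I. E' i)"
    proof clarify
      fix \<omega> \<tau> u v assume h: "\<omega> \<in> space M" "\<tau> \<in> ksets n (Suc d)" "u \<in> \<tau>" "v \<in> \<tau>" "u \<noteq> v"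
        "simultaneous_cover n d (\<lambda>\<tau>. T \<tau> \<omega>) s \<tau> u v"
      then have i: "(\<tau>, u, v) \<in> I" by (simp add: I_def)
      have "Q (\<tau>, u, v) \<omega>" using h by (simp add: Q_def)
      then have "\<omega> \<in> E' (\<tau>, u, v)" using E i h(1) by blast
      then show "\<omega> \<in> (\<Union>i\<in>I. E' i)" using i by blast
    qed
    have "prob (\<Union>i\<in>I. E' i) \<le> (\<Sum>i\<in>I. b)" by (rule prob_UN_le(2)[OF fI E'])
    also have "\<dots> = real (card I) * b" by simp
    also have "\<dots> \<le> real n ^ Suc d * real (Suc d) ^ 2 * b" by (rule mult_right_mono[OF cI b0])
    finally show "prob (\<Union>i\<in>I. E' i) \<le> real n ^ Suc d * real (Suc d) ^ 2 *
      (2 * exp (- s) ^ Suc (2 * (n - Suc d)) / Suc (2 * (n - Suc d)))" by (simp only: b_def)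
  qed
qed

text \<open>Some suitable vertex suffices, so one vertex \<open>v \<sigma>\<close> is fixed in
  advance for each \<open>\<sigma>\<close>. The union then runs over about n^d pairs of
  \<open>\<sigma>\<close> and \<open>u \<in> \<sigma>\<close>; ranging over all vertices would cost
  another factor n, too much for d = 2 and small \<delta>.\<close>

lemma no_own_vertex_event:
  assumes s: "s \<ge> 0" and n: "n > d"
  obtains E where "E \<in> events"
    "{\<omega> \<in> space M. \<not> (\<forall>\<sigma>\<in>isolated n d (faces_at s \<omega>). \<exists>v\<in>{1..n} - \<sigma>. \<forall>u\<in>\<sigma>.
      insert v (\<sigma> - {u}) \<notin> isolated n d (faces_at s \<omega>))} \<subseteq> E"
    "prob E \<le> real n ^ d * real d * exp (- s) ^ Suc (2 * (n - Suc d))"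
proof -
  define b where "b = exp (- s) ^ Suc (2 * (n - Suc d))"
  have "\<exists>v. v \<in> {1..n} - \<sigma>" if "\<sigma> \<in> ksets n d" for \<sigma>
  proof -
    have "card ({1..n} - \<sigma>) > 0" using ksetsD[OF that] n by (simp add: card_Diff_subset)
    then show ?thesis by (metis card.empty ex_in_conv less_irrefl)
  qed
  then obtain v where v: "\<And>\<sigma>. \<sigma> \<in> ksets n d \<Longrightarrow> v \<sigma> \<in> {1..n} - \<sigma>" by metis
  define I where "I = Sigma (ksets n d) (\<lambda>\<sigma>. \<sigma>)"
  have fI: "finite I" unfolding I_def by (intro finite_SigmaI) (auto dest: ksetsD)
  have "card I = (\<Sum>\<sigma>\<in>ksets n d. card \<sigma>)"
    unfolding I_def by (intro card_SigmaI) (auto dest: ksetsD)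
  also have "\<dots> = (\<Sum>\<sigma>\<in>ksets n d. d)" using ksetsD by (intro sum.cong) auto
  also have "\<dots> \<le> n ^ d * d" using card_ksets_le[of n d] by simp
  finally have cI: "real (card I) \<le> real n ^ d * real d"
    by (metis of_nat_le_iff of_nat_mult of_nat_power)
  define Q where "Q i \<omega> \<longleftrightarrow> (case i of (\<sigma>, u) \<Rightarrow> \<sigma> \<in> isolated n d (faces_at s \<omega>) \<and>
      insert (v \<sigma>) (\<sigma> - {u}) \<in> isolated n d (faces_at s \<omega>))" for i \<omega>
  have "\<forall>i\<in>I. \<exists>E. E \<in> events \<and> {\<omega> \<in> space M. Q i \<omega>} \<subseteq> E \<and> prob E \<le> b"
  proof
    fix i assume "i \<in> I"
    then obtain \<sigma> u where i: "i = (\<sigma>, u)" and \<sigma>: "\<sigma> \<in> ksets n d" and u: "u \<in> \<sigma>"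
      unfolding I_def by blast
    have vs: "v \<sigma> \<in> {1..n}" "v \<sigma> \<notin> \<sigma>" using v[OF \<sigma>] by auto
    define \<tau> where "\<tau> = insert (v \<sigma>) \<sigma>"
    have \<tau>: "\<tau> \<in> ksets n (Suc d)" unfolding \<tau>_def by (rule ksets_insert[OF \<sigma> vs])
    have facets: "\<tau> - {v \<sigma>} = \<sigma>" "\<tau> - {u} = insert (v \<sigma>) (\<sigma> - {u})" using vs u by (auto simp: \<tau>_def)
    obtain S where S: "S \<subseteq> ksets n (Suc d) - {\<tau>}" "card S = 2 * (n - Suc d)"
      "\<forall>\<tau>'\<in>S. \<tau> - {u} \<subseteq> \<tau>' \<or> \<tau> - {v \<sigma>} \<subseteq> \<tau>'"
      by (rule other_cofaces[OF \<tau>, of u "v \<sigma>"]) (use u vs in \<open>auto simp: \<tau>_def\<close>)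
    have S': "insert \<tau> S \<subseteq> ksets n (Suc d)" using S \<tau> by auto
    have card: "card (insert \<tau> S) = Suc (2 * (n - Suc d))"
      using S finite_subset[OF S(1)] by (subst card_insert_disjoint) auto
    define E where "E = {\<omega> \<in> space M. (\<forall>\<tau>\<in>{}. T \<tau> \<omega> \<le> s) \<and> (\<forall>\<tau>\<in>insert \<tau> S. s < T \<tau> \<omega>)}"
    have "E \<in> events" unfolding E_def by (rule prob_present_absent(1)[OF _ S' _ s]) auto
    moreover have "prob E = b"
      unfolding E_def b_def by (subst prob_present_absent(2)[OF _ S' _ s]) (auto simp: card)
    moreover have "{\<omega> \<in> space M. Q i \<omega>} \<subseteq> E"
      unfolding i Q_def prod.case
    proof clarify
      fix \<omega> assume w: "\<omega> \<in> space M" "\<sigma> \<in> isolated n d (faces_at s \<omega>)"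
        "insert (v \<sigma>) (\<sigma> - {u}) \<in> isolated n d (faces_at s \<omega>)"
      have "s < T \<tau>' \<omega>" if "\<tau>' \<in> insert \<tau> S" for \<tau>'
      proof (rule ccontr)
        assume "\<not> s < T \<tau>' \<omega>"
        then have "\<tau>' \<in> faces_at s \<omega>" using that S' by (auto simp: faces_until_def)
        then have "\<not> \<sigma> \<subseteq> \<tau>'" "\<not> insert (v \<sigma>) (\<sigma> - {u}) \<subseteq> \<tau>'"
          using w unfolding isolated_def by blast+
        moreover have "\<tau> - {u} \<subseteq> \<tau>' \<or> \<tau> - {v \<sigma>} \<subseteq> \<tau>'" using that S(3) by blast
        ultimately show False unfolding facets by blast
      qed
      then show "\<omega> \<in> E" using w by (simp add: E_def)
    qed
    ultimately show "\<exists>E. E \<in> events \<and> {\<omega> \<in> space M. Q i \<omega>} \<subseteq> E \<and> prob E \<le> b" by blast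
  qed
  then obtain E' where E: "\<forall>i\<in>I. E' i \<in> events \<and> {\<omega> \<in> space M. Q i \<omega>} \<subseteq> E' i \<and> prob (E' i) \<le> b"
    by (rule bchoice[THEN exE])
  have E': "E' i \<in> events" "prob (E' i) \<le> b" if "i \<in> I" for i
    using E that by blast+
  show thesis
  proof (rule that)
    show "(\<Union>i\<in>I. E' i) \<in> events" by (rule prob_UN_le(1)[OF fI E'])
    show "{\<omega> \<in> space M. \<not> (\<forall>\<sigma>\<in>isolated n d (faces_at s \<omega>). \<exists>v\<in>{1..n} - \<sigma>. \<forall>u\<in>\<sigma>.
      insert v (\<sigma> - {u}) \<notin> isolated n d (faces_at s \<omega>))} \<subseteq> (\<Union>i\<in>I. E' i)"
    proof
      fix \<omega> assume "\<omega> \<in> {\<omega> \<in> space M. \<not> (\<forall>\<sigma>\<in>isolated n d (faces_at s \<omega>). \<exists>v\<in>{1..n} - \<sigma>. \<forall>u\<in>\<sigma>.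
        insert v (\<sigma> - {u}) \<notin> isolated n d (faces_at s \<omega>))}"
      then obtain \<sigma> where w: "\<omega> \<in> space M" "\<sigma> \<in> isolated n d (faces_at s \<omega>)"
        "\<And>v. v \<in> {1..n} - \<sigma> \<Longrightarrow> \<exists>u\<in>\<sigma>. insert v (\<sigma> - {u}) \<in> isolated n d (faces_at s \<omega>)"
        by blast
      have \<sigma>: "\<sigma> \<in> ksets n d" using w(2) by (simp add: isolated_def)
      obtain u where u: "u \<in> \<sigma>" "insert (v \<sigma>) (\<sigma> - {u}) \<in> isolated n d (faces_at s \<omega>)"
        using w(3)[OF v[OF \<sigma>]] by blast
      have i: "(\<sigma>, u) \<in> I" using \<sigma> u by (simp add: I_def)
      have "Q (\<sigma>, u) \<omega>" using w(2) u(2) by (simp add: Q_def)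
      then have "\<omega> \<in> E' (\<sigma>, u)" using E i w(1) by blast
      then show "\<omega> \<in> (\<Union>i\<in>I. E' i)" using i by blast
    qed
    have "prob (\<Union>i\<in>I. E' i) \<le> (\<Sum>i\<in>I. b)" by (rule prob_UN_le(2)[OF fI E'])
    also have "\<dots> = real (card I) * b" by simp
    also have "\<dots> \<le> real n ^ d * real d * b" by (rule mult_right_mono[OF cI]) (simp add: b_def)
    finally show "prob (\<Union>i\<in>I. E' i) \<le> real n ^ d * real d * exp (- s) ^ Suc (2 * (n - Suc d))"
      by (simp only: b_def)
  qed
qed

lemma nontrivial_cocycle_event:
  assumes s: "s \<ge> 0" and n: "n > 0"
  defines "p \<equiv> 1 - exp (- s)"
  obtains E where "E \<in> events"
    "{\<omega> \<in> space M. \<exists>A. cocycle n d (faces_at s \<omega>) A \<and> \<not> trivial_cocycle n d (faces_at s \<omega>) A} \<subseteq> E"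
    "prob E \<le> (\<Sum>m=2..n ^ d. \<Sum>k=1..<m.
      real (n ^ Suc d * ((2 * (Suc d * n)) ^ (k - 1) * 2 ^ k * 2 ^ (Suc d * k))) *
      (p ^ k * exp (- p * max (real m * (real n - real d - real m)) (real n * real m / real (Suc d)))))"
proof -
  \<comment> \<open>Two lower bounds for the size of the coboundary: the first is nearly n m for
    small m, the second takes over for large m, where the first even becomes negative.\<close>
  define g where "g m = max (real m * (real n - real d - real m)) (real n * real m / real (Suc d))" for m :: nat
  have p: "0 \<le> p" "exp (- s) = 1 - p" using s by (auto simp: p_def)
  have ep: "exp (- s) \<le> exp (- p)" using exp_ge_add_one_self[of "- p"] p by simp
  \<comment> \<open>The cone bound is available for a smallest cocycle but not for every covered
    pair, so it becomes a condition on the index. The other expansion bound holds for all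
    \<open>A\<close>.\<close>
  define G where "G m k = {(A, K) \<in> covered_pairs n d m k. K \<inter> cobdry n (Suc d) A = {} \<and>
    n * m \<le> Suc d * card (cobdry n (Suc d) A)}" for m k
  define E where "E i = (case i of (A, K) \<Rightarrow>
    {\<omega> \<in> space M. (\<forall>\<tau>\<in>K. T \<tau> \<omega> \<le> s) \<and> (\<forall>\<tau>\<in>cobdry n (Suc d) A. s < T \<tau> \<omega>)})" for i
  have E: "E i \<in> events" "prob (E i) \<le> p ^ k * exp (- p * g m)" if "i \<in> G m k" for i m k
  proof -
    obtain A K where i: "i = (A, K)" by (cases i)
    define C where "C = cobdry n (Suc d) A"
    have h: "K \<subseteq> ksets n (Suc d)" "K \<inter> C = {}" "card K = k" "A \<subseteq> ksets n d" "card A = m"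
      "n * m \<le> Suc d * card C"
      using that unfolding i C_def by (auto simp: G_def covered_pairs_def)
    have C: "C \<subseteq> ksets n (Suc d)" by (auto simp: C_def cobdry_def)
    show "E i \<in> events" unfolding E_def i prod.case C_def[symmetric]
      by (rule prob_present_absent(1)[OF h(1) C h(2) s])
    have "prob (E i) = p ^ k * exp (- s) ^ card C" unfolding E_def i prod.case C_def[symmetric]
      by (subst prob_present_absent(2)[OF h(1) C h(2) s]) (simp add: p_def h)
    also have "exp (- s) ^ card C \<le> exp (- p) ^ card C" by (rule power_mono[OF ep]) simp
    also have "\<dots> = exp (- p * real (card C))" by (simp add: mult.commute flip: exp_of_nat_mult)
    also have "\<dots> \<le> exp (- p * g m)"
    proof -
      have "real m * (real n - real d - real m) \<le> real (m * (n - d - m))"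
      \<comment> \<open>Truncated subtraction: if d + m exceeds n, the natural number is zero and
        the real expression is negative or zero.\<close>
      proof (cases "d + m \<le> n")
        case True
        then have "real (n - d - m) = real n - real d - real m" by simp
        then show ?thesis by simp
      next
        case False
        then have "real n - real d - real m \<le> 0" by linarith
        then have "real m * (real n - real d - real m) \<le> 0" by (rule mult_nonneg_nonpos[rotated]) simp
        also have "0 \<le> real (m * (n - d - m))" by (rule of_nat_0_le_iff)
        finally show ?thesis .
      qed
      also have "\<dots> \<le> real (card C)"
        using coboundary_expansion_small[OF h(4)] unfolding h(5) C_def by (simp only: of_nat_le_iff)
      finally have 1: "real m * (real n - real d - real m) \<le> real (card C)" .
      have "real (n * m) \<le> real (Suc d * card C)" using h(6) by (simp only: of_nat_le_iff)
      then have "real n * real m / real (Suc d) \<le> real (card C)"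
        by (simp add: pos_divide_le_eq algebra_simps)
      then have "g m \<le> real (card C)" using 1 by (simp add: g_def)
      then show ?thesis using p by (simp add: mult_left_mono)
    qed
    finally show "prob (E i) \<le> p ^ k * exp (- p * g m)" using p by (simp add: mult_left_mono)
  qed
  have fG: "finite (G m k)" for m k
    by (rule finite_subset[of _ "covered_pairs n d m k"]) (auto simp: G_def)
  let ?c = "\<lambda>k. real (n ^ Suc d * ((2 * (Suc d * n)) ^ (k - 1) * 2 ^ k * 2 ^ (Suc d * k)))"
  have cG: "real (card (G m k)) \<le> ?c k" for m k
  proof -
    have "card (G m k) \<le> card (covered_pairs n d m k)" by (rule card_mono) (auto simp: G_def)
    also have "\<dots> \<le> n ^ Suc d * ((2 * (Suc d * n)) ^ (k - 1) * 2 ^ k * 2 ^ (Suc d * k))"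
      by (rule card_covered_pairs_le[OF n])
    finally show ?thesis by (simp only: of_nat_le_iff)
  qed
  define E1 where "E1 m k = (\<Union>i\<in>G m k. E i)" for m k
  have E1: "E1 m k \<in> events" "prob (E1 m k) \<le> ?c k * (p ^ k * exp (- p * g m))" for m k
  proof -
    show "E1 m k \<in> events" unfolding E1_def by (rule prob_UN_le(1)[OF fG E])
    have "prob (E1 m k) \<le> (\<Sum>i\<in>G m k. p ^ k * exp (- p * g m))"
      unfolding E1_def by (rule prob_UN_le(2)[OF fG E])
    also have "\<dots> = real (card (G m k)) * (p ^ k * exp (- p * g m))" by simp
    also have "\<dots> \<le> ?c k * (p ^ k * exp (- p * g m))"
      by (rule mult_right_mono[OF cG]) (use p in simp)
    finally show "prob (E1 m k) \<le> ?c k * (p ^ k * exp (- p * g m))" .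
  qed
  define E2 where "E2 m = (\<Union>k\<in>{1..<m}. E1 m k)" for m
  have E2: "E2 m \<in> events" "prob (E2 m) \<le> (\<Sum>k\<in>{1..<m}. ?c k * (p ^ k * exp (- p * g m)))" for m
    unfolding E2_def by (rule prob_UN_le[OF _ E1(1) E1(2)]; simp)+
  show thesis
  proof (rule that)
    show "(\<Union>m\<in>{2..n ^ d}. E2 m) \<in> events" by (rule prob_UN_le(1)[OF _ E2(1) E2(2)]) simp
    show "prob (\<Union>m\<in>{2..n ^ d}. E2 m) \<le> (\<Sum>m=2..n ^ d. \<Sum>k=1..<m. ?c k *
        (p ^ k * exp (- p * max (real m * (real n - real d - real m)) (real n * real m / real (Suc d)))))"
      unfolding g_def[symmetric] by (rule prob_UN_le(2)[OF _ E2(1) E2(2)]) simp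
    show "{\<omega> \<in> space M. \<exists>A. cocycle n d (faces_at s \<omega>) A \<and> \<not> trivial_cocycle n d (faces_at s \<omega>) A}
        \<subseteq> (\<Union>m\<in>{2..n ^ d}. E2 m)"
    proof
      fix \<omega> assume "\<omega> \<in> {\<omega> \<in> space M. \<exists>A. cocycle n d (faces_at s \<omega>) A \<and> \<not> trivial_cocycle n d (faces_at s \<omega>) A}"
      then have w: "\<omega> \<in> space M"
        and ex: "\<exists>A. cocycle n d (faces_at s \<omega>) A \<and> \<not> trivial_cocycle n d (faces_at s \<omega>) A" by auto
      obtain A K where h: "A \<subseteq> ksets n d" "2 \<le> card A" "K \<subseteq> faces_at s \<omega>" "K \<noteq> {}" "card K < card A"
        "\<forall>\<sigma>\<in>A. \<exists>\<tau>\<in>K. \<sigma> \<subseteq> \<tau>"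
        "rel_connected (\<lambda>\<tau> \<tau>'. \<exists>\<sigma>\<in>ksets n d. \<sigma> \<subseteq> \<tau> \<and> \<sigma> \<subseteq> \<tau>') K"
        "cobdry n (Suc d) A \<inter> faces_at s \<omega> = {}" "n * card A \<le> Suc d * card (cobdry n (Suc d) A)"
        by (rule minimal_nontrivial_cocycle[OF faces_until_subset ex])
      have K: "K \<subseteq> ksets n (Suc d)" using h(3) faces_until_subset by blast
      have "finite K" by (rule finite_subset[OF K]) simp
      then have k: "card K \<in> {1..<card A}" using h by (auto simp: Suc_le_eq card_gt_0_iff)
      have "card A \<le> n ^ d" using card_mono[OF finite_ksets h(1)] card_ksets_le[of n d] by linarith
      then have m: "card A \<in> {2..n ^ d}" using h by simp
      have "(A, K) \<in> G (card A) (card K)"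
        using h K by (auto simp: G_def covered_pairs_def)
      moreover have "\<omega> \<in> E (A, K)"
        using w h(3,8) by (auto simp: E_def faces_until_def cobdry_def not_le[symmetric])
      ultimately have "\<omega> \<in> E1 (card A) (card K)" by (auto simp: E1_def)
      then have "\<omega> \<in> E2 (card A)" using k by (auto simp: E2_def)
      then show "\<omega> \<in> (\<Union>m\<in>{2..n ^ d}. E2 m)" using m by blast
    qed
  qed
qed

section \<open>Measurability of a statement about all later times\<close>

text \<open>Uncountably many times reduce to finitely many conditions. The set of faces changes only
  at clock values, so it equals \<open>S\<close> at some time from \<open>s\<close> on iff it does
  so at \<open>s\<close> itself or at a clock value not before \<open>s\<close>. There are only
  finitely many \<open>S\<close> to exclude.\<close>

lemma later_times_event:
  "{\<omega> \<in> space M. \<forall>t\<ge>s. Q (faces_at t \<omega>)} \<in> events"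
proof -
  let ?F = "ksets n (Suc d)"
  define R where "R S \<omega> \<longleftrightarrow> (\<forall>\<tau>\<in>?F. T \<tau> \<omega> \<le> s \<longleftrightarrow> \<tau> \<in> S) \<or>
    (\<exists>\<rho>\<in>?F. s \<le> T \<rho> \<omega> \<and> (\<forall>\<tau>\<in>?F. T \<tau> \<omega> \<le> T \<rho> \<omega> \<longleftrightarrow> \<tau> \<in> S))" for S \<omega>
  have R: "(\<exists>t\<ge>s. faces_at t \<omega> = S) \<longleftrightarrow> R S \<omega>" if S: "S \<subseteq> ?F" for S \<omega>
  proof
    assume "\<exists>t\<ge>s. faces_at t \<omega> = S"
    then obtain t where t: "t \<ge> s" "S = faces_at t \<omega>" by auto
    show "R S \<omega>"
    \<comment> \<open>If a member of \<open>S\<close> appears after \<open>s\<close>, the clock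
      value of the latest one replaces \<open>t\<close>; otherwise \<open>s\<close> does.\<close>
    proof (cases "\<exists>\<rho>\<in>S. s < T \<rho> \<omega>")
      case True
      have "finite S" by (rule finite_subset[OF S]) simp
      then have "Max ((\<lambda>\<rho>. T \<rho> \<omega>) ` S) \<in> (\<lambda>\<rho>. T \<rho> \<omega>) ` S" using True by (intro Max_in) auto
      then obtain \<rho> where \<rho>: "\<rho> \<in> S" "T \<rho> \<omega> = Max ((\<lambda>\<rho>. T \<rho> \<omega>) ` S)" by auto
      have max: "T \<tau> \<omega> \<le> T \<rho> \<omega>" if "\<tau> \<in> S" for \<tau> using that \<open>finite S\<close> \<rho>(2) by simp
      have "s \<le> T \<rho> \<omega>" using True max by fastforce
      moreover have "T \<rho> \<omega> \<le> t" using \<rho>(1) t by (auto simp: faces_until_def)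
      ultimately show ?thesis
        unfolding R_def using max \<rho>(1) S t(2)
        by (intro disjI2 bexI[of _ \<rho>]) (auto simp: faces_until_def)
    next
      case False
      then show ?thesis unfolding R_def using t by (intro disjI1) (auto simp: faces_until_def not_less)
    qed
  next
    assume "R S \<omega>"
    then show "\<exists>t\<ge>s. faces_at t \<omega> = S"
      unfolding R_def
    proof
      assume "\<forall>\<tau>\<in>?F. T \<tau> \<omega> \<le> s \<longleftrightarrow> \<tau> \<in> S"
      then show ?thesis using S by (intro exI[of _ s]) (auto simp: faces_until_def)
    next
      assume "\<exists>\<rho>\<in>?F. s \<le> T \<rho> \<omega> \<and> (\<forall>\<tau>\<in>?F. T \<tau> \<omega> \<le> T \<rho> \<omega> \<longleftrightarrow> \<tau> \<in> S)"
      then obtain \<rho> where "s \<le> T \<rho> \<omega>" "\<forall>\<tau>\<in>?F. T \<tau> \<omega> \<le> T \<rho> \<omega> \<longleftrightarrow> \<tau> \<in> S" by blast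
      then show ?thesis using S by (intro exI[of _ "T \<rho> \<omega>"]) (auto simp: faces_until_def)
    qed
  qed
  have le: "{\<omega> \<in> space M. (T \<tau> \<omega> \<le> f \<omega>) = b} \<in> events"
    if "\<tau> \<in> ?F" "f \<in> borel_measurable M" for \<tau> f b
  proof -
    note [measurable] = clock_measurable[OF that(1)] that(2)
    have "{\<omega> \<in> space M. T \<tau> \<omega> \<le> f \<omega>} \<in> events" "{\<omega> \<in> space M. \<not> T \<tau> \<omega> \<le> f \<omega>} \<in> events" by measurable
    then show ?thesis by (cases b) auto
  qed
  have "{\<omega> \<in> space M. R S \<omega>} \<in> events" for S
  proof -
    have "{\<omega> \<in> space M. \<forall>\<tau>\<in>?F. T \<tau> \<omega> \<le> s \<longleftrightarrow> \<tau> \<in> S} \<in> events"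
      by (intro sets.sets_Collect_finite_All le) auto
    moreover have "{\<omega> \<in> space M. \<exists>\<rho>\<in>?F. s \<le> T \<rho> \<omega> \<and> (\<forall>\<tau>\<in>?F. T \<tau> \<omega> \<le> T \<rho> \<omega> \<longleftrightarrow> \<tau> \<in> S)} \<in> events"
    proof (intro sets.sets_Collect_finite_Ex sets.sets_Collect_conj sets.sets_Collect_finite_All le clock_measurable)
      fix \<rho> assume "\<rho> \<in> ?F"
      note [measurable] = clock_measurable[OF this]
      show "{\<omega> \<in> space M. s \<le> T \<rho> \<omega>} \<in> events" by measurable
    qed auto
    ultimately show ?thesis unfolding R_def by - (rule sets.sets_Collect_disj; assumption)
  qed
  then have "{\<omega> \<in> space M. \<forall>S\<in>{S \<in> Pow ?F. \<not> Q S}. \<not> R S \<omega>} \<in> events"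
    by (intro sets.sets_Collect_finite_All sets.sets_Collect_neg) auto
  moreover have "{\<omega> \<in> space M. \<forall>t\<ge>s. Q (faces_at t \<omega>)} =
      {\<omega> \<in> space M. \<forall>S\<in>{S \<in> Pow ?F. \<not> Q S}. \<not> R S \<omega>}"
  proof (intro Collect_cong conj_cong refl)
    fix \<omega>
    have "(\<forall>S\<in>{S \<in> Pow ?F. \<not> Q S}. \<not> R S \<omega>) \<longleftrightarrow>
        (\<forall>S\<in>{S \<in> Pow ?F. \<not> Q S}. \<not> (\<exists>t\<ge>s. faces_at t \<omega> = S))"
      using R by (intro ball_cong) auto
    also have "\<dots> \<longleftrightarrow> (\<forall>t\<ge>s. Q (faces_at t \<omega>))" using faces_until_subset by blast
    finally show "(\<forall>t\<ge>s. Q (faces_at t \<omega>)) \<longleftrightarrow> (\<forall>S\<in>{S \<in> Pow ?F. \<not> Q S}. \<not> R S \<omega>)" ..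
  qed
  ultimately show ?thesis by simp
qed

end

section \<open>Quotients of spaces of finitely supported functions\<close>

text \<open>A quotient record comes without a proof that it is a module. The axioms are pulled back
  along the bijection \<open>f\<close> from \<open>W\<close> instead of being checked on cosets; the
  isomorphism is the inverse of \<open>f\<close>.\<close>

lemma vectorspace_transport:
  assumes W: "vectorspace K W" and bij: "bij_betw f (carrier W) (carrier Q)"
    and add: "\<And>a b. a \<in> carrier W \<Longrightarrow> b \<in> carrier W \<Longrightarrow> f (a \<oplus>\<^bsub>W\<^esub> b) = f a \<oplus>\<^bsub>Q\<^esub> f b"
    and zero: "f \<zero>\<^bsub>W\<^esub> = \<zero>\<^bsub>Q\<^esub>"
    and smult: "\<And>r a. r \<in> carrier K \<Longrightarrow> a \<in> carrier W \<Longrightarrow> f (r \<odot>\<^bsub>W\<^esub> a) = r \<odot>\<^bsub>Q\<^esub> f a"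
  shows "vs_isomorphic K Q W"
proof -
  interpret W: vectorspace K W by (rule W)
  have car: "carrier Q = f ` carrier W" using bij by (simp add: bij_betw_def)
  have "abelian_group Q"
  proof (rule abelian_groupI)
    fix x assume "x \<in> carrier Q"
    then obtain a where "a \<in> carrier W" "x = f a" by (auto simp: car)
    then show "\<exists>y\<in>carrier Q. y \<oplus>\<^bsub>Q\<^esub> x = \<zero>\<^bsub>Q\<^esub>"
      by (intro bexI[of _ "f (\<ominus>\<^bsub>W\<^esub> a)"]) (auto simp: car W.M.l_neg simp flip: add zero)
  qed (auto simp: car W.M.a_ac simp flip: add zero)
  then have "module K Q"
    by (intro moduleI W.R.is_cring)
      (auto simp: car W.smult_l_distr W.smult_r_distr W.smult_assoc1 simp flip: add smult)
  then have Q: "vectorspace K Q" by (simp add: vectorspace_def W.field_axioms)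
  define g where "g = the_inv_into (carrier W) f"
  have inj: "inj_on f (carrier W)" using bij by (simp add: bij_betw_def)
  have gf: "g (f a) = a" if "a \<in> carrier W" for a
    using the_inv_into_f_f[OF inj that] by (simp add: g_def)
  have "linear_map K Q W g"
    unfolding linear_map_def mod_hom_def mod_hom_axioms_def module_hom_def
    using Q W by (auto simp: vectorspace_def car gf simp flip: add smult)
  moreover have "bij_betw g (carrier Q) (carrier W)"
    unfolding g_def by (rule bij_betw_the_inv_into[OF bij])
  ultimately show ?thesis unfolding vs_isomorphic_def by blast
qed

text \<open>First isomorphism theorem in the direction that \<open>vectorspace_transport\<close>
  wants: the cosets of the kernel \<open>B\<close> are the fibres of \<open>\<psi>\<close>, and
  \<open>fib\<close> sends an element of \<open>W\<close> to its fibre. The record \<open>V\<close>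
  has the shape of \<open>chain_space\<close> with its carrier replaced.\<close>

lemma vs_isomorphic_quotient:
  fixes Z :: "'a::ab_group_add set" and W :: "('r::field, 'b, 'n) module_scheme"
  defines "V sc \<equiv> \<lparr>carrier = Z, mult = undefined, one = undefined, zero = 0, add = (+), smult = sc\<rparr>"
  assumes W: "vectorspace class_ring W"
    and Z: "\<And>x y. x \<in> Z \<Longrightarrow> y \<in> Z \<Longrightarrow> x + y \<in> Z" "\<And>x. x \<in> Z \<Longrightarrow> - x \<in> Z" "\<And>r x. x \<in> Z \<Longrightarrow> sc r x \<in> Z"
    and onto: "\<psi> ` Z = carrier W"
    and add: "\<And>x y. x \<in> Z \<Longrightarrow> y \<in> Z \<Longrightarrow> \<psi> (x + y) = \<psi> x \<oplus>\<^bsub>W\<^esub> \<psi> y"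
    and smult: "\<And>r x. x \<in> Z \<Longrightarrow> \<psi> (sc r x) = r \<odot>\<^bsub>W\<^esub> \<psi> x"
    and ker: "B = {x \<in> Z. \<psi> x = \<zero>\<^bsub>W\<^esub>}"
  shows "vs_isomorphic class_ring (quotient_module (V sc) B) W"
proof -
  interpret W: vectorspace class_ring W by (rule W)
  define fib where "fib a = {x \<in> Z. \<psi> x = a}" for a
  have in_W: "\<psi> x \<in> carrier W" if "x \<in> Z" for x using onto that by auto
  have coset: "B +>\<^bsub>V sc\<^esub> x = fib (\<psi> x)" if x: "x \<in> Z" for x
  proof -
    have "B +>\<^bsub>V sc\<^esub> x = {b + x |b. b \<in> B}"
      by (auto simp: a_r_coset_def r_coset_def V_def)
    also have "\<dots> = fib (\<psi> x)"
    proof (intro equalityI subsetI)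
      fix y assume "y \<in> {b + x |b. b \<in> B}"
      then show "y \<in> fib (\<psi> x)" using x Z in_W by (auto simp: fib_def ker add)
    next
      fix y assume y: "y \<in> fib (\<psi> x)"
      then have yZ: "y \<in> Z" and e: "\<psi> y = \<psi> x" by (auto simp: fib_def)
      have d: "y + - x \<in> Z" by (rule Z(1)[OF yZ Z(2)[OF x]])
      have "\<psi> y = \<psi> (y + - x) \<oplus>\<^bsub>W\<^esub> \<psi> x" using add[OF d x] by simp
      then have "\<psi> (y + - x) \<oplus>\<^bsub>W\<^esub> \<psi> x = \<zero>\<^bsub>W\<^esub> \<oplus>\<^bsub>W\<^esub> \<psi> x"
        using e in_W[OF x] by simp
      then have "\<psi> (y + - x) = \<zero>\<^bsub>W\<^esub>"
        using in_W[OF d] in_W[OF x] by (simp only: W.M.add.right_cancel W.M.zero_closed)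
      then show "y \<in> {b + x |b. b \<in> B}" using d by (auto simp: ker intro!: exI[of _ "y + - x"])
    qed
    finally show ?thesis .
  qed
  have car: "carrier (quotient_module (V sc) B) = fib ` carrier W"
  proof -
    have "carrier (quotient_module (V sc) B) = (\<lambda>x. B +>\<^bsub>V sc\<^esub> x) ` Z"
      by (auto simp: quotient_module_def A_RCOSETS_def RCOSETS_def a_r_coset_def V_def)
    also have "\<dots> = (\<lambda>x. fib (\<psi> x)) ` Z" using coset by (intro image_cong) auto
    finally show ?thesis by (simp flip: onto add: image_image)
  qed
  show ?thesis
  proof (rule vectorspace_transport[OF W])
    have "inj_on fib (carrier W)"
    proof (rule inj_onI)
      fix a b assume "a \<in> carrier W" "b \<in> carrier W" "fib a = fib b"
      moreover then obtain x where "x \<in> Z" "a = \<psi> x" using onto by auto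
      ultimately have "x \<in> fib b" by (auto simp: fib_def)
      then show "a = b" using \<open>a = \<psi> x\<close> by (simp add: fib_def)
    qed
    then show "bij_betw fib (carrier W) (carrier (quotient_module (V sc) B))"
      by (simp add: bij_betw_def car)
    show "fib \<zero>\<^bsub>W\<^esub> = \<zero>\<^bsub>quotient_module (V sc) B\<^esub>"
      by (simp add: quotient_module_def fib_def ker)
  next
    fix a b assume a: "a \<in> carrier W" and b: "b \<in> carrier W"
    then obtain x y where x: "x \<in> Z" "a = \<psi> x" and y: "y \<in> Z" "b = \<psi> y"
      unfolding onto[symmetric] by blast
    have "fib a \<oplus>\<^bsub>quotient_module (V sc) B\<^esub> fib b = {u + v |u v. u \<in> fib a \<and> v \<in> fib b}"
      by (auto simp: quotient_module_def set_add_def set_mult_def V_def)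
    also have "\<dots> = fib (a \<oplus>\<^bsub>W\<^esub> b)"
    proof (intro equalityI subsetI)
      fix z assume "z \<in> {u + v |u v. u \<in> fib a \<and> v \<in> fib b}"
      then show "z \<in> fib (a \<oplus>\<^bsub>W\<^esub> b)" using Z add by (auto simp: fib_def)
    next
      fix z assume z: "z \<in> fib (a \<oplus>\<^bsub>W\<^esub> b)"
      then have zZ: "z \<in> Z" and e: "\<psi> z = a \<oplus>\<^bsub>W\<^esub> b" by (auto simp: fib_def)
      have d: "z + - y \<in> Z" by (rule Z(1)[OF zZ Z(2)[OF y(1)]])
      have "\<psi> z = \<psi> (z + - y) \<oplus>\<^bsub>W\<^esub> b" using add[OF d y(1)] y(2) by simp
      then have "\<psi> (z + - y) = a" using e in_W[OF d] a b by (simp add: W.M.add.right_cancel)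
      then have "z + - y \<in> fib a" "y \<in> fib b" using d y by (auto simp: fib_def)
      moreover have "z = (z + - y) + y" by simp
      ultimately show "z \<in> {u + v |u v. u \<in> fib a \<and> v \<in> fib b}" by blast
    qed
    finally show "fib (a \<oplus>\<^bsub>W\<^esub> b) = fib a \<oplus>\<^bsub>quotient_module (V sc) B\<^esub> fib b" ..
  next
    fix r a assume a: "a \<in> carrier W"
    then obtain x where x: "x \<in> Z" "a = \<psi> x" using onto by auto
    have "r \<odot>\<^bsub>quotient_module (V sc) B\<^esub> fib a = (\<Union>y\<in>fib a. B +>\<^bsub>V sc\<^esub> sc r y)"
      by (simp add: quotient_module_def V_def)
    also have "\<dots> = (\<Union>y\<in>fib a. fib (r \<odot>\<^bsub>W\<^esub> a))"
      using coset Z(3) smult by (intro SUP_cong) (auto simp: fib_def)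
    \<comment> \<open>The union of a constant family; its index set is nonempty because it contains
      \<open>x\<close>.\<close>
    also have "\<dots> = fib (r \<odot>\<^bsub>W\<^esub> a)" using x by (auto simp: fib_def)
    finally show "fib (r \<odot>\<^bsub>W\<^esub> a) = r \<odot>\<^bsub>quotient_module (V sc) B\<^esub> fib a" ..
  qed
qed

section \<open>Pairing chains with cochains\<close>

text \<open>Evaluation of a chain by an arbitrary cochain \<open>z\<close>. Chains are equal once
  all their evaluations agree, which turns identities for \<open>boundary\<close> into identities
  for \<open>cobd\<close>.\<close>

definition pair :: "('v \<Rightarrow> rat) \<Rightarrow> ('v \<Rightarrow>\<^sub>0 rat) \<Rightarrow> rat" where
  "pair z c = (\<Sum>\<sigma>\<in>Poly_Mapping.keys c. Poly_Mapping.lookup c \<sigma> * z \<sigma>)"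

definition cobd :: "('v::linorder set \<Rightarrow> 'a::comm_ring_1) \<Rightarrow> 'v set \<Rightarrow> 'a" where
  "cobd z \<sigma> = (\<Sum>v\<in>\<sigma>. fsign \<sigma> v * z (\<sigma> - {v}))"

abbreviation scale :: "rat \<Rightarrow> ('v \<Rightarrow>\<^sub>0 rat) \<Rightarrow> ('v \<Rightarrow>\<^sub>0 rat)" where
  "scale q \<equiv> Poly_Mapping.map ((*) q)"

lemma lookup_scale [simp]: "Poly_Mapping.lookup (scale q c) \<sigma> = q * Poly_Mapping.lookup c \<sigma>"
  by (simp add: Poly_Mapping.map.rep_eq when_def)

lemma scale_zero [simp]: "scale q 0 = 0"
  by (rule poly_mapping_eqI) simp

lemma keys_scale: "Poly_Mapping.keys (scale q c) \<subseteq> Poly_Mapping.keys c"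
  by (auto simp: in_keys_iff)

lemma pair_superset:
  assumes "finite S" "Poly_Mapping.keys c \<subseteq> S"
  shows "pair z c = (\<Sum>\<sigma>\<in>S. Poly_Mapping.lookup c \<sigma> * z \<sigma>)"
  unfolding pair_def using assms by (intro sum.mono_neutral_left) (auto simp: in_keys_iff)

lemma pair_add: "pair z (c + c') = pair z c + pair z c'"
proof -
  let ?S = "Poly_Mapping.keys c \<union> Poly_Mapping.keys c'"
  have "Poly_Mapping.keys (c + c') \<subseteq> ?S" by (rule keys_add)
  then show ?thesis
    by (simp add: pair_superset[of ?S] lookup_add distrib_right sum.distrib)
qed

lemma pair_zero [simp]: "pair z 0 = 0"
  by (simp add: pair_def)

lemma pair_scale: "pair z (scale q c) = q * pair z c"
  using pair_superset[of "Poly_Mapping.keys c" "scale q c" z] keys_scale[of q c] by (simp add: pair_def sum_distrib_left mult.assoc)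

lemma pair_sum: "pair z (\<Sum>i\<in>I. f i) = (\<Sum>i\<in>I. pair z (f i))"
  by (induction I rule: infinite_finite_induct) (auto simp: pair_add)

lemma pair_single [simp]: "pair z (Poly_Mapping.single \<sigma> q) = q * z \<sigma>"
  by (cases "q = 0") (auto simp: pair_def)

lemma lookup_eq_pair: "Poly_Mapping.lookup c \<sigma> = pair (\<lambda>\<rho>. if \<rho> = \<sigma> then 1 else 0) c"
  by (simp add: pair_def if_distrib[of "\<lambda>x. _ * x"] sum.delta' in_keys_iff cong: if_cong)

lemma chain_eqI: "(\<And>z. pair z c = pair z c') \<Longrightarrow> c = c'"
  by (intro poly_mapping_eqI) (simp add: lookup_eq_pair)

text \<open>\<open>cobd\<close> is the transpose of \<open>boundary\<close>. This breaks down at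
  \<open>k = 0\<close>, where \<open>boundary\<close> is zero by definition while
  \<open>cobd\<close> still sees the empty set.\<close>

lemma pair_boundary:
  assumes "k > 0"
  shows "pair z (boundary k c) = pair (cobd z) c"
proof -
  have "boundary k c = (\<Sum>\<sigma>\<in>Poly_Mapping.keys c. \<Sum>v\<in>\<sigma>.
       Poly_Mapping.single (\<sigma> - {v}) (fsign \<sigma> v * Poly_Mapping.lookup c \<sigma>))"
    using assms by (simp add: boundary_def fsign_def)
  then show ?thesis
    by (simp add: pair_sum) (simp add: pair_def cobd_def sum_distrib_left mult_ac)
qed

lemma boundary_add: "k > 0 \<Longrightarrow> boundary k (c + c') = boundary k c + boundary k c'"
  by (rule chain_eqI) (simp add: pair_boundary pair_add)

lemma boundary_scale: "k > 0 \<Longrightarrow> boundary k (scale q c) = scale q (boundary k c)"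
  by (rule chain_eqI) (simp add: pair_boundary pair_scale)

lemma cobd_cobd: "finite \<tau> \<Longrightarrow> cobd (cobd z) \<tau> = 0"
  unfolding cobd_def by (rule signed_coboundary_twice)

lemma boundary_boundary:
  assumes "k > 0" "\<And>\<sigma>. \<sigma> \<in> Poly_Mapping.keys c \<Longrightarrow> finite \<sigma>"
  shows "boundary k (boundary (Suc k) c) = 0"
proof (rule chain_eqI)
  fix z
  show "pair z (boundary k (boundary (Suc k) c)) = pair z 0"
    using assms by (simp add: pair_boundary) (simp add: pair_def cobd_cobd)
qed

lemma keys_boundary:
  assumes "k > 0" "\<rho> \<in> Poly_Mapping.keys (boundary k c)"
  obtains \<sigma> v where "\<sigma> \<in> Poly_Mapping.keys c" "v \<in> \<sigma>" "\<rho> = \<sigma> - {v}"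
proof -
  have "pair (cobd (\<lambda>\<rho>'. if \<rho>' = \<rho> then 1 else 0)) c \<noteq> 0"
    using assms by (simp add: in_keys_iff lookup_eq_pair pair_boundary)
  then obtain \<sigma> where "\<sigma> \<in> Poly_Mapping.keys c" "cobd (\<lambda>\<rho>'. if \<rho>' = \<rho> then 1 else 0 :: rat) \<sigma> \<noteq> 0"
    unfolding pair_def by (metis (no_types, lifting) mult_zero_right sum.neutral)
  moreover then obtain v where "v \<in> \<sigma>" "fsign \<sigma> v * (if \<sigma> - {v} = \<rho> then 1 else 0 :: rat) \<noteq> 0"
    unfolding cobd_def by (meson sum.not_neutral_contains_not_neutral)
  ultimately show thesis using that[of \<sigma> v] by (auto split: if_splits)
qed

text \<open>A basis of \<open>B\<close> together with \<open>c\<close> is independent, so some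
  linear functional is zero on \<open>B\<close> and one at \<open>c\<close>. Its values at single
  faces form the cochain \<open>z\<close>.\<close>

lemma separating_cochain:
  fixes B :: "('v \<Rightarrow>\<^sub>0 rat) set"
  assumes "0 \<in> B" "\<And>x y. x \<in> B \<Longrightarrow> y \<in> B \<Longrightarrow> x + y \<in> B" "\<And>q x. x \<in> B \<Longrightarrow> scale q x \<in> B"
    and "c \<notin> B"
  obtains z where "pair z c \<noteq> 0" "\<And>x. x \<in> B \<Longrightarrow> pair z x = 0"
proof -
  interpret vector_space_pair "scale :: rat \<Rightarrow> ('v \<Rightarrow>\<^sub>0 rat) \<Rightarrow> _" "(*) :: rat \<Rightarrow> rat \<Rightarrow> rat"
    by unfold_locales (auto intro!: poly_mapping_eqI simp: lookup_add algebra_simps)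
  have B: "vs1.subspace B" using assms by (auto simp: vs1.subspace_def)
  obtain B' where B': "B' \<subseteq> B" "vs1.independent B'" "B \<subseteq> vs1.span B'"
    using vs1.maximal_independent_subset[of B] by metis
  have "vs1.span B' \<subseteq> B" using vs1.span_minimal[OF B'(1) B] .
  then have c: "c \<notin> vs1.span B'" using assms(4) by auto
  then have "vs1.independent (insert c B')" using B'(2) by (rule vs1.independent_insertI)
  then obtain g where g: "Vector_Spaces.linear scale (*) g"
    "\<forall>x\<in>insert c B'. g x = (if x = c then 1 else 0)"
    using linear_independent_extend[of "insert c B'" "\<lambda>x. if x = c then 1 else 0"] by blast
  have c': "c \<notin> B'" using c vs1.span_base by blast
  have g0: "g x = 0" if "x \<in> B" for x
  proof (rule linear_eq_0_on_span[OF g(1), of B'])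
    show "g y = 0" if "y \<in> B'" for y using g(2) c' that by auto
  qed (use B'(3) that in auto)
  define z where "z \<sigma> = g (Poly_Mapping.single \<sigma> 1)" for \<sigma>
  have "pair z x = g x" for x
  proof -
    have "x = (\<Sum>\<sigma>\<in>Poly_Mapping.keys x. scale (Poly_Mapping.lookup x \<sigma>) (Poly_Mapping.single \<sigma> 1))"
      by (rule chain_eqI) (simp add: pair_sum pair_scale, simp add: pair_def)
    then have "g x = g (\<Sum>\<sigma>\<in>Poly_Mapping.keys x. scale (Poly_Mapping.lookup x \<sigma>) (Poly_Mapping.single \<sigma> 1))"
      by simp
    also have "\<dots> = pair z x"
      by (simp only: linear_sum[OF g(1)] linear_scale[OF g(1)] pair_def z_def)
    finally show ?thesis ..
  qed
  then show thesis using that[of z] g0 g(2) by simp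
qed

section \<open>From mod-two cocycles to rational homology\<close>

lemma common_denominator:
  fixes f :: "'a \<Rightarrow> rat"
  assumes "finite S"
  shows "\<exists>D::int. D > 0 \<and> (\<exists>e. \<forall>\<sigma>\<in>S. of_int (e \<sigma>) = of_int D * f \<sigma>)"
proof -
  define D where "D = (\<Prod>\<sigma>\<in>S. snd (quotient_of (f \<sigma>)))"
  have "D > 0" unfolding D_def by (intro prod_pos) (auto simp: quotient_of_denom_pos')
  moreover have "\<exists>m::int. of_int m = of_int D * f \<sigma>" if "\<sigma> \<in> S" for \<sigma>
  proof -
    obtain a b where q: "quotient_of (f \<sigma>) = (a, b)" by fastforce
    have "b > 0" "f \<sigma> = of_int a / of_int b"
      using quotient_of_denom_pos[OF q] quotient_of_div[OF q] by auto
    moreover have "b dvd D" unfolding D_def using q assms that dvd_prodI[of S \<sigma> "\<lambda>\<sigma>. snd (quotient_of (f \<sigma>))"] by simp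
    then obtain k where "D = b * k" by (auto simp: dvd_def)
    ultimately show ?thesis by (intro exI[of _ "a * k"]) (simp add: field_simps)
  qed
  ultimately show ?thesis by metis
qed

text \<open>A cocycle is \<open>b + j + 2 w'\<close> with a coboundary \<open>b\<close>, a cochain \<open>j\<close> on isolated faces
  and a cocycle \<open>w'\<close>; iterating, its value on a cycle vanishing on the isolated faces is divisible by
  every power of two.\<close>

lemma integral_pairing_zero:
  fixes e w :: "nat set \<Rightarrow> int"
  assumes triv: "\<And>A. cocycle n d Y A \<Longrightarrow> trivial_cocycle n d Y A" and Y: "Y \<subseteq> ksets n (Suc d)"
    and cyc: "\<And>f. (\<Sum>\<sigma>\<in>ksets n d. e \<sigma> * cobd f \<sigma>) = 0"
    and iso: "\<And>\<sigma>. \<sigma> \<in> isolated n d Y \<Longrightarrow> e \<sigma> = 0"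
    and w: "\<And>\<tau>. \<tau> \<in> Y \<Longrightarrow> cobd w \<tau> = 0"
  shows "(\<Sum>\<sigma>\<in>ksets n d. e \<sigma> * w \<sigma>) = 0"
proof -
  have pow: "2 ^ k dvd (\<Sum>\<sigma>\<in>ksets n d. e \<sigma> * w \<sigma>)" if "\<And>\<tau>. \<tau> \<in> Y \<Longrightarrow> cobd w \<tau> = 0" for k and w :: "nat set \<Rightarrow> int"
    using that
  proof (induction k arbitrary: w)
    case (Suc k)
    define A where "A = {\<sigma> \<in> ksets n d. odd (w \<sigma>)}"
    have facet: "\<tau> - {v} \<in> ksets n d" if "\<tau> \<in> Y" "v \<in> \<tau>" for \<tau> v
      using that Y ksets_remove by blast
    have finY: "finite \<tau>" if "\<tau> \<in> Y" for \<tau> using that Y ksetsD by blast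
    have "\<not> odd_facets A \<tau>" if \<tau>: "\<tau> \<in> Y" for \<tau>
    proof -
      have "odd_facets A \<tau> \<longleftrightarrow> odd (cobd w \<tau>)" unfolding cobd_def
        using facet[OF \<tau>] by (intro odd_facets_iff_sum finY[OF \<tau>]) (auto simp: A_def)
      then show ?thesis using Suc.prems[OF \<tau>] by simp
    qed
    then have "cocycle n d Y A" by (auto simp: cocycle_def A_def)
    then obtain \<phi> J where J: "J \<subseteq> isolated n d Y" "A = sym_diff (cobdry n d \<phi>) J"
      using triv unfolding trivial_cocycle_def by blast
    \<comment> \<open>Lifts of \<open>\<phi>\<close> and \<open>J\<close> with values 0 and 1. On
      \<open>ksets n d\<close>, \<open>w\<close> agrees modulo two with \<open>cobd f\<close> plus
      \<open>j\<close>, so the division by two in \<open>w'\<close> is exact there.\<close>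
    define f :: "nat set \<Rightarrow> int" where "f \<rho> = (if \<rho> \<in> \<phi> then 1 else 0)" for \<rho>
    define j :: "nat set \<Rightarrow> int" where "j \<sigma> = (if \<sigma> \<in> J then 1 else 0)" for \<sigma>
    define w' where "w' \<sigma> = (w \<sigma> - cobd f \<sigma> - j \<sigma>) div 2" for \<sigma>
    have w': "w \<sigma> = cobd f \<sigma> + j \<sigma> + 2 * w' \<sigma>" if \<sigma>: "\<sigma> \<in> ksets n d" for \<sigma>
    proof -
      have "odd (cobd f \<sigma>) \<longleftrightarrow> odd_facets \<phi> \<sigma>" unfolding cobd_def
        by (rule odd_facets_iff_sum[symmetric]) (use ksetsD(1)[OF \<sigma>] in \<open>auto simp: f_def\<close>)
      then have "odd (cobd f \<sigma>) \<longleftrightarrow> \<sigma> \<in> cobdry n d \<phi>" using \<sigma> by (simp add: cobdry_def)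
      moreover have "odd (w \<sigma>) \<longleftrightarrow> \<sigma> \<in> sym_diff (cobdry n d \<phi>) J"
        unfolding J(2)[symmetric] using \<sigma> by (simp add: A_def)
      ultimately have "even (w \<sigma> - cobd f \<sigma> - j \<sigma>)" by (auto simp: j_def)
      then show ?thesis by (simp add: w'_def)
    qed
    have "cobd w' \<tau> = 0" if \<tau>: "\<tau> \<in> Y" for \<tau>
    proof -
      have "cobd w \<tau> = (\<Sum>v\<in>\<tau>. fsign \<tau> v * (cobd f (\<tau> - {v}) + j (\<tau> - {v}) + 2 * w' (\<tau> - {v})))"
        unfolding cobd_def[of w] using w' facet[OF \<tau>] by (intro sum.cong) auto
      also have "\<dots> = cobd (cobd f) \<tau> + cobd j \<tau> + 2 * cobd w' \<tau>"
        by (simp add: cobd_def algebra_simps sum.distrib sum_distrib_left)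
      also have "cobd (cobd f) \<tau> = 0" by (rule cobd_cobd[OF finY[OF \<tau>]])
      also have "cobd j \<tau> = 0"
        unfolding cobd_def using J(1) \<tau> by (intro sum.neutral) (auto simp: j_def isolated_def)
      finally show ?thesis using Suc.prems[OF \<tau>] by simp
    qed
    then have "2 ^ k dvd (\<Sum>\<sigma>\<in>ksets n d. e \<sigma> * w' \<sigma>)" by (rule Suc.IH)
    moreover have "(\<Sum>\<sigma>\<in>ksets n d. e \<sigma> * w \<sigma>) = 2 * (\<Sum>\<sigma>\<in>ksets n d. e \<sigma> * w' \<sigma>)"
    proof -
      have "(\<Sum>\<sigma>\<in>ksets n d. e \<sigma> * w \<sigma>) = (\<Sum>\<sigma>\<in>ksets n d. e \<sigma> * (cobd f \<sigma> + j \<sigma> + 2 * w' \<sigma>))"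
        using w' by (intro sum.cong) auto
      also have "\<dots> = (\<Sum>\<sigma>\<in>ksets n d. e \<sigma> * cobd f \<sigma>) + (\<Sum>\<sigma>\<in>ksets n d. e \<sigma> * j \<sigma>) +
          2 * (\<Sum>\<sigma>\<in>ksets n d. e \<sigma> * w' \<sigma>)"
        by (simp add: algebra_simps sum.distrib sum_distrib_left)
      also have "(\<Sum>\<sigma>\<in>ksets n d. e \<sigma> * j \<sigma>) = 0"
        using iso J(1) by (intro sum.neutral) (auto simp: j_def)
      finally show ?thesis using cyc by simp
    qed
    ultimately show ?case by simp
  qed simp
  define N where "N = (\<Sum>\<sigma>\<in>ksets n d. e \<sigma> * w \<sigma>)"
  \<comment> \<open>A nonzero integer has no divisor exceeding its absolute value, and this power of
    two exceeds it.\<close>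
  have "\<not> 2 ^ nat \<bar>N\<bar> dvd N" if "N \<noteq> 0"
  proof
    assume "2 ^ nat \<bar>N\<bar> dvd N"
    then have "(2::int) ^ nat \<bar>N\<bar> \<le> \<bar>N\<bar>" using that dvd_imp_le_int[of N "2 ^ nat \<bar>N\<bar>"] by simp
    moreover have "int (nat \<bar>N\<bar>) < 2 ^ nat \<bar>N\<bar>" by (rule of_nat_less_two_power)
    ultimately show False by simp
  qed
  then show ?thesis using pow[OF w, of "nat \<bar>N\<bar>"] unfolding N_def by blast
qed

text \<open>If \<open>c\<close> were no boundary, some cochain \<open>z\<close> would vanish on all
  boundaries and not at \<open>c\<close>; vanishing there makes it a cocycle on \<open>Y\<close>. On
  the finitely many faces both \<open>c\<close> and \<open>z\<close> have common denominators, and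
  once these are cleared \<open>integral_pairing_zero\<close> contradicts the choice of
  \<open>z\<close>.\<close>

lemma cycle_is_boundary:
  assumes triv: "\<And>A. cocycle n d Y A \<Longrightarrow> trivial_cocycle n d Y A" and Y: "Y \<subseteq> ksets n (Suc d)"
    and d: "d \<ge> 2" and X: "simplices X d = Y"
    and c: "Poly_Mapping.keys c \<subseteq> ksets n d" "boundary (d - 1) c = 0"
    and iso: "\<And>\<sigma>. \<sigma> \<in> isolated n d Y \<Longrightarrow> Poly_Mapping.lookup c \<sigma> = 0"
  shows "c \<in> boundaries X (d - 1)"
proof (rule ccontr)
  assume nc: "c \<notin> boundaries X (d - 1)"
  have B: "boundaries X (d - 1) = boundary d ` {c. Poly_Mapping.keys c \<subseteq> Y}"
    using d X by (simp add: boundaries_def chain_space_def)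
  have d0: "d > 0" using d by simp
  obtain z where z: "pair z c \<noteq> 0" "\<And>x. x \<in> boundaries X (d - 1) \<Longrightarrow> pair z x = 0"
  proof (rule separating_cochain[of "boundaries X (d - 1)" c])
    show "0 \<in> boundaries X (d - 1)"
      unfolding B using d0 by (intro image_eqI[of _ _ 0]) (auto simp: boundary_def)
  next
    fix x y assume "x \<in> boundaries X (d - 1)" "y \<in> boundaries X (d - 1)"
    then obtain a b where "x = boundary d a" "y = boundary d b" "Poly_Mapping.keys a \<subseteq> Y" "Poly_Mapping.keys b \<subseteq> Y"
      unfolding B by auto
    then show "x + y \<in> boundaries X (d - 1)"
      unfolding B using d0 keys_add[of a b] by (intro image_eqI[of _ _ "a + b"]) (auto simp: boundary_add)
  next
    fix q x assume "x \<in> boundaries X (d - 1)"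
    then obtain a where "x = boundary d a" "Poly_Mapping.keys a \<subseteq> Y" unfolding B by auto
    then show "scale q x \<in> boundaries X (d - 1)"
      unfolding B using d0 keys_scale[of q a] by (intro image_eqI[of _ _ "scale q a"]) (auto simp: boundary_scale)
  qed (use nc in auto)
  have zY: "cobd z \<tau> = 0" if "\<tau> \<in> Y" for \<tau>
  proof -
    have "boundary d (Poly_Mapping.single \<tau> 1) \<in> boundaries X (d - 1)"
      unfolding B using that by (intro imageI) simp
    then have "pair z (boundary d (Poly_Mapping.single \<tau> 1)) = 0" by (rule z(2))
    then show ?thesis using d0 by (simp add: pair_boundary)
  qed
  let ?S = "ksets n d"
  obtain D e where D: "D > 0" "\<And>\<sigma>. \<sigma> \<in> ?S \<Longrightarrow> of_int (e \<sigma>) = of_int D * Poly_Mapping.lookup c \<sigma>"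
    using common_denominator[OF finite_ksets, of n d "Poly_Mapping.lookup c"] by blast
  obtain D' w where D': "D' > 0" "\<And>\<sigma>. \<sigma> \<in> ?S \<Longrightarrow> of_int (w \<sigma>) = of_int D' * z \<sigma>"
    using common_denominator[OF finite_ksets, of n d z] by blast
  have "(\<Sum>\<sigma>\<in>?S. e \<sigma> * w \<sigma>) = 0"
  proof (rule integral_pairing_zero[OF triv Y])
    fix f :: "nat set \<Rightarrow> int"
    have cob: "of_int (cobd f \<sigma>) = (cobd (\<lambda>\<rho>. of_int (f \<rho>)) \<sigma> :: rat)" for \<sigma>
      by (simp add: cobd_def fsign_def)
    \<comment> \<open>The cycle condition in dual form: \<open>c\<close> pairs to zero with every
      coboundary.\<close>
    have "of_int (\<Sum>\<sigma>\<in>?S. e \<sigma> * cobd f \<sigma>) =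
        of_int D * (\<Sum>\<sigma>\<in>?S. Poly_Mapping.lookup c \<sigma> * cobd (\<lambda>\<rho>. of_int (f \<rho>)) \<sigma>)"
      using D(2) by (simp add: cob sum_distrib_left mult.assoc cong: sum.cong)
    also have "\<dots> = of_int D * pair (cobd (\<lambda>\<rho>. of_int (f \<rho>))) c"
      using c(1) by (subst pair_superset[of ?S]) auto
    also have "\<dots> = of_int D * pair (\<lambda>\<rho>. of_int (f \<rho>)) (boundary (d - 1) c)"
      using d by (subst pair_boundary) auto
    also have "\<dots> = 0" by (simp only: c(2) pair_zero mult_zero_right)
    finally show "(\<Sum>\<sigma>\<in>?S. e \<sigma> * cobd f \<sigma>) = 0" by (simp only: of_int_eq_0_iff)
  next
    fix \<sigma> assume \<sigma>: "\<sigma> \<in> isolated n d Y"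
    then have "of_int (e \<sigma>) = (0::rat)" using D(2)[of \<sigma>] iso by (simp add: isolated_def)
    then show "e \<sigma> = 0" by simp
  next
    fix \<tau> assume \<tau>: "\<tau> \<in> Y"
    have "of_int (cobd w \<tau>) = of_int D' * cobd z \<tau>"
    proof -
      have "(\<Sum>v\<in>\<tau>. fsign \<tau> v * of_int (w (\<tau> - {v}))) = (\<Sum>v\<in>\<tau>. fsign \<tau> v * (of_int D' * z (\<tau> - {v})))"
        using D'(2) ksets_remove \<tau> Y by (intro sum.cong) auto
      then show ?thesis by (simp add: cobd_def sum_distrib_left mult_ac fsign_def)
    qed
    then have "of_int (cobd w \<tau>) = (0::rat)" using zY[OF \<tau>] by simp
    then show "cobd w \<tau> = 0" by simp
  qed
  moreover have "of_int (\<Sum>\<sigma>\<in>?S. e \<sigma> * w \<sigma>) = of_int D * of_int D' * pair z c"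
    using D(2) D'(2) c(1) by (simp add: pair_superset[of ?S] sum_distrib_left mult_ac cong: sum.cong)
  ultimately show False using z(1) D(1) D'(1) by simp
qed

text \<open>\<open>\<psi>\<close> reads off the coefficients at the isolated faces. Boundaries
  vanish there because isolated faces have no coface in \<open>Y\<close>; the converse for cycles is
  \<open>cycle_is_boundary\<close>. For surjectivity, \<open>\<sigma>\<close> together with its own
  vertex is a d-simplex outside \<open>Y\<close>, yet its boundary is a cycle of the complex, and
  \<open>\<sigma>\<close> is its only isolated facet.\<close>

lemma homology_iso_isolated:
  assumes triv: "\<And>A. cocycle n d Y A \<Longrightarrow> trivial_cocycle n d Y A" and Y: "Y \<subseteq> ksets n (Suc d)"
    and d: "d \<ge> 2" and X: "simplices X (d - 1) = ksets n d" "simplices X d = Y"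
    and own_vertex: "\<And>\<sigma>. \<sigma> \<in> isolated n d Y \<Longrightarrow>
      \<exists>v\<in>{1..n} - \<sigma>. \<forall>u\<in>\<sigma>. insert v (\<sigma> - {u}) \<notin> isolated n d Y"
  shows "vs_isomorphic class_ring (homology X (d - 1))
    (module_vec TYPE(rat) (card (isolated_simplices X (d - 1))))"
proof -
  let ?I = "isolated n d Y"
  have I: "isolated_simplices X (d - 1) = ?I"
    using d X by (simp add: isolated_simplices_def isolated_def)
  have fI: "finite ?I" by (rule finite_subset[of _ "ksets n d"]) (auto simp: isolated_def)
  define N where "N = card ?I"
  obtain h where h: "bij_betw h {0..<N} ?I" using ex_bij_betw_nat_finite[OF fI] N_def by blast
  define Z where "Z = cycles X (d - 1)"
  have Z: "Z = {c. Poly_Mapping.keys c \<subseteq> ksets n d \<and> boundary (d - 1) c = 0}"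
    unfolding Z_def cycles_def chain_space_def X(1) by simp
  define \<psi> where "\<psi> c = vec N (\<lambda>i. Poly_Mapping.lookup c (h i))" for c :: "nat set \<Rightarrow>\<^sub>0 rat"
  have d1: "d - 1 > 0" and d0: "d > 0" using d by auto
  have B: "boundaries X (d - 1) = boundary d ` {c. Poly_Mapping.keys c \<subseteq> Y}"
    using d X by (simp add: boundaries_def chain_space_def)
  have bd_cycle: "boundary d c \<in> Z" if c: "Poly_Mapping.keys c \<subseteq> ksets n (Suc d)" for c
  proof -
    have "boundary (d - 1) (boundary (Suc (d - 1)) c) = 0"
      using boundary_boundary[OF d1] c ksetsD by blast
    moreover have "Poly_Mapping.keys (boundary d c) \<subseteq> ksets n d"
      using keys_boundary[OF d0] ksets_remove c by (metis subset_iff)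
    ultimately show ?thesis using d by (simp add: Z)
  qed
  have lookup_bd: "Poly_Mapping.lookup (boundary d (Poly_Mapping.single \<tau> q)) \<rho> =
      q * cobd (\<lambda>\<rho>'. if \<rho>' = \<rho> then 1 else 0) \<tau>" for \<tau> q \<rho>
    using d0 by (simp add: lookup_eq_pair pair_boundary)
  have "vs_isomorphic class_ring (quotient_module \<lparr>carrier = Z, mult = undefined, one = undefined,
      zero = 0, add = (+), smult = scale\<rparr> (boundaries X (d - 1))) (module_vec TYPE(rat) N)"
  proof (rule vs_isomorphic_quotient[OF vec_vs, where \<psi>=\<psi>])
    fix x y assume "x \<in> Z" "y \<in> Z"
    then show "x + y \<in> Z" using keys_add[of x y] boundary_add[OF d1, of x y] by (auto simp: Z)
  next
    fix x assume x: "x \<in> Z"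
    have "- x = scale (-1) x" by (rule poly_mapping_eqI) simp
    then show "- x \<in> Z" using x keys_scale[of "-1" x] boundary_scale[OF d1, of "-1" x] by (auto simp: Z)
  next
    fix r x assume "x \<in> Z"
    then show "scale r x \<in> Z" using keys_scale[of r x] boundary_scale[OF d1, of r x]
      by (auto simp: Z intro!: poly_mapping_eqI)
  next
    show "\<psi> ` Z = carrier (module_vec TYPE(rat) N)"
    proof (intro equalityI subsetI)
      fix a assume "a \<in> \<psi> ` Z"
      then show "a \<in> carrier (module_vec TYPE(rat) N)" by (auto simp: \<psi>_def module_vec_simps)
    next
      fix a :: "rat vec" assume "a \<in> carrier (module_vec TYPE(rat) N)"
      then have a: "dim_vec a = N" by (simp add: module_vec_simps)
      define hi where "hi = inv_into {0..<N} h"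
      have hi: "hi \<sigma> < N" "h (hi \<sigma>) = \<sigma>" if "\<sigma> \<in> ?I" for \<sigma>
        using that h inv_into_into[of \<sigma> h "{0..<N}"] f_inv_into_f[of \<sigma> h "{0..<N}"]
        by (auto simp: hi_def bij_betw_def)
      have hh: "hi (h i) = i" "h i \<in> ?I" if "i < N" for i
        using that h inv_into_f_f[of h "{0..<N}" i] by (auto simp: hi_def bij_betw_def)
      obtain v where v: "\<And>\<sigma>. \<sigma> \<in> ?I \<Longrightarrow> v \<sigma> \<in> {1..n} - \<sigma> \<and> (\<forall>u\<in>\<sigma>. insert (v \<sigma>) (\<sigma> - {u}) \<notin> ?I)"
        using own_vertex by metis
      \<comment> \<open>The sign of \<open>\<sigma>\<close> in the boundary of
        \<open>insert (v \<sigma>) \<sigma>\<close>; being its own inverse, it normalises the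
        coefficient.\<close>
      define s :: "nat set \<Rightarrow> rat" where "s \<sigma> = fsign (insert (v \<sigma>) \<sigma>) (v \<sigma>)" for \<sigma>
      have s: "s \<sigma> * s \<sigma> = 1" for \<sigma> by (simp add: s_def fsign_def flip: power_add)
      define c where "c = (\<Sum>\<sigma>\<in>?I. boundary d (Poly_Mapping.single (insert (v \<sigma>) \<sigma>) (s \<sigma> * a $ hi \<sigma>)))"
      have look: "Poly_Mapping.lookup (boundary d (Poly_Mapping.single (insert (v \<sigma>) \<sigma>) (s \<sigma> * a $ hi \<sigma>))) \<rho> =
          (if \<rho> = \<sigma> then a $ hi \<sigma> else 0)" if \<sigma>: "\<sigma> \<in> ?I" and \<rho>: "\<rho> \<in> ?I" for \<sigma> \<rho>
      proof -
        have nv: "v \<sigma> \<notin> \<sigma>" "finite \<sigma>" using v[OF \<sigma>] \<sigma> ksetsD by (auto simp: isolated_def)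
        have ne: "insert (v \<sigma>) \<sigma> - {u} \<noteq> \<rho>" if "u \<in> \<sigma>" for u
        proof -
          have "insert (v \<sigma>) \<sigma> - {u} = insert (v \<sigma>) (\<sigma> - {u})" using nv that by auto
          then show ?thesis using v[OF \<sigma>] that \<rho> by metis
        qed
        have "cobd (\<lambda>\<rho>'. if \<rho>' = \<rho> then 1 else 0) (insert (v \<sigma>) \<sigma>) = (if \<rho> = \<sigma> then s \<sigma> else 0)"
        proof -
          have "(\<Sum>u\<in>\<sigma>. fsign (insert (v \<sigma>) \<sigma>) u * (if insert (v \<sigma>) \<sigma> - {u} = \<rho> then 1 else 0 :: rat)) = 0"
            using ne by (intro sum.neutral) auto
          moreover have "insert (v \<sigma>) \<sigma> - {v \<sigma>} = \<sigma>" using nv by auto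
          ultimately show ?thesis using nv by (auto simp: cobd_def s_def)
        qed
        then show ?thesis using s[of \<sigma>] by (auto simp: lookup_bd mult_ac)
      qed
      have "\<psi> c = a"
      proof (rule eq_vecI)
        fix i assume "i < dim_vec a"
        then have i: "i < N" using a by simp
        have "\<psi> c $ i = (\<Sum>\<sigma>\<in>?I. Poly_Mapping.lookup (boundary d
            (Poly_Mapping.single (insert (v \<sigma>) \<sigma>) (s \<sigma> * a $ hi \<sigma>))) (h i))"
          using i by (simp add: \<psi>_def c_def lookup_sum)
        also have "\<dots> = (\<Sum>\<sigma>\<in>?I. if h i = \<sigma> then a $ hi \<sigma> else 0)"
          using look hh(2)[OF i] by (intro sum.cong) auto
        also have "\<dots> = a $ i" using hh[OF i] fI by simp
        finally show "\<psi> c $ i = a $ i" .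
      qed (simp add: \<psi>_def a)
      moreover have "c \<in> Z"
      proof -
        have add: "x + y \<in> Z" if "x \<in> Z" "y \<in> Z" for x y
          using that keys_add[of x y] boundary_add[OF d1, of x y] by (auto simp: Z)
        have "(\<Sum>\<sigma>\<in>L. boundary d (Poly_Mapping.single (insert (v \<sigma>) \<sigma>) (s \<sigma> * a $ hi \<sigma>))) \<in> Z"
          if "finite L" "L \<subseteq> ?I" for L using that
        proof (induction L)
          case empty
          then show ?case by (simp add: Z boundary_def)
        next
          case (insert \<sigma> L)
          have "insert (v \<sigma>) \<sigma> \<in> ksets n (Suc d)"
            using insert.prems v[of \<sigma>] by (intro ksets_insert) (auto simp: isolated_def)
          then have "boundary d (Poly_Mapping.single (insert (v \<sigma>) \<sigma>) (s \<sigma> * a $ hi \<sigma>)) \<in> Z"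
            by (intro bd_cycle) auto
          then show ?case using insert by (simp add: add)
        qed
        then show ?thesis unfolding c_def using fI by blast
      qed
      ultimately show "a \<in> \<psi> ` Z" by blast
    qed
  next
    fix x y :: "nat set \<Rightarrow>\<^sub>0 rat"
    show "\<psi> (x + y) = \<psi> x \<oplus>\<^bsub>module_vec TYPE(rat) N\<^esub> \<psi> y"
      by (auto simp: \<psi>_def module_vec_simps lookup_add)
  next
    fix r and x :: "nat set \<Rightarrow>\<^sub>0 rat"
    show "\<psi> (scale r x) = r \<odot>\<^bsub>module_vec TYPE(rat) N\<^esub> \<psi> x"
      by (auto simp: \<psi>_def module_vec_simps)
  next
    have zero_iff: "\<psi> c = \<zero>\<^bsub>module_vec TYPE(rat) N\<^esub> \<longleftrightarrow> (\<forall>\<sigma>\<in>?I. Poly_Mapping.lookup c \<sigma> = 0)" for c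
    proof -
      have "?I = h ` {0..<N}" using h by (simp add: bij_betw_def)
      moreover have "\<psi> c = 0\<^sub>v N \<longleftrightarrow> (\<forall>i<N. Poly_Mapping.lookup c (h i) = 0)"
        by (auto simp: \<psi>_def vec_eq_iff)
      ultimately show ?thesis by (auto simp: module_vec_simps)
    qed
    show "boundaries X (d - 1) = {x \<in> Z. \<psi> x = \<zero>\<^bsub>module_vec TYPE(rat) N\<^esub>}"
    proof (intro equalityI subsetI)
      fix x assume "x \<in> boundaries X (d - 1)"
      then obtain c where c: "x = boundary d c" "Poly_Mapping.keys c \<subseteq> Y" unfolding B by auto
      have "Poly_Mapping.lookup x \<sigma> = 0" if \<sigma>: "\<sigma> \<in> ?I" for \<sigma>
      proof (rule ccontr)
        assume "Poly_Mapping.lookup x \<sigma> \<noteq> 0"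
        then have "\<sigma> \<in> Poly_Mapping.keys (boundary d c)" by (simp add: in_keys_iff c)
        then obtain \<tau> u where "\<tau> \<in> Poly_Mapping.keys c" "\<sigma> = \<tau> - {u}" using keys_boundary[OF d0] by metis
        then show False using \<sigma> c by (auto simp: isolated_def)
      qed
      moreover have "x \<in> Z" unfolding c(1) using c(2) Y by (intro bd_cycle) auto
      ultimately show "x \<in> {x \<in> Z. \<psi> x = \<zero>\<^bsub>module_vec TYPE(rat) N\<^esub>}" by (simp add: zero_iff)
    next
      fix x assume "x \<in> {x \<in> Z. \<psi> x = \<zero>\<^bsub>module_vec TYPE(rat) N\<^esub>}"
      then show "x \<in> boundaries X (d - 1)"
        using cycle_is_boundary[OF triv Y d X(2)] by (auto simp: Z zero_iff)
    qed
  qed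
  then show ?thesis
    unfolding I N_def[symmetric] homology_def Z_def by (simp add: chain_space_def)
qed

section \<open>Combining the events\<close>

lemma process_complex_eq:
  "process_complex d n clock t = {\<sigma>. \<sigma> \<subseteq> {1..n} \<and> \<sigma> \<noteq> {} \<and> card \<sigma> \<le> d} \<union> faces_until n d clock t"
  by (simp add: process_complex_def faces_until_def possible_faces_eq)

lemma process_complex_iso:
  assumes d: "d \<ge> 2"
    and start: "\<And>A. cocycle n d (faces_until n d clock s) A \<Longrightarrow> trivial_cocycle n d (faces_until n d clock s) A"
    and single: "\<And>\<tau> u v. \<tau> \<in> ksets n (Suc d) \<Longrightarrow> u \<in> \<tau> \<Longrightarrow> v \<in> \<tau> \<Longrightarrow> u \<noteq> v \<Longrightarrow>
      \<not> simultaneous_cover n d clock s \<tau> u v"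
    and own_vertex: "\<And>\<sigma>. \<sigma> \<in> isolated n d (faces_until n d clock s) \<Longrightarrow>
      \<exists>v\<in>{1..n} - \<sigma>. \<forall>u\<in>\<sigma>. insert v (\<sigma> - {u}) \<notin> isolated n d (faces_until n d clock s)"
    and t: "s \<le> t"
  defines "X \<equiv> process_complex d n clock t"
  shows "vs_isomorphic class_ring (homology X (d - 1))
    (module_vec TYPE(rat) (card (isolated_simplices X (d - 1))))"
proof (rule homology_iso_isolated)
  show "simplices X (d - 1) = ksets n d"
    using d by (auto simp: X_def process_complex_eq simplices_def faces_until_def ksets_def)
  show "simplices X d = faces_until n d clock t"
    by (auto simp: X_def process_complex_eq simplices_def faces_until_def ksets_def)
  \<comment> \<open>Isolated faces only become fewer, so a vertex suitable at time \<open>s\<close>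
    stays suitable.\<close>
  have sub: "isolated n d (faces_until n d clock t) \<subseteq> isolated n d (faces_until n d clock s)"
    using t by (auto simp: isolated_def faces_until_def)
  show "\<exists>v\<in>{1..n} - \<sigma>. \<forall>u\<in>\<sigma>. insert v (\<sigma> - {u}) \<notin> isolated n d (faces_until n d clock t)"
    if "\<sigma> \<in> isolated n d (faces_until n d clock t)" for \<sigma>
    using own_vertex[of \<sigma>] that sub by blast
  show "trivial_cocycle n d (faces_until n d clock t) A" if "cocycle n d (faces_until n d clock t) A" for A
    using start single t that by (rule cocycles_trivial_later)
qed (use d faces_until_subset in auto)

lemma (in face_clocks) prob_process_iso_ge:
  assumes d: "d \<ge> 2" and s: "s \<ge> 0" and n: "n > d"
  defines "p \<equiv> 1 - exp (- s)" and "N \<equiv> Suc (2 * (n - Suc d))"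
  shows "\<P>(\<omega> in M. \<forall>t\<ge>s. let Y = process_complex d n (\<lambda>\<sigma>. T \<sigma> \<omega>) t in
      vs_isomorphic class_ring (homology Y (d - 1))
        (module_vec TYPE(rat) (card (isolated_simplices Y (d - 1)))))
    \<ge> 1 - ((\<Sum>m=2..n ^ d. \<Sum>k=1..<m.
      real (n ^ Suc d * ((2 * (Suc d * n)) ^ (k - 1) * 2 ^ k * 2 ^ (Suc d * k))) *
      (p ^ k * exp (- p * max (real m * (real n - real d - real m)) (real n * real m / real (Suc d)))))
      + real n ^ Suc d * real (Suc d) ^ 2 * (2 * exp (- s) ^ N / real N)
      + real n ^ d * real d * exp (- s) ^ N)" (is "prob ?G \<ge> 1 - (?b1 + ?b2 + ?b3)")
proof -
  have n0: "n > 0" using n by simp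
  obtain E1 where E1: "E1 \<in> events"
    "{\<omega> \<in> space M. \<exists>A. cocycle n d (faces_at s \<omega>) A \<and> \<not> trivial_cocycle n d (faces_at s \<omega>) A} \<subseteq> E1"
    "prob E1 \<le> ?b1"
    unfolding p_def by (rule nontrivial_cocycle_event[OF s n0])
  obtain E2 where E2: "E2 \<in> events"
    "{\<omega> \<in> space M. \<exists>\<tau>\<in>ksets n (Suc d). \<exists>u\<in>\<tau>. \<exists>v\<in>\<tau>. u \<noteq> v \<and>
      simultaneous_cover n d (\<lambda>\<tau>. T \<tau> \<omega>) s \<tau> u v} \<subseteq> E2"
    "prob E2 \<le> ?b2"
    unfolding N_def by (rule simultaneous_cover_event[OF s])
  obtain E3 where E3: "E3 \<in> events"
    "{\<omega> \<in> space M. \<not> (\<forall>\<sigma>\<in>isolated n d (faces_at s \<omega>). \<exists>v\<in>{1..n} - \<sigma>. \<forall>u\<in>\<sigma>.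
      insert v (\<sigma> - {u}) \<notin> isolated n d (faces_at s \<omega>))} \<subseteq> E3"
    "prob E3 \<le> ?b3"
    unfolding N_def by (rule no_own_vertex_event[OF s n])
  \<comment> \<open>Homology and isolated faces depend on the process only through the set of
    present d-faces.\<close>
  have G: "?G \<in> events"
    unfolding process_complex_eq
    by (rule later_times_event[where Q="\<lambda>F. let Y = {\<sigma>. \<sigma> \<subseteq> {1..n} \<and> \<sigma> \<noteq> {} \<and> card \<sigma> \<le> d} \<union> F in
      vs_isomorphic class_ring (homology Y (d - 1))
        (module_vec TYPE(rat) (card (isolated_simplices Y (d - 1))))"])
  have sub: "space M - (E1 \<union> E2 \<union> E3) \<subseteq> ?G"
  proof
    fix \<omega> assume w: "\<omega> \<in> space M - (E1 \<union> E2 \<union> E3)"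
    have 1: "trivial_cocycle n d (faces_at s \<omega>) A" if "cocycle n d (faces_at s \<omega>) A" for A
      using w E1(2) that by blast
    have 2: "\<not> simultaneous_cover n d (\<lambda>\<tau>. T \<tau> \<omega>) s \<tau> u v"
      if "\<tau> \<in> ksets n (Suc d)" "u \<in> \<tau>" "v \<in> \<tau>" "u \<noteq> v" for \<tau> u v
      using w E2(2) that by blast
    have 3: "\<exists>v\<in>{1..n} - \<sigma>. \<forall>u\<in>\<sigma>. insert v (\<sigma> - {u}) \<notin> isolated n d (faces_at s \<omega>)"
      if "\<sigma> \<in> isolated n d (faces_at s \<omega>)" for \<sigma>
      using w E3(2) that by blast
    show "\<omega> \<in> ?G"
      using process_complex_iso[OF d 1 2 3] w unfolding Let_def by blast
  qed
  have "1 - (?b1 + ?b2 + ?b3) \<le> 1 - prob (E1 \<union> E2 \<union> E3)"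
  proof -
    have "prob (E1 \<union> E2 \<union> E3) \<le> prob (E1 \<union> E2) + prob E3"
      using E1 E2 E3 by (intro measure_Un_le) auto
    also have "prob (E1 \<union> E2) \<le> prob E1 + prob E2"
      using E1 E2 by (intro measure_Un_le) auto
    finally show ?thesis using E1(3) E2(3) E3(3) by linarith
  qed
  also have "\<dots> = prob (space M - (E1 \<union> E2 \<union> E3))"
    using E1 E2 E3 by (intro prob_compl[symmetric]) auto
  also have "\<dots> \<le> prob ?G" by (rule finite_measure_mono[OF sub G])
  finally show ?thesis .
qed

section \<open>Asymptotics\<close>

text \<open>\<open>C\<close> collects the constants of \<open>card_covered_pairs_le\<close> per face
  of \<open>K\<close>; as n p = c L, such a face contributes \<open>C * c * L\<close>. The 2 in
  \<open>\<kappa>\<close> absorbs the summation over \<open>k\<close>, by m - 1 \<le> 2^m. Below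
  \<open>M\<close> the powers of log n are paid for by n^\<delta>; from \<open>M\<close> on the
  terms are so small that even n^d of them do not matter, since \<open>8 * d + 4\<close> makes d -
  m/4 at most -(d + 1).\<close>

lemma cocycle_sum_le:
  fixes n d :: nat and c L p \<delta> :: real
  defines "C \<equiv> real (2 * Suc d * 2 * 2 ^ Suc d)" and "M \<equiv> 8 * d + 4"
  defines "\<kappa> \<equiv> 2 * C * c"
  assumes d: "d \<ge> 2" and \<delta>: "\<delta> > 0" and n: "n > 0" and L: "L = ln (real n)"
    and c: "c = real d - 1 + \<delta>" and p: "p = c * L / real n"
    and k1: "\<kappa> * L \<ge> 2" and k2: "\<kappa> * L \<le> exp (L / 12)" and k3: "\<kappa> * L \<le> exp (\<delta> / real M * L)"
    and k4: "p * (real M * (real d + real M)) \<le> 1"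
  shows "(\<Sum>m=2..n ^ d. \<Sum>k=1..<m.
      real (n ^ Suc d * ((2 * (Suc d * n)) ^ (k - 1) * 2 ^ k * 2 ^ (Suc d * k))) *
      (p ^ k * exp (- p * max (real m * (real n - real d - real m)) (real n * real m / real (Suc d)))))
    \<le> 3 * real M * exp (- \<delta> * L) + exp (- L)"
proof -
  define g where "g m = max (real m * (real n - real d - real m)) (real n * real m / real (Suc d))" for m :: nat
  have L0: "L \<ge> 0" using L n by simp
  have c0: "c > 0" using c d \<delta> by simp
  have p0: "p \<ge> 0" using p L0 c0 by simp
  have np: "real n * p = c * L" using p n by simp
  have nL: "real n ^ j = exp (real j * L)" for j :: nat
    using n by (simp add: L exp_of_nat_mult)
  have cnt: "real (n ^ Suc d * ((2 * (Suc d * n)) ^ (k - 1) * 2 ^ k * 2 ^ (Suc d * k))) * p ^ k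
      \<le> real n ^ d * (\<kappa> * L / 2) ^ k" if k: "k \<ge> 1" for k
  proof -
    obtain j where j: "k = Suc j" using k by (cases k) auto
    have "n * (2 * (Suc d * n)) ^ j \<le> (2 * (Suc d * n)) * (2 * (Suc d * n)) ^ j"
      by (intro mult_right_mono) auto
    also have "\<dots> = (2 * (Suc d * n)) ^ k" by (simp add: j)
    finally have "n ^ d * (n * (2 * (Suc d * n)) ^ j) * (2 ^ k * 2 ^ (Suc d * k)) \<le>
        n ^ d * (2 * (Suc d * n)) ^ k * (2 ^ k * 2 ^ (Suc d * k))"
      by (intro mult_right_mono mult_left_mono) auto
    also have "\<dots> = n ^ d * ((2 * Suc d * 2 * 2 ^ Suc d) * n) ^ k"
    proof -
      have "(2::nat) ^ (Suc d * k) = (2 ^ Suc d) ^ k" by (rule power_mult)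
      then show ?thesis by (simp only: power_mult_distrib mult_ac)
    qed
    finally have "n ^ Suc d * ((2 * (Suc d * n)) ^ (k - 1) * 2 ^ k * 2 ^ (Suc d * k)) \<le>
        n ^ d * ((2 * Suc d * 2 * 2 ^ Suc d) * n) ^ k"
      by (simp add: j mult_ac)
    then have "real (n ^ Suc d * ((2 * (Suc d * n)) ^ (k - 1) * 2 ^ k * 2 ^ (Suc d * k))) \<le>
        real (n ^ d * ((2 * Suc d * 2 * 2 ^ Suc d) * n) ^ k)"
      by (simp only: of_nat_le_iff)
    also have "\<dots> = real n ^ d * (C * real n) ^ k" by (simp only: C_def of_nat_mult of_nat_power)
    finally have "real (n ^ Suc d * ((2 * (Suc d * n)) ^ (k - 1) * 2 ^ k * 2 ^ (Suc d * k))) * p ^ k \<le>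
        real n ^ d * (C * real n) ^ k * p ^ k"
      by (rule mult_right_mono) (use p0 in simp)
    also have "\<dots> = real n ^ d * (C * (real n * p)) ^ k" by (simp add: power_mult_distrib mult_ac)
    also have "C * (real n * p) = \<kappa> * L / 2" by (simp add: np \<kappa>_def)
    finally show ?thesis .
  qed
  have summand: "(\<Sum>k=1..<m. real (n ^ Suc d * ((2 * (Suc d * n)) ^ (k - 1) * 2 ^ k * 2 ^ (Suc d * k))) *
      (p ^ k * exp (- p * g m))) \<le> real n ^ d * (\<kappa> * L) ^ m * exp (- p * g m)" for m
  proof -
    have "(\<Sum>k=1..<m. real (n ^ Suc d * ((2 * (Suc d * n)) ^ (k - 1) * 2 ^ k * 2 ^ (Suc d * k))) *
        (p ^ k * exp (- p * g m))) \<le> (\<Sum>k=1..<m. real n ^ d * (\<kappa> * L / 2) ^ m * exp (- p * g m))"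
    proof (rule sum_mono)
      fix k assume k: "k \<in> {1..<m}"
      have "real (n ^ Suc d * ((2 * (Suc d * n)) ^ (k - 1) * 2 ^ k * 2 ^ (Suc d * k))) * p ^ k
          \<le> real n ^ d * (\<kappa> * L / 2) ^ k" using cnt k by auto
      also have "\<dots> \<le> real n ^ d * (\<kappa> * L / 2) ^ m"
        using k k1 by (intro mult_left_mono power_increasing) auto
      finally show "real (n ^ Suc d * ((2 * (Suc d * n)) ^ (k - 1) * 2 ^ k * 2 ^ (Suc d * k))) *
          (p ^ k * exp (- p * g m)) \<le> real n ^ d * (\<kappa> * L / 2) ^ m * exp (- p * g m)"
        unfolding mult.assoc[symmetric, of _ "p ^ k"] by (intro mult_right_mono) auto
    qed
    also have "\<dots> = real (m - 1) * (real n ^ d * (\<kappa> * L / 2) ^ m * exp (- p * g m))" by simp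
    also have "\<dots> \<le> 2 ^ m * (real n ^ d * (\<kappa> * L / 2) ^ m * exp (- p * g m))"
    proof (rule mult_right_mono)
      have "m - 1 \<le> 2 ^ m" using less_exp[of m] by linarith
      then have "real (m - 1) \<le> real (2 ^ m)" by (simp only: of_nat_le_iff)
      then show "real (m - 1) \<le> 2 ^ m" by simp
    qed (use k1 in simp)
    also have "\<dots> = real n ^ d * (\<kappa> * L) ^ m * exp (- p * g m)"
      by (simp add: power_divide)
    finally show ?thesis .
  qed
  have small: "real n ^ d * (\<kappa> * L) ^ m * exp (- p * g m) \<le> 3 * exp (- \<delta> * L)" if m: "2 \<le> m" "m < M" for m
  proof -
    have M0: "real M > 0" by (simp add: M_def)
    have "(\<kappa> * L) ^ m \<le> (\<kappa> * L) ^ M" using m k1 by (intro power_increasing) auto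
    also have "\<dots> \<le> exp (\<delta> / real M * L) ^ M" using k1 k3 by (intro power_mono) auto
    also have "\<dots> = exp (\<delta> * L)" using M0 by (simp flip: exp_of_nat_mult)
    finally have 1: "(\<kappa> * L) ^ m \<le> exp (\<delta> * L)" .
    have "p * (real m * (real n - real d - real m)) \<le> p * g m"
      unfolding g_def by (rule mult_left_mono[OF max.cobounded1 p0])
    then have "- p * g m \<le> - p * (real m * (real n - real d - real m))" by simp
    \<comment> \<open>The correction d + m to n costs a factor of at most \<open>exp 1\<close>, by
      \<open>k4\<close>; this is the origin of the 3 in the bound.\<close>
    also have "\<dots> = - (real n * p) * real m + p * (real m * (real d + real m))"
      by (simp add: algebra_simps)
    also have "\<dots> \<le> - (c * L) * 2 + 1"
    proof (rule add_mono)
      show "- (real n * p) * real m \<le> - (c * L) * 2"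
        unfolding np using m c0 L0 by (simp add: mult_left_mono)
      have "p * (real m * (real d + real m)) \<le> p * (real M * (real d + real M))"
        using m p0 by (intro mult_left_mono mult_mono) auto
      then show "p * (real m * (real d + real m)) \<le> 1" using k4 by simp
    qed
    finally have 2: "exp (- p * g m) \<le> exp (- (c * L) * 2 + 1)" by simp
    have "real n ^ d * (\<kappa> * L) ^ m * exp (- p * g m) \<le>
        exp (real d * L) * exp (\<delta> * L) * exp (- (c * L) * 2 + 1)"
      unfolding nL using 1 2 by (intro mult_mono) (use k1 in auto)
    also have "\<dots> = exp ((real d + \<delta> - 2 * c) * L) * exp 1"
      by (simp add: algebra_simps flip: exp_add)
    also have "\<dots> \<le> exp (- \<delta> * L) * 3"
    proof (rule mult_mono)
      \<comment> \<open>The left side is 2 - d - \<delta>, so d \<ge> 2 is decisive. One \<delta>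
        has already been spent on the powers of log n.\<close>
      have "real d + \<delta> - 2 * c \<le> - \<delta>" using c d by simp
      then have "(real d + \<delta> - 2 * c) * L \<le> - \<delta> * L" using L0 by (rule mult_right_mono)
      then show "exp ((real d + \<delta> - 2 * c) * L) \<le> exp (- \<delta> * L)" by simp
    qed (use exp_le in auto)
    finally show ?thesis by simp
  qed
  have large: "real n ^ d * (\<kappa> * L) ^ m * exp (- p * g m) \<le> exp (- (real d + 1) * L)" if m: "M \<le> m" for m
  proof -
    have "(\<kappa> * L) ^ m \<le> exp (L / 12) ^ m" using k1 k2 by (intro power_mono) auto
    also have "\<dots> = exp (real m * L / 12)" by (simp flip: exp_of_nat_mult)
    finally have 1: "(\<kappa> * L) ^ m \<le> exp (real m * L / 12)" .
    have "p * (real n * real m / real (Suc d)) \<le> p * g m"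
      unfolding g_def by (rule mult_left_mono[OF max.cobounded2 p0])
    then have "- p * g m \<le> - p * (real n * real m / real (Suc d))" by simp
    also have "\<dots> = - ((real n * p) * real m / real (Suc d))" by simp
    also have "\<dots> = - (c / real (Suc d) * (real m * L))" by (simp add: np)
    also have "\<dots> \<le> - (1 / 3 * (real m * L))"
    proof -
      \<comment> \<open>(d - 1) / (d + 1) is smallest at d = 2, with value 1/3. Of this 1/12 goes to
        the powers of log n and 1/4 remains.\<close>
      have "1 / 3 \<le> c / real (Suc d)" using c d \<delta> by (simp add: field_simps)
      then have "1 / 3 * (real m * L) \<le> c / real (Suc d) * (real m * L)"
        using L0 by (intro mult_right_mono) auto
      then show ?thesis by simp
    qed
    finally have 2: "exp (- p * g m) \<le> exp (- (1 / 3 * (real m * L)))" by simp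
    have "real n ^ d * (\<kappa> * L) ^ m * exp (- p * g m) \<le>
        exp (real d * L) * exp (real m * L / 12) * exp (- (1 / 3 * (real m * L)))"
      unfolding nL using 1 2 by (intro mult_mono) (use k1 in auto)
    also have "\<dots> = exp ((real d - real m / 4) * L)"
      by (simp add: algebra_simps flip: exp_add)
    also have "\<dots> \<le> exp (- (real d + 1) * L)"
    proof -
      have "real M \<le> real m" using m by simp
      then have "real d - real m / 4 \<le> - (real d + 1)" by (simp add: M_def)
      then have "(real d - real m / 4) * L \<le> - (real d + 1) * L" using L0 by (rule mult_right_mono)
      then show ?thesis by simp
    qed
    finally show ?thesis .
  qed
  have "(\<Sum>m=2..n ^ d. \<Sum>k=1..<m.
      real (n ^ Suc d * ((2 * (Suc d * n)) ^ (k - 1) * 2 ^ k * 2 ^ (Suc d * k))) * (p ^ k * exp (- p * g m)))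
    \<le> (\<Sum>m=2..n ^ d. (if m < M then 3 * exp (- \<delta> * L) else 0) + exp (- (real d + 1) * L))"
  proof (rule sum_mono)
    fix m assume m: "m \<in> {2..n ^ d}"
    have "real n ^ d * (\<kappa> * L) ^ m * exp (- p * g m) \<le>
        (if m < M then 3 * exp (- \<delta> * L) else 0) + exp (- (real d + 1) * L)"
    proof (cases "m < M")
      case True
      have "real n ^ d * (\<kappa> * L) ^ m * exp (- p * g m) \<le> 3 * exp (- \<delta> * L)"
        using True m by (intro small) auto
      then show ?thesis using True by (simp add: add_increasing2)
    next
      case False
      then show ?thesis using large[of m] by simp
    qed
    then show "(\<Sum>k=1..<m. real (n ^ Suc d * ((2 * (Suc d * n)) ^ (k - 1) * 2 ^ k * 2 ^ (Suc d * k))) *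
        (p ^ k * exp (- p * g m))) \<le> (if m < M then 3 * exp (- \<delta> * L) else 0) + exp (- (real d + 1) * L)"
      by (rule order_trans[OF summand])
  qed
  also have "\<dots> = (\<Sum>m=2..n ^ d. if m < M then 3 * exp (- \<delta> * L) else 0) +
      real (card {2..n ^ d}) * exp (- (real d + 1) * L)"
    by (simp add: sum.distrib)
  also have "(\<Sum>m=2..n ^ d. if m < M then 3 * exp (- \<delta> * L) else 0) \<le> (\<Sum>m<M. 3 * exp (- \<delta> * L))"
    unfolding sum.inter_filter[symmetric, OF finite_atLeastAtMost] by (rule sum_mono2) auto
  also have "(\<Sum>m<M. 3 * exp (- \<delta> * L)) = 3 * real M * exp (- \<delta> * L)" by simp
  also have "real (card {2..n ^ d}) * exp (- (real d + 1) * L) \<le> real n ^ d * exp (- (real d + 1) * L)"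
  proof (rule mult_right_mono)
    have "card {2..n ^ d} \<le> n ^ d" by simp
    then show "real (card {2..n ^ d}) \<le> real n ^ d" by (metis of_nat_le_iff of_nat_power)
  qed simp
  also have "real n ^ d * exp (- (real d + 1) * L) = exp (- L)"
    unfolding nL by (simp add: algebra_simps flip: exp_add)
  finally show ?thesis unfolding g_def by simp
qed

text \<open>\<open>N\<close> counts the d-faces that contain one of two given facets of a common
  coface, so both are isolated with probability about n^(-2 c). In the second bound the additional
  power of n is absorbed by \<open>N\<close>, which is at least n because n > 2 d.\<close>

lemma isolated_pair_le:
  fixes n d :: nat and c L p \<delta> s :: real
  assumes d: "d \<ge> 2" and n: "n > 2 * d" and L: "L = ln (real n)"
    and c: "c = real d - 1 + \<delta>" and p: "p = c * L / real n" and s: "1 - exp (- s) = p"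
    and k: "p * (2 * real d + 1) \<le> 1"
  defines "N \<equiv> Suc (2 * (n - Suc d))"
  shows "real n ^ d * exp (- s) ^ N \<le> 3 * exp (- 2 * \<delta> * L)"
    and "real n ^ Suc d * (exp (- s) ^ N / real N) \<le> 3 * exp (- 2 * \<delta> * L)"
proof -
  have L0: "L \<ge> 0" using L n by simp
  have N: "real N = 2 * real n - 2 * real d - 1" using n by (simp add: N_def of_nat_diff)
  have "exp (- s) \<le> exp (- p)" using exp_ge_add_one_self[of "- p"] s by linarith
  then have "exp (- s) ^ N \<le> exp (- p) ^ N" by (intro power_mono) auto
  also have "\<dots> = exp (- (real N * p))" by (simp flip: exp_of_nat_mult)
  also have "real N * p = 2 * c * L - p * (2 * real d + 1)"
    unfolding N using p n by (simp add: field_simps)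
  also have "exp (- (2 * c * L - p * (2 * real d + 1))) \<le> exp (1 - 2 * c * L)" using k by simp
  finally have e: "exp (- s) ^ N \<le> exp (1 - 2 * c * L)" .
  have "real n ^ d * exp (- s) ^ N \<le> exp (real d * L) * exp (1 - 2 * c * L)"
    using n e by (intro mult_mono) (auto simp: L exp_of_nat_mult)
  also have "\<dots> = exp 1 * exp ((real d - 2 * c) * L)" by (simp add: algebra_simps flip: exp_add)
  also have "\<dots> \<le> 3 * exp (- 2 * \<delta> * L)"
  proof (rule mult_mono)
    have "real d - 2 * c \<le> - 2 * \<delta>" using c d by simp
    then have "(real d - 2 * c) * L \<le> - 2 * \<delta> * L" using L0 by (rule mult_right_mono)
    then show "exp ((real d - 2 * c) * L) \<le> exp (- 2 * \<delta> * L)" by simp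
  qed (use exp_le in auto)
  finally show 1: "real n ^ d * exp (- s) ^ N \<le> 3 * exp (- 2 * \<delta> * L)" .
  have "real n \<le> real N" unfolding N using n by linarith
  moreover have "real N > 0" by (simp add: N_def)
  ultimately have "real n / real N \<le> 1" by simp
  then have "real n ^ d * exp (- s) ^ N * (real n / real N) \<le> real n ^ d * exp (- s) ^ N * 1"
    by (intro mult_left_mono) auto
  then show "real n ^ Suc d * (exp (- s) ^ N / real N) \<le> 3 * exp (- 2 * \<delta> * L)"
    using 1 by (simp add: mult_ac)
qed

theorem theorem3p2:
  fixes d :: nat and \<delta> :: real and t0 :: "nat \<Rightarrow> real"
    and M :: "nat \<Rightarrow> 'a measure" and T :: "nat \<Rightarrow> nat set \<Rightarrow> 'a \<Rightarrow> real"
  assumes "d \<ge> 2" and "\<delta> > 0"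
    and "\<And>n. face_clocks (M n) d n (T n)"
    and "\<forall>\<^sub>F n in sequentially. 1 - exp (- t0 n) = (real d - 1 + \<delta>) * ln (real n) / real n"
  shows "(\<lambda>n. \<P>(\<omega> in M n. \<forall>t \<ge> t0 n.
           let Y = process_complex d n (\<lambda>\<sigma>. T n \<sigma> \<omega>) t in
             vs_isomorphic class_ring (homology Y (d - 1))
               (module_vec TYPE(rat) (card (isolated_simplices Y (d - 1)))))) \<longlonglongrightarrow> 1"
proof -
  define c where "c = real d - 1 + \<delta>"
  define R where "R = 8 * d + 4"
  define \<kappa> where "\<kappa> = 2 * real (2 * Suc d * 2 * 2 ^ Suc d) * c"
  define b where "b n = 3 * real R * exp (- \<delta> * ln (real n)) + exp (- ln (real n)) +
    (2 * real (Suc d) ^ 2 + real d) * (3 * exp (- 2 * \<delta> * ln (real n)))" for n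
  have c0: "c > 0" using assms(1,2) by (simp add: c_def)
  have \<kappa>0: "\<kappa> > 0" unfolding \<kappa>_def using c0 by (intro mult_pos_pos) (simp_all only: of_nat_0_less_iff, simp_all)
  have R0: "\<delta> / real R > 0" using assms(2) by (simp add: R_def)
  have grow: "\<forall>\<^sub>F n in sequentially. \<kappa> * ln (real n) \<le> exp (a * ln (real n))" if "a > 0" for a
    using \<kappa>0 that by real_asymp
  have grow12: "\<forall>\<^sub>F n in sequentially. \<kappa> * ln (real n) \<le> exp (ln (real n) / 12)"
    using grow[of "1 / 12"] by simp
  have ev1: "\<forall>\<^sub>F n in sequentially. \<kappa> * ln (real n) \<ge> 2" using \<kappa>0 by real_asymp
  have ev4: "\<forall>\<^sub>F n in sequentially. c * ln (real n) / real n * q \<le> 1" if "q > 0" for q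
    using c0 that by real_asymp
  have q: "real R * (real d + real R) > 0" by (simp add: R_def)
  have b: "b \<longlonglongrightarrow> 0"
  proof -
    have 1: "(\<lambda>n. exp (- \<delta> * ln (real n))) \<longlonglongrightarrow> 0" using assms(2) by real_asymp
    have 2: "(\<lambda>n. exp (- ln (real n))) \<longlonglongrightarrow> 0" by real_asymp
    have 3: "(\<lambda>n. exp (- 2 * \<delta> * ln (real n))) \<longlonglongrightarrow> 0" using assms(2) by real_asymp
    have "b \<longlonglongrightarrow> 3 * real R * 0 + 0 + (2 * real (Suc d) ^ 2 + real d) * (3 * 0)"
      unfolding b_def by (intro tendsto_add tendsto_mult_left 1 2 3)
    then show ?thesis by simp
  qed
  let ?P = "\<lambda>n. \<P>(\<omega> in M n. \<forall>t \<ge> t0 n.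
           let Y = process_complex d n (\<lambda>\<sigma>. T n \<sigma> \<omega>) t in
             vs_isomorphic class_ring (homology Y (d - 1))
               (module_vec TYPE(rat) (card (isolated_simplices Y (d - 1)))))"
  have "\<forall>\<^sub>F n in sequentially. 1 - b n \<le> ?P n"
    using assms(4) ev1 grow12 grow[OF R0] ev4[OF q] eventually_gt_at_top[of "2 * d"]
  proof eventually_elim
    case (elim n)
    interpret face_clocks "M n" d n "T n" by (rule assms(3))
    define L where "L = ln (real n)"
    define p where "p = c * L / real n"
    have p: "1 - exp (- t0 n) = p" using elim(1) by (simp add: p_def c_def L_def)
    have L0: "L \<ge> 0" using elim(6) by (simp add: L_def)
    then have p0: "p \<ge> 0" using c0 by (simp add: p_def)
    \<comment> \<open>The starting time is known only through \<open>p\<close>, so its sign, which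
      the clock probabilities require, is recovered from \<open>p \<ge> 0\<close>.\<close>
    then have s: "t0 n \<ge> 0" using p by (metis add_0 diff_ge_0_iff_ge exp_le_one_iff neg_le_0_iff_le)
    define N where "N = Suc (2 * (n - Suc d))"
    have k4: "p * (real R * (real d + real R)) \<le> 1" using elim(5) by (simp add: p_def L_def)
    \<comment> \<open>The smallness of \<open>p\<close> demanded by \<open>cocycle_sum_le\<close>
      thus implies the one demanded by \<open>isolated_pair_le\<close>.\<close>
    have "2 * real d + 1 \<le> real R * (real d + real R)"
    proof -
      have "2 * d + 1 \<le> R * 1" by (simp add: R_def)
      also have "\<dots> \<le> R * (d + R)" by (intro mult_left_mono) (auto simp: R_def)
      finally have "real (2 * d + 1) \<le> real (R * (d + R))" by (simp only: of_nat_le_iff)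
      then show ?thesis by simp
    qed
    then have "p * (2 * real d + 1) \<le> p * (real R * (real d + real R))" using p0 by (rule mult_left_mono)
    then have k: "p * (2 * real d + 1) \<le> 1" using k4 by simp
    have "(\<Sum>m=2..n ^ d. \<Sum>k=1..<m.
        real (n ^ Suc d * ((2 * (Suc d * n)) ^ (k - 1) * 2 ^ k * 2 ^ (Suc d * k))) *
        (p ^ k * exp (- p * max (real m * (real n - real d - real m)) (real n * real m / real (Suc d)))))
        \<le> 3 * real R * exp (- \<delta> * L) + exp (- L)"
      unfolding R_def
      by (rule cocycle_sum_le[OF assms(1,2) _ L_def c_def p_def])
        (use elim k4 in \<open>simp_all only: \<kappa>_def R_def L_def\<close>)
    moreover have "real n ^ Suc d * real (Suc d) ^ 2 * (2 * exp (- t0 n) ^ N / real N) \<le>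
        2 * real (Suc d) ^ 2 * (3 * exp (- 2 * \<delta> * L))"
    proof -
      have "2 * real (Suc d) ^ 2 * (real n ^ Suc d * (exp (- t0 n) ^ N / real N)) \<le>
          2 * real (Suc d) ^ 2 * (3 * exp (- 2 * \<delta> * L))"
        unfolding N_def
        by (intro mult_left_mono isolated_pair_le(2)[OF assms(1) elim(6) L_def c_def p_def p k]) auto
      then show ?thesis by (simp only: mult_ac times_divide_eq_right)
    qed
    moreover have "real n ^ d * real d * exp (- t0 n) ^ N \<le> real d * (3 * exp (- 2 * \<delta> * L))"
    proof -
      have "real d * (real n ^ d * exp (- t0 n) ^ N) \<le> real d * (3 * exp (- 2 * \<delta> * L))"
        unfolding N_def
        by (intro mult_left_mono isolated_pair_le(1)[OF assms(1) elim(6) L_def c_def p_def p k]) auto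
      then show ?thesis by (simp only: mult_ac)
    qed
    moreover have "n > d" using elim(6) by simp
    note prob_process_iso_ge[OF assms(1) s this]
    ultimately show ?case unfolding p N_def[symmetric] b_def L_def[symmetric]
      by (simp only: distrib_right)
  qed
  moreover have "\<forall>\<^sub>F n in sequentially. ?P n \<le> 1"
  proof (rule always_eventually, rule allI)
    fix n
    interpret face_clocks "M n" d n "T n" by (rule assms(3))
    show "?P n \<le> 1" by (rule prob_le_1)
  qed
  moreover have "(\<lambda>n. 1 - b n) \<longlonglongrightarrow> 1" using tendsto_diff[OF tendsto_const b, of 1] by simp
  ultimately show ?thesis by (rule tendsto_sandwich[OF _ _ _ tendsto_const])
qed

end
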